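(* Let $n\ge 3$ and let $M\subset\mathbb{R}^n$ be a rotational hypersurface with constant Gauss curvature $K$ such that its generating curve $\gamma$ is a graph over the axis of rotation. Let $\gamma(t)=(\varphi(t),\psi(t))$ be a parametrization of the generating curve, where $\varphi(t)$ is the radius of the meridian $(n-2)$-sphere, $\psi(t)$ is the height function and $t$ is the arclength parameter. Then: (1) When $K=0$, $M$ is a circular cone or a circular cylinder. (2) When $K\neq 0$, the inverse function of $\varphi$ is locally given by $$t-t_0=\int_{\varphi(t_0)}^{\varphi(t)}\pm\frac{d\varphi}{\sqrt{1-(K\varphi^{n-1}-C_K)^{\frac{2}{n-1}}}},$$ where the sign of the integrand agrees with the sign of $\varphi'$, $t_0$ is the initial time and $C_K$ is a real constant. Moreover, $$\psi(t)=\psi(t_0)+\int_{t_0}^{t}\sqrt{1-(\varphi'(s))^2}\,ds.$$ (3) When $K<0$ and $C_K=-1$, the corresponding hypersurface is diffeomorphic to $S^{n-2}\times[0,+\infty)$ and has finite volume.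
   Context: Let $x_1,\dots,x_n$ be the standard coordinates of $\mathbb{R}^n$, with the $x_n$-axis as axis of rotation. A rotational hypersurface is obtained by rotating a generating curve $x_1=f(x_n)>0$ ($f$ smooth, on an interval) in the $x_1x_n$-plane around the $x_n$-axis, i.e. it is given by $f(x_n)^2=\sum_{i=1}^{n-1}x_i^2$. The generating curve is parametrized by arclength as $(x_1,x_n)=(\varphi(t),\psi(t))$ with $\varphi'^2+\psi'^2=1$ and $\psi'\ge 0$. Hypersurfaces are allowed to be incomplete or to have boundary, so "cone" and "cylinder" include portions thereof (cut out by the range of $x_n$). The Gauss curvature (Gauss-Kronecker curvature) is the product of the $n-1$ principal curvatures; for $M$ it equals $K=-\varphi''\psi'^{\,n-3}/\varphi^{n-2}$. The constant $C_K$ is the integration constant determined by $K\varphi^{n-1}=(1-\varphi'^2)^{\frac{n-1}{2}}+C_K$. In (3), the corresponding hypersurface is the one generated by the solution $\varphi>0$ with $\varphi'>0$ (orientation convention), defined on a maximal interval $(-\infty,t_{\max}]$, where $t_{\max}$ is the point at which $\varphi$ attains its maximum $(-1/K)^{1/(n-1)}$ (the boundary sphere over $t_{\max}$ is included). "Volume" of the hypersurface means its $(n-1)$-dimensional volume.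
   Formalization: In (3) the hypersurface with its boundary sphere is only a C^1, not C^2, hypersurface with boundary, so "diffeomorphic to S^{n-2}×[0,+∞)" is stated as: one map that is a C^1 diffeomorphism up to the boundary and a smooth diffeomorphism of the interiors. *)

theory Defs
  imports "HOL-Analysis.Analysis"
begin

text \<open>Only meaningful for open sets. In finite dimension, continuity of all directional
  derivatives is continuity of the derivative.\<close>

primrec Ck_on_open ::
  "nat \<Rightarrow> ('a::euclidean_space \<Rightarrow> 'b::euclidean_space) \<Rightarrow> 'a set \<Rightarrow> bool" where
  "Ck_on_open 0 f S = continuous_on S f"
| "Ck_on_open (Suc k) f S =
     ((\<forall>x\<in>S. f differentiable (at x)) \<and>
      (\<forall>v. Ck_on_open k (\<lambda>x. frechet_derivative f (at x) v) S))"

text \<open>On an arbitrary subset, a map is of class C^k if near each point of the subset it is the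
  restriction of a C^k map on an open set; \<open>k = \<infinity>\<close> is smoothness.\<close>

definition Ck_on ::
  "enat \<Rightarrow> ('a::euclidean_space \<Rightarrow> 'b::euclidean_space) \<Rightarrow> 'a set \<Rightarrow> bool" where
  "Ck_on k f A \<longleftrightarrow>
     (\<forall>x\<in>A. \<exists>U g. open U \<and> x \<in> U \<and> (\<forall>j. enat j \<le> k \<longrightarrow> Ck_on_open j g U) \<and>
        (\<forall>y\<in>A \<inter> U. g y = f y))"

definition Ck_diffeomorphism ::
  "enat \<Rightarrow> 'a::euclidean_space set \<Rightarrow> 'b::euclidean_space set \<Rightarrow> ('a \<Rightarrow> 'b) \<Rightarrow> bool" where
  "Ck_diffeomorphism k A B F \<longleftrightarrow>
     bij_betw F A B \<and> Ck_on k F A \<and> Ck_on k (inv_into A F) B"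

text \<open>Hausdorff measure, normalized so that it is the usual d-dimensional volume of
  d-dimensional submanifolds. Intended for \<open>d \<ge> 1\<close> (so that empty covering sets count as 0).\<close>

definition hausdorff_premeasure :: "nat \<Rightarrow> real \<Rightarrow> 'a::metric_space set \<Rightarrow> ennreal" where
  "hausdorff_premeasure d \<delta> A =
     (INF U \<in> {U :: nat \<Rightarrow> 'a set. A \<subseteq> (\<Union>i. U i) \<and>
                 (\<forall>i. bounded (U i) \<and> diameter (U i) \<le> \<delta>)}.
        \<Sum>i. ennreal (unit_ball_vol (real d) * (diameter (U i) / 2) ^ d))"

definition hausdorff_measure :: "nat \<Rightarrow> 'a::metric_space set \<Rightarrow> ennreal" where
  "hausdorff_measure d A = (SUP \<delta>\<in>{0<..}. hausdorff_premeasure d \<delta> A)"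

text \<open>One-sided velocities are used, and their span is taken, so that the definition also gives
  the full tangent space at boundary points.\<close>

definition tangent_space :: "'a::euclidean_space set \<Rightarrow> 'a \<Rightarrow> 'a set" where
  "tangent_space M p =
     span {v. \<exists>c \<epsilon>. \<epsilon> > 0 \<and> c 0 = p \<and> c ` {0..\<epsilon>} \<subseteq> M \<and>
              (c has_vector_derivative v) (at 0 within {0..\<epsilon>})}"

definition unit_normal_field :: "'a::euclidean_space set \<Rightarrow> ('a \<Rightarrow> 'a) \<Rightarrow> bool" where
  "unit_normal_field M \<nu> \<longleftrightarrow>
     continuous_on M \<nu> \<and>
     (\<forall>p\<in>M. norm (\<nu> p) = 1 \<and> (\<forall>v\<in>tangent_space M p. inner (\<nu> p) v = 0))"

text \<open>\<open>B\<close> is an orthonormal basis of the tangent space at \<open>p\<close> consisting of eigenvectors of the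
  shape operator \<open>- d\<nu>\<close>, with eigenvalues (principal curvatures) \<open>\<kappa>\<close>. The derivative within \<open>M\<close>
  is unique on the tangent space only, which is where it is used.\<close>

definition principal_curvatures ::
  "'a::euclidean_space set \<Rightarrow> ('a \<Rightarrow> 'a) \<Rightarrow> 'a \<Rightarrow> 'a set \<Rightarrow> ('a \<Rightarrow> real) \<Rightarrow> bool" where
  "principal_curvatures M \<nu> p B \<kappa> \<longleftrightarrow>
     pairwise orthogonal B \<and> (\<forall>b\<in>B. norm b = 1) \<and> span B = tangent_space M p \<and>
     (\<exists>D. (\<nu> has_derivative D) (at p within M) \<and> (\<forall>b\<in>B. - D b = \<kappa> b *\<^sub>R b))"

definition has_gauss_curvature ::
  "'a::euclidean_space set \<Rightarrow> ('a \<Rightarrow> 'a) \<Rightarrow> 'a \<Rightarrow> real \<Rightarrow> bool" where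
  "has_gauss_curvature M \<nu> p K \<longleftrightarrow>
     (\<exists>B \<kappa>. principal_curvatures M \<nu> p B \<kappa> \<and> K = (\<Prod>b\<in>B. \<kappa> b))"

text \<open>The ambient space is \<open>(real^'m) \<times> real\<close>: the second component is the coordinate along the
  axis of rotation, the first one collects the remaining coordinates. The curve
  \<open>t \<mapsto> (r t, h t)\<close> has radius \<open>r\<close> and height \<open>h\<close>.\<close>

definition rotate_curve ::
  "real set \<Rightarrow> (real \<Rightarrow> real) \<Rightarrow> (real \<Rightarrow> real) \<Rightarrow> ((real^'m::finite) \<times> real) set" where
  "rotate_curve I r h = {(x, z). \<exists>t\<in>I. (r t)\<^sup>2 = (\<Sum>i\<in>UNIV. (x $ i)\<^sup>2) \<and> z = h t}"

text \<open>A generating curve that is a graph over the axis of rotation.\<close>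

definition generating_graph :: "real set \<Rightarrow> (real \<Rightarrow> real) \<Rightarrow> bool" where
  "generating_graph J f \<longleftrightarrow>
     is_interval J \<and> interior J \<noteq> {} \<and> Ck_on \<infinity> f J \<and> (\<forall>z\<in>J. f z > 0)"

definition arclength_curve ::
  "real set \<Rightarrow> (real \<Rightarrow> real) \<Rightarrow> (real \<Rightarrow> real) \<Rightarrow> (real \<Rightarrow> real) \<Rightarrow> (real \<Rightarrow> real) \<Rightarrow> bool" where
  "arclength_curve I \<phi> \<psi> \<phi>' \<psi>' \<longleftrightarrow>
     is_interval I \<and> Ck_on \<infinity> \<phi> I \<and> Ck_on \<infinity> \<psi> I \<and>
     (\<forall>t\<in>I. (\<phi> has_real_derivative \<phi>' t) (at t within I) \<and>
            (\<psi> has_real_derivative \<psi>' t) (at t within I) \<and>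
            (\<phi>' t)\<^sup>2 + (\<psi>' t)\<^sup>2 = 1 \<and> \<psi>' t \<ge> 0)"

text \<open>The unit normal points towards the axis. With this orientation parallels have positive
  principal curvature and the curvature is \<open>- \<phi>'' \<psi>'^(n-3) / \<phi>^(n-2)\<close>; for even \<open>n\<close> the opposite
  orientation would change its sign.\<close>

definition has_constant_gauss_curvature :: "((real^'m::finite) \<times> real) set \<Rightarrow> real \<Rightarrow> bool" where
  "has_constant_gauss_curvature M K \<longleftrightarrow>
     (\<exists>\<nu>. unit_normal_field M \<nu> \<and> (\<forall>p\<in>M. inner (fst (\<nu> p)) (fst p) < 0) \<and>
          (\<forall>p\<in>M. has_gauss_curvature M \<nu> p K))"

definition circular_cylinder :: "((real^'m::finite) \<times> real) set \<Rightarrow> bool" where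
  "circular_cylinder S \<longleftrightarrow> (\<exists>r>0. S = {(x, z). norm x = r})"

definition circular_cone :: "((real^'m::finite) \<times> real) set \<Rightarrow> bool" where
  "circular_cone S \<longleftrightarrow> (\<exists>a>0. \<exists>z0. S = {(x, z). norm x = a * \<bar>z - z0\<bar>})"

text \<open>\<open>C\<close> is the constant \<open>C\<^sub>K\<close>.\<close>

definition integration_constant ::
  "nat \<Rightarrow> real \<Rightarrow> real set \<Rightarrow> (real \<Rightarrow> real) \<Rightarrow> (real \<Rightarrow> real) \<Rightarrow> real \<Rightarrow> bool" where
  "integration_constant n K I \<phi> \<phi>' C \<longleftrightarrow>
     (\<forall>t\<in>I. K * \<phi> t ^ (n - 1) = (1 - (\<phi>' t)\<^sup>2) powr ((real n - 1) / 2) + C)"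

text \<open>The curve over the maximal interval for \<open>K < 0\<close>, \<open>C\<^sub>K = -1\<close>, oriented by \<open>\<phi>' > 0\<close>. It cannot
  be continued beyond \<open>tmax\<close>, where \<open>1 + K \<phi>^(n-1)\<close> vanishes. At \<open>tmax\<close> only continuity is
  required: the one-sided derivative of \<open>\<phi>\<close> there is 1, but \<open>\<psi>\<close> is not twice differentiable
  at that point.\<close>

definition maximal_solution ::
  "nat \<Rightarrow> real \<Rightarrow> real \<Rightarrow> (real \<Rightarrow> real) \<Rightarrow> (real \<Rightarrow> real) \<Rightarrow> bool" where
  "maximal_solution n K tmax \<phi> \<psi> \<longleftrightarrow>
     continuous_on {..tmax} \<phi> \<and> continuous_on {..tmax} \<psi> \<and>
     \<phi> tmax = (- 1 / K) powr (1 / (real n - 1)) \<and>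
     (\<exists>\<phi>' \<psi>'. arclength_curve {..<tmax} \<phi> \<psi> \<phi>' \<psi>' \<and>
        (\<forall>t<tmax. \<phi> t > 0 \<and> \<phi>' t > 0) \<and>
        integration_constant n K {..<tmax} \<phi> \<phi>' (- 1))"

end

theory Submission
  imports Defs
begin

text \<open>
  Along a meridian the parallels have principal curvature \<open>\<psi>' / \<phi>\<close> and the meridian itself has
  \<open>- \<phi>'' / \<psi>'\<close>, so constant Gauss curvature is the equation
  \<open>K \<phi>^(n-2) = - \<phi>'' \<psi>'^(n-3)\<close>. For \<open>K = 0\<close> it forces \<open>\<phi>'' = 0\<close>; in general it integrates
  to \<open>K \<phi>^(n-1) = \<psi>'^(n-1) + C\<close>, which makes \<open>\<phi>'\<close> a function of \<open>\<phi>\<close> up to sign, and the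
  integral formula is a change of variables. For \<open>K < 0\<close> and \<open>C = -1\<close> the solution is unique up to
  translation and reflection, and the hypersurface is the graph of a function of the
  distance \<open>u\<close> to the axis over a punctured ball of radius \<open>R\<close>. Inverting \<open>u = R / (1 + s)\<close>
  gives the diffeomorphism, and \<open>\<phi>'\<close> is at least of order \<open>\<phi>^((n-1)/2)\<close>, so that the
  part with \<open>\<phi>\<close> of order \<open>2^-j\<close> has volume \<open>O(2^-j)\<close>.
\<close>

section \<open>Calculus of differentiable maps\<close>

text \<open>The difficulty sits at endpoints. The curvature hypothesis becomes an equation only on
  \<open>interior I\<close>, where two-sided derivatives exist; continuity of \<open>\<phi>'\<close>
  and \<open>\<psi>'\<close> on \<open>I\<close> carries each conclusion to the ends. That the curve
  is a graph forces \<open>\<psi>' > 0\<close>, which licenses every division by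
  \<open>\<psi>'\<close>. At radius \<open>R\<close> the cosine has a root singularity, so the
  height is only C^1 there; hence a diffeomorphism that is C^1 up to the boundary sphere and smooth
  off it. Continuing the cosine by 0 makes arc length, as a function of the radius, an increasing
  bijection from the positive reals onto all reals: its inverse is differentiable at every time, and
  the tip becomes an ordinary point. The equation is separable, so uniqueness amounts to an
  identity: arc length and height composed with a solution differ from time and
  \<open>\<psi>\<close> (up to a common sign) by constants. Finite volume asks only for an upper
  bound, so explicit coverings by small pieces suffice, with a total that does not depend on their
  size.\<close>

lemma Ck_on_open_cong_imp:
  assumes "open S" "\<And>x. x \<in> S \<Longrightarrow> f x = g x" "Ck_on_open k f S"
  shows "Ck_on_open k g S"
  using assms(2,3)
proof (induction k arbitrary: f g)
  case 0
  then show ?case using continuous_on_cong by fastforce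
next
  case (Suc k)
  have d: "(g has_derivative frechet_derivative f (at x)) (at x)" if "x \<in> S" for x
    using that Suc.prems frechet_derivative_works assms(1)
    by (metis Ck_on_open.simps(2) has_derivative_transform_within_open)
  have "frechet_derivative g (at x) = frechet_derivative f (at x)" if "x \<in> S" for x
    using d[OF that] frechet_derivative_at by metis
  then show ?case
    using Suc.IH[of "\<lambda>x. frechet_derivative f (at x) v" "\<lambda>x. frechet_derivative g (at x) v" for v]
      d Suc.prems differentiableI by fastforce
qed

text \<open>Frees the derivative from \<open>frechet_derivative\<close>: any explicit formula may be
  used, because the two agree throughout the open set \<open>S\<close>.\<close>

lemma Ck_on_open_SucI:
  assumes "open S" "\<And>x. x \<in> S \<Longrightarrow> (f has_derivative f' x) (at x)"
    and "\<And>v. Ck_on_open k (\<lambda>x. f' x v) S"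
  shows "Ck_on_open (Suc k) f S"
proof -
  have "Ck_on_open k (\<lambda>x. frechet_derivative f (at x) v) S" for v
    by (rule Ck_on_open_cong_imp[OF assms(1) _ assms(3)[of v]])
       (metis assms(2) frechet_derivative_at)
  then show ?thesis using assms(2) unfolding Ck_on_open.simps differentiable_def by blast
qed

lemma Ck_on_open_SucD: "Ck_on_open (Suc k) f S \<Longrightarrow> Ck_on_open k f S"
proof (induction k arbitrary: f)
  case 0
  then show ?case
    by (simp add: continuous_at_imp_continuous_on differentiable_imp_continuous_within)
next
  case (Suc k)
  then show ?case by (metis Ck_on_open.simps(2))
qed

lemma Ck_on_open_le: "j \<le> k \<Longrightarrow> Ck_on_open k f S \<Longrightarrow> Ck_on_open j f S"
  by (induction j rule: inc_induct) (blast intro: Ck_on_open_SucD)+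

lemma Ck_on_open_derivative:
  assumes "Ck_on_open (Suc k) f S" "x \<in> S"
  shows "(f has_derivative frechet_derivative f (at x)) (at x)"
  using assms frechet_derivative_works by auto

lemma Ck_on_open_const: "open S \<Longrightarrow> Ck_on_open k (\<lambda>_. c) S"
  by (induction k arbitrary: c)
    (auto intro!: Ck_on_open_SucI[OF _ has_derivative_const] simp del: Ck_on_open.simps(2))

lemma Ck_on_open_linear:
  assumes "bounded_linear f" "open S" shows "Ck_on_open k f S"
proof (cases k)
  case 0
  then show ?thesis using assms by (simp add: linear_continuous_on)
next
  case (Suc j)
  show ?thesis unfolding Suc
    by (rule Ck_on_open_SucI[OF assms(2) bounded_linear_imp_has_derivative[OF assms(1)]
          Ck_on_open_const[OF assms(2)]])
qed

lemma Ck_on_open_add: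
  assumes "open S" "Ck_on_open k f S" "Ck_on_open k g S"
  shows "Ck_on_open k (\<lambda>x. f x + g x) S"
  using assms(2,3)
proof (induction k arbitrary: f g)
  case 0
  then show ?case by (simp add: continuous_on_add)
next
  case (Suc k)
  show ?case
    by (rule Ck_on_open_SucI[OF assms(1) has_derivative_add
          [OF Ck_on_open_derivative[OF Suc.prems(1)] Ck_on_open_derivative[OF Suc.prems(2)]]])
       (use Suc in auto)
qed

lemma Ck_on_open_bilinear:
  assumes h: "bounded_bilinear h" and "open S" "Ck_on_open k f S" "Ck_on_open k g S"
  shows "Ck_on_open k (\<lambda>x. h (f x) (g x)) S"
  using assms(3,4)
proof (induction k arbitrary: f g)
  case 0
  then show ?case by (simp add: bounded_bilinear.continuous_on[OF h])
next
  case (Suc k)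
  show ?case
  proof (rule Ck_on_open_SucI[OF assms(2)])
    show "((\<lambda>x. h (f x) (g x)) has_derivative
      (\<lambda>v. h (f x) (frechet_derivative g (at x) v) + h (frechet_derivative f (at x) v) (g x))) (at x)"
      if "x \<in> S" for x
      by (rule bounded_bilinear.FDERIV[OF h Ck_on_open_derivative[OF Suc.prems(1) that]
            Ck_on_open_derivative[OF Suc.prems(2) that]])
    show "Ck_on_open k (\<lambda>x. h (f x) (frechet_derivative g (at x) v)
             + h (frechet_derivative f (at x) v) (g x)) S" for v
      using Suc.prems by (intro Ck_on_open_add assms(2) Suc.IH Ck_on_open_SucD[of k f]
        Ck_on_open_SucD[of k g]) auto
  qed
qed

lemma Ck_on_open_sum:
  assumes "open S" "\<And>i. i \<in> A \<Longrightarrow> Ck_on_open k (f i) S"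
  shows "Ck_on_open k (\<lambda>x. \<Sum>i\<in>A. f i x) S"
  using assms(2)
  by (induction A rule: infinite_finite_induct)
     (auto intro: Ck_on_open_const Ck_on_open_add assms(1))

text \<open>The chain rule evaluates the derivative of \<open>g\<close> in the direction
  \<open>?f' x v\<close>, which moves with \<open>x\<close>, whereas the induction hypothesis speaks
  of fixed directions. Expanding that direction in \<open>Basis\<close> turns the derivative into a
  sum of products of functions to which the hypothesis applies.\<close>

lemma Ck_on_open_compose:
  assumes "open S" "open T" "f ` S \<subseteq> T" "Ck_on_open k f S" "Ck_on_open k g T"
  shows "Ck_on_open k (\<lambda>x. g (f x)) S"
  using assms(4,5)
proof (induction k arbitrary: g)
  case 0
  then show ?case using assms(3) by (auto intro: continuous_on_compose2)
next
  case (Suc k)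
  let ?f' = "\<lambda>x. frechet_derivative f (at x)" and ?g' = "\<lambda>y. frechet_derivative g (at y)"
  show ?case
  proof (rule Ck_on_open_SucI[OF assms(1)])
    fix x assume x: "x \<in> S"
    have g: "(g has_derivative ?g' (f x)) (at (f x))"
      using x assms(3) by (intro Ck_on_open_derivative[OF Suc.prems(2)]) auto
    interpret g': linear "?g' (f x)" using has_derivative_linear[OF g] .
    have "?g' (f x) (?f' x v) = (\<Sum>b\<in>Basis. (?f' x v \<bullet> b) *\<^sub>R ?g' (f x) b)" for v
    proof -
      have "?g' (f x) (?f' x v) = ?g' (f x) (\<Sum>b\<in>Basis. (?f' x v \<bullet> b) *\<^sub>R b)"
        by (simp only: euclidean_representation)
      then show ?thesis by (simp only: g'.sum g'.scale)
    qed
    with diff_chain_at[OF Ck_on_open_derivative[OF Suc.prems(1) x] g]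
    show "((\<lambda>x. g (f x)) has_derivative
        (\<lambda>v. \<Sum>b\<in>Basis. (?f' x v \<bullet> b) *\<^sub>R ?g' (f x) b)) (at x)"
      by (simp add: o_def)
  next
    show "Ck_on_open k (\<lambda>x. \<Sum>b\<in>Basis. (?f' x v \<bullet> b) *\<^sub>R ?g' (f x) b) S" for v
      using Suc.prems Ck_on_open_SucD[OF Suc.prems(1)]
      by (intro Ck_on_open_sum Ck_on_open_bilinear[OF bounded_bilinear_scaleR]
          Ck_on_open_bilinear[OF bounded_bilinear_inner] Ck_on_open_const assms(1) Suc.IH) auto
  qed
qed

lemma Ck_on_open_real_SucI:
  fixes f :: "real \<Rightarrow> real"
  assumes "open S" "\<And>x. x \<in> S \<Longrightarrow> (f has_real_derivative f' x) (at x)" "Ck_on_open k f' S"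
  shows "Ck_on_open (Suc k) f S"
  by (rule Ck_on_open_SucI[where f' = "\<lambda>x v. f' x * v"])
     (use assms in \<open>auto simp: has_field_derivative_def
        intro!: Ck_on_open_bilinear[OF bounded_bilinear_mult] Ck_on_open_const\<close>)

lemma Ck_on_open_powr: "Ck_on_open k (\<lambda>x::real. x powr a) {0<..}"
proof (induction k arbitrary: a)
  case 0
  then show ?case by (auto intro!: continuous_intros)
next
  case (Suc k)
  show ?case
    by (rule Ck_on_open_real_SucI[where f' = "\<lambda>x. a * x powr (a - 1)"])
       (auto intro!: has_real_derivative_powr Suc Ck_on_open_bilinear[OF bounded_bilinear_mult]
          Ck_on_open_const)
qed

lemma Ck_on_open_powr_compose:
  fixes f :: "'a::euclidean_space \<Rightarrow> real"
  assumes "open S" "\<And>x. x \<in> S \<Longrightarrow> 0 < f x" "Ck_on_open k f S"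
  shows "Ck_on_open k (\<lambda>x. f x powr a) S"
  by (rule Ck_on_open_compose[where T = "{0::real<..}", OF assms(1) _ _ assms(3) Ck_on_open_powr])
    (use assms(2) in auto)

lemma Ck_on_open_mult:
  fixes f g :: "'a::euclidean_space \<Rightarrow> real"
  assumes "open S" "Ck_on_open k f S" "Ck_on_open k g S"
  shows "Ck_on_open k (\<lambda>x. f x * g x) S"
  using Ck_on_open_bilinear[OF bounded_bilinear_mult assms] .

lemma Ck_on_open_diff:
  assumes "open S" "Ck_on_open k f S" "Ck_on_open k g S"
  shows "Ck_on_open k (\<lambda>x. f x - g x) S"
proof -
  have "Ck_on_open k (\<lambda>x. f x + (-1) *\<^sub>R g x) S"
    using assms by (intro Ck_on_open_add Ck_on_open_bilinear[OF bounded_bilinear_scaleR]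
        Ck_on_open_const)
  then show ?thesis by simp
qed

lemma Ck_on_open_divide:
  fixes f g :: "'a::euclidean_space \<Rightarrow> real"
  assumes "open S" "\<And>x. x \<in> S \<Longrightarrow> 0 < g x" "Ck_on_open k f S" "Ck_on_open k g S"
  shows "Ck_on_open k (\<lambda>x. f x / g x) S"
proof (rule Ck_on_open_cong_imp[OF assms(1)])
  show "Ck_on_open k (\<lambda>x. f x * g x powr (- 1)) S"
    using assms by (intro Ck_on_open_mult Ck_on_open_powr_compose)
qed (use assms(2) in \<open>auto simp: powr_minus_divide abs_of_pos\<close>)

lemma Ck_on_open_linear_compose:
  assumes "bounded_linear h" "open S" "Ck_on_open k f S"
  shows "Ck_on_open k (\<lambda>x. h (f x)) S"
  by (rule Ck_on_open_compose[OF assms(2) open_UNIV _ assms(3)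
        Ck_on_open_linear[OF assms(1) open_UNIV]]) simp

lemma Ck_on_open_Pair:
  assumes "open S" "Ck_on_open k f S" "Ck_on_open k g S"
  shows "Ck_on_open k (\<lambda>x. (f x, g x)) S"
proof -
  have "Ck_on_open k (\<lambda>x. (f x, 0) + (0, g x)) S"
    using assms bounded_linear_Pair[OF bounded_linear_ident bounded_linear_zero]
      bounded_linear_Pair[OF bounded_linear_zero bounded_linear_ident]
    by (intro Ck_on_open_add Ck_on_open_linear_compose[where h = "\<lambda>x. (x, 0)"]
        Ck_on_open_linear_compose[where h = "\<lambda>x. (0, x)"])
  then show ?thesis by simp
qed

lemma Ck_on_open_fst:
  "open S \<Longrightarrow> Ck_on_open k (fst :: 'a::euclidean_space \<times> 'b::euclidean_space \<Rightarrow> 'a) S"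
  by (rule Ck_on_open_linear[OF bounded_linear_fst])

lemma Ck_on_open_snd:
  "open S \<Longrightarrow> Ck_on_open k (snd :: 'a::euclidean_space \<times> 'b::euclidean_space \<Rightarrow> 'b) S"
  by (rule Ck_on_open_linear[OF bounded_linear_snd])

lemma Ck_on_open_norm:
  "Ck_on_open k (norm :: 'a::euclidean_space \<Rightarrow> real) (- {0})"
proof (rule Ck_on_open_cong_imp)
  show "Ck_on_open k (\<lambda>x::'a. (x \<bullet> x) powr (1/2)) (- {0})"
    by (intro Ck_on_open_powr_compose Ck_on_open_bilinear[OF bounded_bilinear_inner]
        Ck_on_open_linear) (auto intro: bounded_linear_ident)
qed (auto simp: norm_eq_sqrt_inner powr_half_sqrt)

lemma Ck_on_openI:
  assumes "open U" "A \<subseteq> U" "\<And>j. enat j \<le> k \<Longrightarrow> Ck_on_open j g U" "\<And>x. x \<in> A \<Longrightarrow> g x = f x"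
  shows "Ck_on k f A"
  unfolding Ck_on_def using assms by (metis IntD1 subsetD)

lemma Ck_on_open_deriv:
  fixes g :: "real \<Rightarrow> real"
  assumes "open U" "Ck_on_open (Suc k) g U"
  shows "x \<in> U \<Longrightarrow> (g has_real_derivative deriv g x) (at x)" "Ck_on_open k (deriv g) U"
proof -
  have d: "(g has_real_derivative deriv g x) (at x)" if "x \<in> U" for x
    using assms that by (simp add: DERIV_deriv_iff_real_differentiable)
  then show "x \<in> U \<Longrightarrow> (g has_real_derivative deriv g x) (at x)" .
  have "frechet_derivative g (at x) = (\<lambda>h. deriv g x * h)" if "x \<in> U" for x
    using frechet_derivative_at[OF d[OF that, unfolded has_field_derivative_def]] by simp
  then have eq: "frechet_derivative g (at x) 1 = deriv g x" if "x \<in> U" for x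
    using that by simp
  have "Ck_on_open k (\<lambda>x. frechet_derivative g (at x) 1) U"
    using assms(2) by simp
  then show "Ck_on_open k (deriv g) U"
    by (rule Ck_on_open_cong_imp[rotated 2]) (simp_all only: assms(1) eq)
qed

section \<open>Smooth functions on intervals and their one-sided derivatives\<close>

lemma has_real_derivative_transform_Int_open:
  fixes f g :: "real \<Rightarrow> real"
  assumes "(g has_real_derivative d) (at t within I)" "open U" "t \<in> I" "t \<in> U"
    and eq: "\<And>y. y \<in> I \<inter> U \<Longrightarrow> g y = f y"
  shows "(f has_real_derivative d) (at t within I)"
proof -
  obtain e where "e > 0" "ball t e \<subseteq> U" using assms openE by blast
  then show ?thesis
    using assms unfolding has_field_derivative_def
    by (intro has_derivative_transform_within[where d=e and f=g and g=f])
      (auto simp: dist_commute subset_eq)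
qed

text \<open>Calculus at an endpoint of \<open>I\<close> goes through a local smooth extension
  \<open>g\<close>: its two-sided \<open>deriv g\<close> represents the derivative of
  \<open>f\<close> within \<open>I\<close> and can be differentiated again.\<close>

lemma Ck_on_real_extension:
  fixes f :: "real \<Rightarrow> real"
  assumes "Ck_on \<infinity> f I" "t \<in> I"
  obtains U g where "open U" "t \<in> U" "\<And>j. Ck_on_open j g U" "\<And>y. y \<in> I \<inter> U \<Longrightarrow> g y = f y"
    "\<And>y. y \<in> I \<inter> U \<Longrightarrow> (f has_real_derivative deriv g y) (at y within I)"
    "\<And>y. y \<in> U \<Longrightarrow> (deriv g has_real_derivative deriv (deriv g) y) (at y)"
proof -
  obtain U g where U: "open U" "t \<in> U" "\<And>j. Ck_on_open j g U" "\<And>y. y \<in> I \<inter> U \<Longrightarrow> g y = f y"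
    using assms unfolding Ck_on_def by (metis enat_ord_code(3))
  have "(f has_real_derivative deriv g y) (at y within I)" if "y \<in> I \<inter> U" for y
  proof (rule has_real_derivative_transform_Int_open[of g])
    show "(g has_real_derivative deriv g y) (at y within I)"
      using that Ck_on_open_deriv(1)[OF U(1,3)] has_field_derivative_at_within by blast
  qed (use U that in auto)
  moreover have "(deriv g has_real_derivative deriv (deriv g) y) (at y)" if "y \<in> U" for y
    using Ck_on_open_deriv(1)[OF U(1) Ck_on_open_deriv(2)[OF U(1,3)] that] .
  ultimately show ?thesis using that U by blast
qed

lemma Ck_on_has_real_derivative:
  fixes f :: "real \<Rightarrow> real"
  assumes "Ck_on \<infinity> f I" "t \<in> I"
  shows "\<exists>d. (f has_real_derivative d) (at t within I)"
  using assms by (rule Ck_on_real_extension) (use assms(2) in blast)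

lemma is_interval_at_within_nontrivial:
  fixes I :: "real set"
  assumes "is_interval I" "t \<in> I" "s \<in> I" "s \<noteq> t"
  shows "at t within I \<noteq> bot"
  using assms connected_imp_perfect[of I t] is_interval_connected[of I]
  by (metis islimpt_def singletonD trivial_limit_within)

text \<open>Two distinct points make every point of \<open>I\<close> a limit point, so derivatives
  within \<open>I\<close> are unique. Hence \<open>f'\<close> agrees near each point with
  \<open>deriv g\<close> for a local extension \<open>g\<close>, and that function is
  differentiable.\<close>

lemma Ck_on_continuous_derivative:
  fixes f :: "real \<Rightarrow> real"
  assumes "Ck_on \<infinity> f I" "is_interval I" "s \<in> I" "s' \<in> I" "s \<noteq> s'"
    and f': "\<And>t. t \<in> I \<Longrightarrow> (f has_real_derivative f' t) (at t within I)"
  shows "continuous_on I f'"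
  unfolding continuous_on_eq_continuous_within
proof
  fix t assume t: "t \<in> I"
  obtain U g where U: "open U" "t \<in> U"
    "\<And>y. y \<in> I \<inter> U \<Longrightarrow> (f has_real_derivative deriv g y) (at y within I)"
    "\<And>y. y \<in> U \<Longrightarrow> (deriv g has_real_derivative deriv (deriv g) y) (at y)"
    using Ck_on_real_extension[OF assms(1) t] by metis
  have "deriv g y = f' y" if "y \<in> I \<inter> U" for y
    using that U(3) f' assms(3-5) is_interval_at_within_nontrivial[OF assms(2)]
    by (metis has_field_derivative_unique Int_iff)
  moreover obtain e where "e > 0" "ball t e \<subseteq> U" using U openE by blast
  moreover have "continuous (at t within I) (deriv g)"
    using U(2,4) DERIV_isCont continuous_at_imp_continuous_at_within by blast
  ultimately show "continuous (at t within I) f'"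
    using t by (elim continuous_transform_within) (auto simp: dist_commute subset_eq)
qed

lemma Ck_on_second_derivative:
  fixes f :: "real \<Rightarrow> real"
  assumes "Ck_on \<infinity> f I" "t \<in> interior I"
    and f': "\<And>t. t \<in> interior I \<Longrightarrow> (f has_real_derivative f' t) (at t)"
  shows "\<exists>d. (f' has_real_derivative d) (at t)"
proof -
  have t: "t \<in> I" using assms(2) interior_subset by blast
  obtain U g where U: "open U" "t \<in> U"
    "\<And>y. y \<in> I \<inter> U \<Longrightarrow> (f has_real_derivative deriv g y) (at y within I)"
    "\<And>y. y \<in> U \<Longrightarrow> (deriv g has_real_derivative deriv (deriv g) y) (at y)"
    using Ck_on_real_extension[OF assms(1) t] by metis
  have "deriv g y = f' y" if "y \<in> interior I \<inter> U" for y
  proof (rule DERIV_unique)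
    show "(f has_real_derivative deriv g y) (at y)"
      using that U(3)[of y] at_within_interior[of y I] interior_subset by fastforce
  qed (use that f' in auto)
  then have "(f' has_real_derivative deriv (deriv g) t) (at t)"
    by (rule has_field_derivative_transform_within_open[OF U(4)[OF U(2)] open_Int[OF open_interior U(1)]
        IntI[OF assms(2) U(2)]])
  then show ?thesis ..
qed

section \<open>Gauss curvature of rotational hypersurfaces\<close>

text \<open>The eigenbasis in \<open>principal_curvatures\<close> is arbitrary, so its product must
  be shown to depend only on the operator. Splitting \<open>b\<close> along \<open>\<tau>\<close>
  shows that \<open>b\<close> has eigenvalue \<open>\<rho>\<close> if orthogonal to
  \<open>\<tau>\<close> and \<open>\<mu>\<close> otherwise. If \<open>\<mu>\<close> and
  \<open>\<rho>\<close> differ, every \<open>b\<close> of the second kind is a multiple of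
  \<open>\<tau>\<close>; two of these cannot be orthogonal, and one exists because
  \<open>\<tau>\<close> lies in the span.\<close>

lemma prod_eigenvalues:
  fixes B :: "'a::euclidean_space set"
  assumes B: "pairwise orthogonal B" "\<And>b. b \<in> B \<Longrightarrow> norm b = 1"
    and D: "linear D" "\<And>b. b \<in> B \<Longrightarrow> - D b = \<kappa> b *\<^sub>R b"
    and \<tau>: "\<tau> \<in> span B" "norm \<tau> = 1" "- D \<tau> = \<mu> *\<^sub>R \<tau>"
    and \<rho>: "\<And>w. w \<in> span B \<Longrightarrow> w \<bullet> \<tau> = 0 \<Longrightarrow> - D w = \<rho> *\<^sub>R w"
  shows "(\<Prod>b\<in>B. \<kappa> b) = \<mu> * \<rho> ^ (dim (span B) - 1)"
proof -
  interpret D: linear D by fact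
  have "0 \<notin> B" using B(2) by force
  then have indep: "independent B" by (rule pairwise_orthogonal_independent[OF B(1)])
  then have fin: "finite B" and card: "card B = dim (span B)"
    by (auto simp: independent_imp_finite dim_eq_card_independent)
  have \<tau>1: "\<tau> \<bullet> \<tau> = 1" using \<tau>(2) by (simp add: norm_eq_sqrt_inner)
  have key: "\<kappa> b *\<^sub>R b = (\<mu> * (b \<bullet> \<tau>)) *\<^sub>R \<tau> + \<rho> *\<^sub>R (b - (b \<bullet> \<tau>) *\<^sub>R \<tau>)" if "b \<in> B" for b
  proof -
    define w where "w = b - (b \<bullet> \<tau>) *\<^sub>R \<tau>"
    have "w \<in> span B" unfolding w_def using that \<tau>(1)
      by (intro span_diff span_scale) (auto intro: span_base)
    moreover have "w \<bullet> \<tau> = 0" by (simp add: w_def inner_diff_left \<tau>1)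
    ultimately have "- D w = \<rho> *\<^sub>R w" by (rule \<rho>)
    moreover have "- D b = (b \<bullet> \<tau>) *\<^sub>R (- D \<tau>) + - D w"
      by (simp add: w_def D.diff D.scale)
    ultimately show ?thesis using D(2)[OF that] \<tau>(3) by (simp add: w_def mult.commute)
  qed
  have \<kappa>\<mu>: "\<kappa> b * (b \<bullet> \<tau>) = \<mu> * (b \<bullet> \<tau>)" if "b \<in> B" for b
    using arg_cong[OF key[OF that], of "\<lambda>x. x \<bullet> \<tau>"] \<tau>1
    by (simp add: inner_add_left inner_diff_left)
  have \<kappa>\<rho>: "\<kappa> b = \<rho>" if "b \<in> B" "b \<bullet> \<tau> = 0" for b
    using key[OF that(1)] that \<open>0 \<notin> B\<close> by auto
  obtain b0 where b0: "b0 \<in> B" "b0 \<bullet> \<tau> \<noteq> 0"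
  proof (rule ccontr)
    assume "\<not> thesis"
    then have "\<And>b. b \<in> B \<Longrightarrow> orthogonal \<tau> b"
      using that by (auto simp: orthogonal_def inner_commute)
    then have "orthogonal \<tau> \<tau>" using \<tau>(1) by (rule orthogonal_to_span[rotated])
    then show False using \<tau>1 by (simp add: orthogonal_def)
  qed
  have "\<kappa> b = \<rho>" if b: "b \<in> B - {b0}" for b
  proof (cases "\<mu> = \<rho>")
    case True
    then show ?thesis using \<kappa>\<mu>[of b] \<kappa>\<rho>[of b] b by fastforce
  next
    case False
    have par: "x = (x \<bullet> \<tau>) *\<^sub>R \<tau>" if "x \<in> B" "x \<bullet> \<tau> \<noteq> 0" for x
    proof -
      have "\<kappa> x = \<mu>" using \<kappa>\<mu>[OF that(1)] that(2) by simp
      then have "(\<mu> - \<rho>) *\<^sub>R (x - (x \<bullet> \<tau>) *\<^sub>R \<tau>) = 0"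
        using key[OF that(1)] by (simp add: algebra_simps)
      then show ?thesis using False by simp
    qed
    have "b \<bullet> b0 = 0"
      using B(1) b b0(1) by (auto simp: pairwise_def orthogonal_def)
    moreover have "b \<bullet> b0 = (b \<bullet> \<tau>) * (b0 \<bullet> \<tau>)"
      by (subst par[OF b0]) simp
    ultimately show ?thesis using \<kappa>\<rho> b b0 by auto
  qed
  then have "(\<Prod>b\<in>B - {b0}. \<kappa> b) = \<rho> ^ (card B - 1)"
    using b0 fin by (simp add: card_Diff_singleton)
  moreover have "\<kappa> b0 = \<mu>" using \<kappa>\<mu> b0 by auto
  ultimately show ?thesis
    using prod.remove[OF fin b0(1), of \<kappa>] card by simp
qed

lemma rotate_curve_eq:
  fixes x :: "real ^ 'm::finite"
  assumes "\<And>t. t \<in> I \<Longrightarrow> r t > 0"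
  shows "(x, z) \<in> rotate_curve I r h \<longleftrightarrow> (\<exists>t\<in>I. norm x = r t \<and> z = h t)"
proof -
  have "(\<Sum>i\<in>UNIV. (x $ i)\<^sup>2) = (norm x)\<^sup>2"
    by (simp add: norm_vec_def L2_set_def sum_nonneg)
  moreover have "norm x = r t \<longleftrightarrow> (r t)\<^sup>2 = (norm x)\<^sup>2" if "t \<in> I" for t
    using assms[OF that] by auto
  ultimately show ?thesis by (auto simp: rotate_curve_def)
qed

text \<open>The derivative of the normal field is only taken within \<open>M\<close>; on a velocity
  of a curve in \<open>M\<close> it is pinned down by differentiating the field along that curve,
  one-sidedly.\<close>

lemma derivative_along_curve:
  fixes \<nu> :: "'a::euclidean_space \<Rightarrow> 'b::euclidean_space"
  assumes "(\<nu> has_derivative D) (at (c 0) within M)" "\<epsilon> > 0" "c ` {0..\<epsilon>} \<subseteq> M"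
    and "(c has_vector_derivative w) (at 0 within {0..\<epsilon>})"
    and "((\<lambda>s. \<nu> (c s)) has_vector_derivative w') (at 0 within {0..\<epsilon>})"
  shows "D w = w'"
proof -
  have "((\<nu> \<circ> c) has_vector_derivative D w) (at 0 within {0..\<epsilon>})"
    using assms by (intro vector_derivative_diff_chain_within has_derivative_subset[OF assms(1)])
  then show ?thesis
    using assms(2,5)
    by (intro vector_derivative_unique_within_closed_interval[of 0 \<epsilon> 0 "\<nu> \<circ> c"])
      (simp_all add: o_def)
qed

text \<open>The pointwise geometry needs the curve only at interior parameters. There
  \<open>\<psi>' > 0\<close> keeps the normal from being parallel to the axis, so the inward
  condition can select one of the two unit normals.\<close>

locale rotational_hypersurface =
  fixes I :: "real set" and \<phi> \<psi> \<phi>' \<psi>' :: "real \<Rightarrow> real"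
    and M :: "((real^'m::finite) \<times> real) set" and \<nu> :: "(real^'m) \<times> real \<Rightarrow> (real^'m) \<times> real"
  assumes M_eq: "M = rotate_curve I \<phi> \<psi>"
    and pos: "t \<in> I \<Longrightarrow> \<phi> t > 0"
    and deriv_\<phi>: "t \<in> interior I \<Longrightarrow> (\<phi> has_real_derivative \<phi>' t) (at t)"
    and deriv_\<psi>: "t \<in> interior I \<Longrightarrow> (\<psi> has_real_derivative \<psi>' t) (at t)"
    and unit: "t \<in> interior I \<Longrightarrow> (\<phi>' t)\<^sup>2 + (\<psi>' t)\<^sup>2 = 1"
    and \<psi>'_pos: "t \<in> interior I \<Longrightarrow> \<psi>' t > 0"
    and normal: "unit_normal_field M \<nu>"
    and inward: "p \<in> M \<Longrightarrow> fst (\<nu> p) \<bullet> fst p < 0"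
begin

lemma mem_M: "t \<in> I \<Longrightarrow> norm u = 1 \<Longrightarrow> (\<phi> t *\<^sub>R u, \<psi> t) \<in> M"
  using pos unfolding M_eq by (subst rotate_curve_eq) force+

lemma meridian:
  assumes "t \<in> interior I" "norm u = 1"
  obtains \<epsilon> where "\<epsilon> > 0" "(\<lambda>s. (\<phi> (t + s) *\<^sub>R u, \<psi> (t + s))) ` {0..\<epsilon>} \<subseteq> M"
    "\<And>s. s \<in> {0..\<epsilon>} \<Longrightarrow> t + s \<in> interior I"
    "((\<lambda>s. (\<phi> (t + s) *\<^sub>R u, \<psi> (t + s))) has_vector_derivative (\<phi>' t *\<^sub>R u, \<psi>' t))
       (at 0 within {0..\<epsilon>})"
proof -
  obtain e where "e > 0" "cball t e \<subseteq> interior I"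
    using assms(1) open_contains_cball by blast
  then have e: "\<And>s. s \<in> {0..e} \<Longrightarrow> t + s \<in> interior I" by (auto simp: subset_eq dist_real_def)
  have "((\<lambda>s. \<phi> (t + s)) has_real_derivative \<phi>' t) (at 0)"
    "((\<lambda>s. \<psi> (t + s)) has_real_derivative \<psi>' t) (at 0)"
    using deriv_\<phi>[OF assms(1)] deriv_\<psi>[OF assms(1)] DERIV_shift[of _ _ 0 t]
    by (simp_all add: add.commute)
  then have "((\<lambda>s. (\<phi> (t + s) *\<^sub>R u, \<psi> (t + s))) has_vector_derivative (\<phi>' t *\<^sub>R u, \<psi>' t)) (at 0)"
    by (auto intro!: derivative_eq_intros has_vector_derivative_Pair
        simp: has_real_derivative_iff_has_vector_derivative)
  then have "((\<lambda>s. (\<phi> (t + s) *\<^sub>R u, \<psi> (t + s))) has_vector_derivative (\<phi>' t *\<^sub>R u, \<psi>' t))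
      (at 0 within {0..e})"
    by (rule has_vector_derivative_at_within)
  moreover have "(\<lambda>s. (\<phi> (t + s) *\<^sub>R u, \<psi> (t + s))) ` {0..e} \<subseteq> M"
    using e mem_M[OF _ assms(2)] interior_subset by blast
  ultimately show ?thesis
    by (intro that[OF \<open>e > 0\<close> _ e])
qed

lemma parallel:
  assumes "t \<in> I" "norm u = 1" "norm v = 1" "u \<bullet> v = 0"
  shows "(\<lambda>s. (\<phi> t *\<^sub>R (cos s *\<^sub>R u + sin s *\<^sub>R v), \<psi> t)) ` {0..1} \<subseteq> M"
    and "\<And>s. norm (cos s *\<^sub>R u + sin s *\<^sub>R v) = 1"
    and "((\<lambda>s. (\<phi> t *\<^sub>R (cos s *\<^sub>R u + sin s *\<^sub>R v), \<psi> t)) has_vector_derivative (\<phi> t *\<^sub>R v, 0))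
       (at 0 within {0..1})"
proof -
  show n: "norm (cos s *\<^sub>R u + sin s *\<^sub>R v) = 1" for s
  proof -
    have "(norm (cos s *\<^sub>R u + sin s *\<^sub>R v))\<^sup>2 = (cos s)\<^sup>2 + (sin s)\<^sup>2"
      using assms(2-4) unfolding power2_norm_eq_inner
      by (simp add: inner_add_left inner_add_right norm_eq_1 inner_commute power2_eq_square)
    then show ?thesis by (simp add: abs_square_eq_1)
  qed
  show "(\<lambda>s. (\<phi> t *\<^sub>R (cos s *\<^sub>R u + sin s *\<^sub>R v), \<psi> t)) ` {0..1} \<subseteq> M"
    using mem_M[OF assms(1) n] by blast
  show "((\<lambda>s. (\<phi> t *\<^sub>R (cos s *\<^sub>R u + sin s *\<^sub>R v), \<psi> t)) has_vector_derivative (\<phi> t *\<^sub>R v, 0))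
       (at 0 within {0..1})"
    by (auto intro!: derivative_eq_intros has_vector_derivative_Pair)
qed

lemma tangent_meridian:
  assumes "t \<in> interior I" "norm u = 1"
  shows "(\<phi>' t *\<^sub>R u, \<psi>' t) \<in> tangent_space M (\<phi> t *\<^sub>R u, \<psi> t)"
proof -
  obtain \<epsilon> where "\<epsilon> > 0" "(\<lambda>s. (\<phi> (t + s) *\<^sub>R u, \<psi> (t + s))) ` {0..\<epsilon>} \<subseteq> M"
    "\<And>s. s \<in> {0..\<epsilon>} \<Longrightarrow> t + s \<in> interior I"
    "((\<lambda>s. (\<phi> (t + s) *\<^sub>R u, \<psi> (t + s))) has_vector_derivative (\<phi>' t *\<^sub>R u, \<psi>' t))
       (at 0 within {0..\<epsilon>})"
    by (rule meridian[OF assms]) (rule that)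
  then show ?thesis
    unfolding tangent_space_def
    by (intro span_base CollectI exI[of _ "\<lambda>s. (\<phi> (t + s) *\<^sub>R u, \<psi> (t + s))"] exI[of _ \<epsilon>]) simp
qed

lemma tangent_parallel:
  assumes "t \<in> I" "norm u = 1" "u \<bullet> v = 0"
  shows "(v, 0) \<in> tangent_space M (\<phi> t *\<^sub>R u, \<psi> t)"
proof (cases "v = 0")
  case True
  then show ?thesis by (simp add: tangent_space_def span_zero flip: zero_prod_def)
next
  case False
  define w where "w = v /\<^sub>R norm v"
  have w: "norm w = 1" "u \<bullet> w = 0" using False assms by (auto simp: w_def)
  have "(\<phi> t *\<^sub>R w, 0) \<in> tangent_space M (\<phi> t *\<^sub>R u, \<psi> t)"
    unfolding tangent_space_def using parallel[OF assms(1,2) w]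
    by (intro span_base CollectI
        exI[of _ "\<lambda>s. (\<phi> t *\<^sub>R (cos s *\<^sub>R u + sin s *\<^sub>R w), \<psi> t)"] exI[of _ 1]) simp
  then have "(norm v / \<phi> t) *\<^sub>R (\<phi> t *\<^sub>R w, 0::real) \<in> tangent_space M (\<phi> t *\<^sub>R u, \<psi> t)"
    unfolding tangent_space_def by (rule span_scale)
  then show ?thesis using pos[OF assms(1)] False by (simp add: w_def)
qed

text \<open>Orthogonality to the parallels puts the normal into the plane of \<open>u\<close> and
  the axis. Orthogonality to the meridian and unit length then give \<open>x\<close> squared equal
  to \<open>\<psi>' t\<close> squared, because both velocity and normal are unit vectors in that
  plane; the inward condition fixes the sign.\<close>

lemma normal_eq:
  assumes "t \<in> interior I" "norm u = 1"
  shows "\<nu> (\<phi> t *\<^sub>R u, \<psi> t) = (- \<psi>' t *\<^sub>R u, \<phi>' t)"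
proof -
  let ?p = "(\<phi> t *\<^sub>R u, \<psi> t)"
  have t: "t \<in> I" using assms(1) interior_subset by blast
  obtain a \<beta> where a: "\<nu> ?p = (a, \<beta>)" by fastforce
  have p: "?p \<in> M" using mem_M t assms(2) by blast
  have perp: "\<And>v. v \<in> tangent_space M ?p \<Longrightarrow> (a, \<beta>) \<bullet> v = 0" and n1: "norm (a, \<beta>) = 1"
    using normal p unfolding unit_normal_field_def by (simp_all flip: a)
  have u1: "u \<bullet> u = 1" using assms(2) by (simp add: norm_eq_1)
  define x where "x = a \<bullet> u"
  have "u \<bullet> (a - x *\<^sub>R u) = 0" by (simp add: inner_diff_right u1 x_def inner_commute)
  then have "a \<bullet> (a - x *\<^sub>R u) = 0"
    using perp[OF tangent_parallel[OF t assms(2)]] by force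
  then have "(a - x *\<^sub>R u) \<bullet> (a - x *\<^sub>R u) = 0"
    using \<open>u \<bullet> (a - x *\<^sub>R u) = 0\<close> by (simp add: inner_diff_left)
  then have ax: "a = x *\<^sub>R u" by simp
  have 1: "x * \<phi>' t + \<beta> * \<psi>' t = 0"
    using perp[OF tangent_meridian[OF assms]] u1 by (simp add: ax mult.commute)
  have 2: "x\<^sup>2 + \<beta>\<^sup>2 = 1"
    using n1 by (simp add: norm_eq_1 ax u1 power2_eq_square)
  have "x * \<phi> t < 0" using inward[OF p] by (simp add: a ax u1 mult.commute)
  then have neg: "x < 0" using pos[OF t] by (simp add: mult_less_0_iff)
  have "x\<^sup>2 * 1 = (\<psi>' t)\<^sup>2"
    using 1 2 unit[OF assms(1)] by algebra
  then have "x = - \<psi>' t" using neg \<psi>'_pos[OF assms(1)] by (simp add: power2_eq_iff)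
  moreover have "\<beta> = \<phi>' t" using 1 \<psi>'_pos[OF assms(1)] \<open>x = - \<psi>' t\<close> by simp
  ultimately show ?thesis using a ax by simp
qed

text \<open>A vector orthogonal to the normal is a multiple of the meridian velocity plus a
  horizontal vector orthogonal to \<open>u\<close>. Knowing the whole hyperplane gives the
  dimension, hence the multiplicity of the parallel curvature.\<close>

lemma tangent_space_eq:
  assumes "t \<in> interior I" "norm u = 1"
  shows "tangent_space M (\<phi> t *\<^sub>R u, \<psi> t) = {w. (- \<psi>' t *\<^sub>R u, \<phi>' t) \<bullet> w = 0}"
    (is "?W = ?N")
proof
  have t: "t \<in> I" using assms(1) interior_subset by blast
  show "?W \<subseteq> ?N"
    using normal mem_M[OF t assms(2)] normal_eq[OF assms] unfolding unit_normal_field_def by force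
  show "?N \<subseteq> ?W"
  proof
    fix w assume w: "w \<in> ?N"
    define c where "c = w \<bullet> (\<phi>' t *\<^sub>R u, \<psi>' t)"
    obtain y z where yz: "w = (y, z)" by fastforce
    have u1: "u \<bullet> u = 1" using assms(2) by (simp add: norm_eq_1)
    define x where "x = y \<bullet> u"
    have 1: "- \<psi>' t * x + \<phi>' t * z = 0" using w by (simp add: yz x_def inner_commute mult.commute)
    have 2: "c = x * \<phi>' t + z * \<psi>' t" by (simp add: c_def yz x_def)
    have z: "z - c * \<psi>' t = 0" and x: "x - c * \<phi>' t = 0"
      using 1 2 unit[OF assms(1)] by algebra+
    have "u \<bullet> (y - (c * \<phi>' t) *\<^sub>R u) = 0"
      using x by (simp add: inner_diff_right u1 x_def inner_commute)
    then have "(y - (c * \<phi>' t) *\<^sub>R u, 0) \<in> ?W" by (rule tangent_parallel[OF t assms(2)])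
    moreover have "c *\<^sub>R (\<phi>' t *\<^sub>R u, \<psi>' t) \<in> ?W"
      using tangent_meridian[OF assms] unfolding tangent_space_def by (rule span_scale)
    ultimately have "(y - (c * \<phi>' t) *\<^sub>R u, 0) + c *\<^sub>R (\<phi>' t *\<^sub>R u, \<psi>' t) \<in> ?W"
      unfolding tangent_space_def by (rule span_add)
    then show "w \<in> ?W" using z by (simp add: yz)
  qed
qed

text \<open>Differentiating the explicit normal along great circles and along the meridian gives
  eigenvalue \<open>\<psi>' / \<phi>\<close> with multiplicity \<open>CARD('m) - 1\<close> and the
  simple eigenvalue \<open>- \<phi>2 / \<psi>'\<close>; in the product one factor
  \<open>\<psi>'\<close> cancels.\<close>

lemma gauss_curvature_eq:
  assumes t: "t \<in> interior I"
    and \<phi>2: "(\<phi>' has_real_derivative \<phi>2) (at t)" and \<psi>2: "(\<psi>' has_real_derivative \<psi>2) (at t)"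
    and K: "\<And>p. p \<in> M \<Longrightarrow> has_gauss_curvature M \<nu> p K"
    and card: "CARD('m) \<ge> 2"
  shows "K * \<phi> t ^ (CARD('m) - 1) = - \<phi>2 * \<psi>' t ^ (CARD('m) - 2)"
    and "\<phi>' t * \<phi>2 + \<psi>' t * \<psi>2 = 0"
proof -
  have tI: "t \<in> I" using t interior_subset by blast
  obtain u :: "real^'m" where u: "norm u = 1" using vector_choose_size zero_le_one by blast
  have u1: "u \<bullet> u = 1" using u by (simp add: norm_eq_1)
  let ?p = "(\<phi> t *\<^sub>R u, \<psi> t)"
  define \<tau> where "\<tau> = (\<phi>' t *\<^sub>R u, \<psi>' t)"
  obtain B \<kappa> D where B: "pairwise orthogonal B" "\<forall>b\<in>B. norm b = 1"
    and span: "span B = tangent_space M ?p"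
    and D: "(\<nu> has_derivative D) (at ?p within M)" "\<forall>b\<in>B. - D b = \<kappa> b *\<^sub>R b"
    and K_eq: "K = (\<Prod>b\<in>B. \<kappa> b)"
    using K[OF mem_M[OF tI u]] unfolding has_gauss_curvature_def principal_curvatures_def by metis
  have W: "span B = {w. (- \<psi>' t *\<^sub>R u, \<phi>' t) \<bullet> w = 0}"
    using span tangent_space_eq[OF t u] by simp
  have D_par: "- D (v, 0) = (\<psi>' t / \<phi> t) *\<^sub>R (v, 0)" if v: "u \<bullet> v = 0" for v
  proof (cases "v = 0")
    case True
    then show ?thesis using D(1) by (simp add: has_derivative_linear linear_0 flip: zero_prod_def)
  next
    case False
    define w where "w = v /\<^sub>R norm v"
    have w: "norm w = 1" "u \<bullet> w = 0" using False v by (auto simp: w_def)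
    note par = parallel[OF tI u w]
    have "D (\<phi> t *\<^sub>R w, 0) = (- \<psi>' t *\<^sub>R w, 0)"
    proof (rule derivative_along_curve[OF _ _ par(1,3)])
      have "((\<lambda>s. (- \<psi>' t *\<^sub>R (cos s *\<^sub>R u + sin s *\<^sub>R w), \<phi>' t))
          has_vector_derivative (- \<psi>' t *\<^sub>R w, 0)) (at 0 within {0..1})"
        by (auto intro!: derivative_eq_intros has_vector_derivative_Pair)
      then show "((\<lambda>s. \<nu> (\<phi> t *\<^sub>R (cos s *\<^sub>R u + sin s *\<^sub>R w), \<psi> t))
          has_vector_derivative (- \<psi>' t *\<^sub>R w, 0)) (at 0 within {0..1})"
        using normal_eq[OF t par(2)] by simp
    qed (use D in simp_all)
    moreover have "(v, 0) = (norm v / \<phi> t) *\<^sub>R (\<phi> t *\<^sub>R w, 0::real)"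
      using pos[OF tI] False by (simp add: w_def)
    ultimately have "D (v, 0) = (norm v / \<phi> t) *\<^sub>R (- \<psi>' t *\<^sub>R w, 0)"
      using linear_scale[OF has_derivative_linear[OF D(1)]] by metis
    then show ?thesis using False by (simp add: w_def)
  qed
  have "((\<lambda>s. (\<phi>' s)\<^sup>2 + (\<psi>' s)\<^sup>2) has_real_derivative 2 * (\<phi>' t * \<phi>2 + \<psi>' t * \<psi>2)) (at t)"
    by (auto intro!: derivative_eq_intros \<phi>2 \<psi>2)
  moreover have "((\<lambda>s. (\<phi>' s)\<^sup>2 + (\<psi>' s)\<^sup>2) has_real_derivative 0) (at t)"
    by (rule has_field_derivative_transform_within_open[OF DERIV_const open_interior t])
       (simp add: unit)
  ultimately show rel: "\<phi>' t * \<phi>2 + \<psi>' t * \<psi>2 = 0"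
    using DERIV_unique by fastforce
  have D_\<tau>: "D \<tau> = (- \<psi>2 *\<^sub>R u, \<phi>2)"
  proof -
    obtain \<epsilon> where \<epsilon>: "\<epsilon> > 0" "(\<lambda>s. (\<phi> (t + s) *\<^sub>R u, \<psi> (t + s))) ` {0..\<epsilon>} \<subseteq> M"
      "\<And>s. s \<in> {0..\<epsilon>} \<Longrightarrow> t + s \<in> interior I"
      "((\<lambda>s. (\<phi> (t + s) *\<^sub>R u, \<psi> (t + s))) has_vector_derivative (\<phi>' t *\<^sub>R u, \<psi>' t))
         (at 0 within {0..\<epsilon>})"
      by (rule meridian[OF t u]) (rule that)
    show ?thesis
    proof (rule derivative_along_curve[OF _ \<epsilon>(1,2) \<epsilon>(4)[folded \<tau>_def]])
      have "((\<lambda>s. \<phi>' (t + s)) has_real_derivative \<phi>2) (at 0)"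
        "((\<lambda>s. \<psi>' (t + s)) has_real_derivative \<psi>2) (at 0)"
        using \<phi>2 \<psi>2 DERIV_shift[of _ _ 0 t] by (simp_all add: add.commute)
      then have "((\<lambda>s. (- \<psi>' (t + s) *\<^sub>R u, \<phi>' (t + s))) has_vector_derivative (- \<psi>2 *\<^sub>R u, \<phi>2)) (at 0)"
        by (auto intro!: derivative_eq_intros has_vector_derivative_Pair
            simp: has_real_derivative_iff_has_vector_derivative)
      from has_vector_derivative_transform[where S = "{0..\<epsilon>}",
          OF _ normal_eq[OF \<epsilon>(3) u] has_vector_derivative_at_within[OF this]]
      show "((\<lambda>s. \<nu> (\<phi> (t + s) *\<^sub>R u, \<psi> (t + s))) has_vector_derivative (- \<psi>2 *\<^sub>R u, \<phi>2))
          (at 0 within {0..\<epsilon>})"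
        using \<epsilon>(1) by simp
    qed (use D in simp)
  qed
  \<comment> \<open>The differentiated unit-speed relation eliminates \<open>\<psi>2\<close>; this
    is what makes \<open>\<tau>\<close> an eigenvector.\<close>
  have "\<psi>2 = - \<phi>2 / \<psi>' t * \<phi>' t"
    using rel \<psi>'_pos[OF t] by (simp add: field_simps)
  then have e1: "- D \<tau> = (- \<phi>2 / \<psi>' t) *\<^sub>R \<tau>"
    unfolding D_\<tau> using \<psi>'_pos[OF t] by (simp add: \<tau>_def)
  have e2: "\<tau> \<in> span B" unfolding W \<tau>_def by (simp add: u1)
  have e3: "norm \<tau> = 1"
    unfolding norm_eq_1 using unit[OF t] by (simp add: \<tau>_def u1 power2_eq_square)
  have e4: "- D w = (\<psi>' t / \<phi> t) *\<^sub>R w" if "w \<in> span B" "w \<bullet> \<tau> = 0" for w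
  proof -
    obtain y z where yz: "w = (y, z)" by fastforce
    define x where "x = y \<bullet> u"
    have 1: "- \<psi>' t * x + \<phi>' t * z = 0" using that W by (simp add: yz x_def inner_commute mult.commute)
    have 2: "x * \<phi>' t + z * \<psi>' t = 0" using that by (simp add: yz x_def \<tau>_def mult.commute)
    have "z = 0" "x = 0" using 1 2 unit[OF t] by algebra+
    then show ?thesis using D_par[of y] by (simp add: yz x_def inner_commute)
  qed
  have "K = (- \<phi>2 / \<psi>' t) * (\<psi>' t / \<phi> t) ^ (dim (span B) - 1)"
    unfolding K_eq
    by (rule prod_eigenvalues[OF B(1) _ has_derivative_linear[OF D(1)] _ e2 e3 e1 e4])
      (use B(2) D(2) in blast)+
  moreover have "dim (span B) = CARD('m)"
  proof -
    have "(- \<psi>' t *\<^sub>R u, \<phi>' t) \<noteq> 0" using \<psi>'_pos[OF t] u by (auto simp: zero_prod_def)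
    from dim_hyperplane[OF this] show ?thesis unfolding W by simp
  qed
  \<comment> \<open>Truncated subtraction: with \<open>CARD('m) \<ge> 2\<close> one factor
    \<open>\<psi>'\<close> can be split off the power.\<close>
  moreover have "CARD('m) - 1 = Suc (CARD('m) - 2)" using card by simp
  ultimately have "\<psi>' t * (K * \<phi> t ^ (CARD('m) - 1)) = \<psi>' t * (- \<phi>2 * \<psi>' t ^ (CARD('m) - 2))"
    using \<psi>'_pos[OF t] pos[OF tI] by (simp add: power_divide field_simps)
  then show "K * \<phi> t ^ (CARD('m) - 1) = - \<phi>2 * \<psi>' t ^ (CARD('m) - 2)"
    using \<psi>'_pos[OF t] by (metis less_irrefl mult_cancel_left)
qed

end

section \<open>Profile curves parametrized by arc length\<close>

lemma is_interval_Icc_subset: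
  fixes I :: "real set"
  shows "is_interval I \<Longrightarrow> a \<in> I \<Longrightarrow> b \<in> I \<Longrightarrow> {a..b} \<subseteq> I"
  by (meson atLeastAtMost_iff mem_is_interval_1_I subsetI)

text \<open>The derivative is controlled only in the interior; continuity on \<open>I\<close> lets
  the mean value theorem reach the endpoints.\<close>

lemma constant_on_interval:
  fixes g :: "real \<Rightarrow> real"
  assumes I: "is_interval I" and "continuous_on I g"
    and d: "\<And>t. t \<in> interior I \<Longrightarrow> (g has_real_derivative 0) (at t)" and "x \<in> I" "y \<in> I"
  shows "g x = g y"
proof -
  have "g b = g a" if ab: "a < b" "a \<in> I" "b \<in> I" for a b
  proof (rule DERIV_isconst_end[OF ab(1)])
    have sub: "{a..b} \<subseteq> I" using I ab(2,3) by (rule is_interval_Icc_subset)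
    show "continuous_on {a..b} g" using assms(2) sub by (rule continuous_on_subset)
    have "{a<..<b} \<subseteq> interior I"
      using sub by (intro interior_maximal) auto
    then show "(g has_real_derivative 0) (at x)" if "a < x" "x < b" for x
      using d that by auto
  qed
  then show ?thesis using assms(4,5) by (metis linorder_neqE)
qed

text \<open>After substituting \<open>u = g s\<close> the integrand is 1. The hypotheses stop short
  of \<open>a\<close> and \<open>b\<close>: there \<open>g'\<close> may vanish and \<open>h\<close>
  may blow up, so the integral is treated as improper, with limits of \<open>g\<close> at the
  ends.\<close>

lemma inverse_integral_mono:
  fixes g g' h :: "real \<Rightarrow> real"
  assumes "a < b" and cont: "continuous_on {a..b} g"
    and deriv: "\<And>s. a < s \<Longrightarrow> s < b \<Longrightarrow> (g has_real_derivative g' s) (at s)"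
    and cont': "\<And>s. a < s \<Longrightarrow> s < b \<Longrightarrow> isCont g' s"
    and pos: "\<And>s. a < s \<Longrightarrow> s < b \<Longrightarrow> g' s > 0"
    and conth: "\<And>s. a < s \<Longrightarrow> s < b \<Longrightarrow> isCont h (g s)"
    and h: "\<And>s. a < s \<Longrightarrow> s < b \<Longrightarrow> h (g s) = 1 / g' s"
  shows "(LBINT u=g a..g b. h u) = b - a"
proof -
  have ev: "eventually (\<lambda>s. a < s \<and> s < b) (at_right a)" "eventually (\<lambda>s. a < s \<and> s < b) (at_left b)"
    using \<open>a < b\<close> by (auto simp: eventually_at_right eventually_at_left)
  have eq: "h (g s) * max 0 (g' s) = 1" if "s \<in> einterval a b" for s
    using that pos[of s] h[of s] by (auto simp: einterval_iff)
  have lim: "(g \<longlongrightarrow> g a) (at_right a)" "(g \<longlongrightarrow> g b) (at_left b)"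
    using cont \<open>a < b\<close>
    by (auto simp: continuous_on_Icc_at_rightD continuous_on_Icc_at_leftD)
  \<comment> \<open>\<open>max 0\<close> changes nothing inside the interval and secures
    nonnegativity at the endpoints, where nothing is assumed about \<open>g'\<close>.\<close>
  have "(LBINT u=g a..g b. h u) = (LBINT s=a..b. h (g s) * max 0 (g' s))"
  proof (rule interval_integral_substitution_nonneg(2))
    show "(g has_real_derivative max 0 (g' x)) (at x)" if "ereal a < ereal x" "ereal x < ereal b" for x
      using deriv[of x] pos[of x] that by (simp add: max_def)
    show "isCont (\<lambda>x. max 0 (g' x)) x" if "ereal a < ereal x" "ereal x < ereal b" for x
      using cont'[of x] that by (intro continuous_intros) auto
    have 1: "set_integrable lborel (einterval a b) (\<lambda>s. 1 :: real)"
      using interval_integral_const(1)[of a b 1] \<open>a < b\<close>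
      by (simp add: interval_lebesgue_integrable_def)
    show "set_integrable lborel (einterval a b) (\<lambda>s. h (g s) * max 0 (g' s))"
      by (subst set_integrable_cong[OF refl refl eq]) (use 1 in auto)
    show "((ereal \<circ> g \<circ> real_of_ereal) \<longlongrightarrow> ereal (g a)) (at_right (ereal a))"
         "((ereal \<circ> g \<circ> real_of_ereal) \<longlongrightarrow> ereal (g b)) (at_left (ereal b))"
      using lim by (simp_all add: o_def at_right_ereal at_left_ereal filterlim_filtermap)
    show "0 \<le> h (g x)" if "ereal a < ereal x" "ereal x < ereal b" for x
      using h[of x] pos[of x] that by simp
  qed (use assms in auto)
  also have "\<dots> = (LBINT s=a..b. 1)"
    using \<open>a < b\<close> eq by (intro interval_integral_cong) (auto simp: min_def max_def)
  finally show ?thesis by simp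
qed

text \<open>Time reversal \<open>s \<mapsto> - s\<close> reduces this to the increasing case and
  exchanges the limits of integration.\<close>

lemma inverse_integral_antimono:
  fixes g g' h :: "real \<Rightarrow> real"
  assumes "a < b" and cont: "continuous_on {a..b} g"
    and deriv: "\<And>s. a < s \<Longrightarrow> s < b \<Longrightarrow> (g has_real_derivative g' s) (at s)"
    and cont': "\<And>s. a < s \<Longrightarrow> s < b \<Longrightarrow> isCont g' s"
    and neg: "\<And>s. a < s \<Longrightarrow> s < b \<Longrightarrow> g' s < 0"
    and conth: "\<And>s. a < s \<Longrightarrow> s < b \<Longrightarrow> isCont h (g s)"
    and h: "\<And>s. a < s \<Longrightarrow> s < b \<Longrightarrow> h (g s) = - 1 / g' s"
  shows "(LBINT u=g b..g a. h u) = b - a"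
proof -
  have "(LBINT u=g (- (- b))..g (- (- a)). h u) = - a - (- b)"
  proof (rule inverse_integral_mono[where g = "\<lambda>s. g (- s)" and g' = "\<lambda>s. - g' (- s)"])
    show "continuous_on {- b..- a} (\<lambda>s. g (- s))"
      by (rule continuous_on_compose2[OF cont]) (auto intro!: continuous_intros)
    show "((\<lambda>s. g (- s)) has_real_derivative - g' (- s)) (at s)" if "- b < s" "s < - a" for s
      using DERIV_mirror[of g "g' (- s)" s] deriv[of "- s"] that by simp
    show "isCont (\<lambda>s. - g' (- s)) s" if "- b < s" "s < - a" for s
      using isCont_o2[where f = uminus and a = s, OF _ cont'[of "- s"]] that
      by (intro continuous_intros) auto
    show "h (g (- s)) = 1 / (- g' (- s))" if "- b < s" "s < - a" for s
      using h[of "- s"] that by simp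
  qed (use assms in auto)
  then show ?thesis by simp
qed

lemma power2_powr_half:
  fixes x :: real assumes "x > 0" "n \<ge> 1"
  shows "(x\<^sup>2) powr ((real n - 1) / 2) = x ^ (n - 1)"
proof -
  have "x\<^sup>2 = x powr 2" using assms by simp
  then have "(x\<^sup>2) powr ((real n - 1) / 2) = x powr (2 * ((real n - 1) / 2))"
    by (simp only: powr_powr)
  also have "2 * ((real n - 1) / 2) = real (n - 1)" using assms by (simp add: of_nat_diff)
  finally show ?thesis using assms(1) by (simp only: powr_realpow)
qed

lemma power_powr_root:
  fixes x :: real assumes "x > 0" "n \<ge> 2"
  shows "(x ^ (n - 1)) powr (2 / (real n - 1)) = x\<^sup>2"
proof -
  have "x ^ (n - 1) = x powr real (n - 1)" using assms(1) by (simp only: powr_realpow)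
  then have "(x ^ (n - 1)) powr (2 / (real n - 1)) = x powr (real (n - 1) * (2 / (real n - 1)))"
    by (simp only: powr_powr)
  also have "real (n - 1) * (2 / (real n - 1)) = 2" using assms by (simp add: of_nat_diff field_simps)
  finally show ?thesis using assms by simp
qed

text \<open>\<open>nondegenerate\<close> excludes a one-point \<open>I\<close>, on which derivatives
  within \<open>I\<close> would be arbitrary. The strict sign of \<open>\<psi>'\<close>, stronger
  than in \<open>arclength_curve\<close>, encodes that the curve is a graph.\<close>

locale arclength_profile =
  fixes I :: "real set" and \<phi> \<psi> \<phi>' \<psi>' :: "real \<Rightarrow> real"
  assumes curve: "arclength_curve I \<phi> \<psi> \<phi>' \<psi>'"
    and nondegenerate: "\<exists>a\<in>I. \<exists>b\<in>I. a \<noteq> b"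
    and \<psi>'_pos: "t \<in> I \<Longrightarrow> \<psi>' t > 0"
begin

lemma
  shows interval: "is_interval I" and smooth: "Ck_on \<infinity> \<phi> I" "Ck_on \<infinity> \<psi> I"
    and deriv_within: "t \<in> I \<Longrightarrow> (\<phi> has_real_derivative \<phi>' t) (at t within I)"
      "t \<in> I \<Longrightarrow> (\<psi> has_real_derivative \<psi>' t) (at t within I)"
    and unit: "t \<in> I \<Longrightarrow> (\<phi>' t)\<^sup>2 + (\<psi>' t)\<^sup>2 = 1"
  using curve by (auto simp: arclength_curve_def)

lemma deriv:
  assumes "t \<in> interior I"
  shows "(\<phi> has_real_derivative \<phi>' t) (at t)" "(\<psi> has_real_derivative \<psi>' t) (at t)"
  using deriv_within[of t] at_within_interior[OF assms] assms interior_subset by auto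

lemma continuous: "continuous_on I \<phi>" "continuous_on I \<psi>"
  unfolding continuous_on_eq_continuous_within
  using DERIV_continuous[OF deriv_within(1)] DERIV_continuous[OF deriv_within(2)] by blast+

lemma continuous_deriv: "continuous_on I \<phi>'" "continuous_on I \<psi>'"
  using nondegenerate Ck_on_continuous_derivative[OF _ interval] smooth deriv_within by metis+

lemma second_deriv:
  assumes "t \<in> interior I"
  obtains \<phi>2 \<psi>2 where "(\<phi>' has_real_derivative \<phi>2) (at t)" "(\<psi>' has_real_derivative \<psi>2) (at t)"
  using Ck_on_second_derivative[OF smooth(1) assms deriv(1)]
    Ck_on_second_derivative[OF smooth(2) assms deriv(2)] by blast

lemma \<psi>'_eq: "t \<in> I \<Longrightarrow> \<psi>' t = sqrt (1 - (\<phi>' t)\<^sup>2)"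
  using unit[of t] \<psi>'_pos[of t] by (auto intro!: real_sqrt_unique[symmetric])

text \<open>As \<open>\<psi>'\<close> is the positive root of
  \<open>1 - (\<phi>' t)\<^sup>2\<close>, the real power collapses to a natural power of
  \<open>\<psi>'\<close>.\<close>

lemma integration_constant_iff:
  assumes "n \<ge> 1"
  shows "integration_constant n K I \<phi> \<phi>' C
     \<longleftrightarrow> (\<forall>t\<in>I. K * \<phi> t ^ (n - 1) = \<psi>' t ^ (n - 1) + C)"
proof -
  have "(1 - (\<phi>' t)\<^sup>2) powr ((real n - 1) / 2) = \<psi>' t ^ (n - 1)" if "t \<in> I" for t
    using power2_powr_half[OF \<psi>'_pos[OF that] assms] unit[OF that]
    by (metis add_diff_cancel_left')
  then show ?thesis by (simp add: integration_constant_def)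
qed

lemma height_integral:
  assumes "t0 \<in> I" "t \<in> I"
  shows "\<psi> t = \<psi> t0 + (LBINT s=t0..t. sqrt (1 - (\<phi>' s)\<^sup>2))"
proof -
  have sub: "{min t0 t..max t0 t} \<subseteq> I"
    by (rule is_interval_Icc_subset[OF interval]) (use assms in \<open>auto simp: min_def max_def\<close>)
  have "(LBINT s=t0..t. sqrt (1 - (\<phi>' s)\<^sup>2)) = \<psi> t - \<psi> t0"
  proof (rule interval_integral_FTC_finite)
    show "continuous_on {min t0 t..max t0 t} (\<lambda>s. sqrt (1 - (\<phi>' s)\<^sup>2))"
      by (intro continuous_intros continuous_on_subset[OF continuous_deriv(1) sub])
    show "(\<psi> has_vector_derivative sqrt (1 - (\<phi>' x)\<^sup>2)) (at x within {min t0 t..max t0 t})"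
      if "min t0 t \<le> x" "x \<le> max t0 t" for x
    proof -
      have "x \<in> I" using sub that by auto
      then have "(\<psi> has_real_derivative sqrt (1 - (\<phi>' x)\<^sup>2)) (at x within I)"
        using deriv_within(2) \<psi>'_eq by metis
      then show ?thesis
        unfolding has_real_derivative_iff_has_vector_derivative
        by (rule has_vector_derivative_within_subset[OF _ sub])
    qed
  qed
  then show ?thesis by simp
qed

text \<open>Multiply the curvature equation by \<open>\<phi>'\<close> and replace
  \<open>\<phi>' * \<phi>2\<close> by \<open>- \<psi>' * \<psi>2\<close>: this gives
  \<open>K * \<phi> ^ (n - 2) * \<phi>' = \<psi>' ^ (n - 2) * \<psi>2\<close>, whose two sides are,
  up to the factor \<open>n - 1\<close>, the derivatives of \<open>K * \<phi> ^ (n - 1)\<close> and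
  \<open>\<psi>' ^ (n - 1)\<close>.\<close>

lemma first_integral:
  assumes n: "n \<ge> 3"
    and gauss: "\<And>t \<phi>2 \<psi>2. t \<in> interior I \<Longrightarrow> (\<phi>' has_real_derivative \<phi>2) (at t) \<Longrightarrow>
      (\<psi>' has_real_derivative \<psi>2) (at t) \<Longrightarrow>
      K * \<phi> t ^ (n - 2) = - \<phi>2 * \<psi>' t ^ (n - 3) \<and> \<phi>' t * \<phi>2 + \<psi>' t * \<psi>2 = 0"
  shows "\<exists>C. integration_constant n K I \<phi> \<phi>' C"
proof -
  define g where "g t = K * \<phi> t ^ (n - 1) - \<psi>' t ^ (n - 1)" for t
  have "(g has_real_derivative 0) (at t)" if t: "t \<in> interior I" for t
  proof -
    obtain \<phi>2 \<psi>2 where d2: "(\<phi>' has_real_derivative \<phi>2) (at t)" "(\<psi>' has_real_derivative \<psi>2) (at t)"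
      using second_deriv[OF t] by blast
    obtain j where j: "n = j + 3" using n by (metis le_add_diff_inverse2)
    have "(g has_real_derivative
        K * (real (n - 1) * (\<phi>' t * \<phi> t ^ (n - 2))) - real (n - 1) * (\<psi>2 * \<psi>' t ^ (n - 2))) (at t)"
      unfolding g_def
      by (rule derivative_eq_intros deriv[OF t] d2 refl)+ (simp add: j eval_nat_numeral)
    also have "K * (real (n - 1) * (\<phi>' t * \<phi> t ^ (n - 2))) - real (n - 1) * (\<psi>2 * \<psi>' t ^ (n - 2))
       = real (n - 1) * (\<phi>' t * (K * \<phi> t ^ (n - 2)) - \<psi>' t * \<psi>2 * \<psi>' t ^ (n - 3))"
      by (simp add: j eval_nat_numeral algebra_simps)
    also have "\<dots> = real (n - 1) * (- (\<phi>' t * \<phi>2 + \<psi>' t * \<psi>2) * \<psi>' t ^ (n - 3))"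
      by (subst conjunct1[OF gauss[OF t d2]]) (simp add: algebra_simps)
    also have "\<dots> = 0" using gauss[OF t d2] by simp
    finally show ?thesis .
  qed
  moreover have "continuous_on I g"
    unfolding g_def by (intro continuous_intros continuous continuous_deriv)
  ultimately have "g x = g y" if "x \<in> I" "y \<in> I" for x y
    using constant_on_interval[OF interval _ _ that] by blast
  then obtain C where "\<And>t. t \<in> I \<Longrightarrow> g t = C" by metis
  then have "\<forall>t\<in>I. K * \<phi> t ^ (n - 1) = \<psi>' t ^ (n - 1) + C" by (force simp: g_def)
  then show ?thesis using integration_constant_iff[of n] n by auto
qed

lemma inverse_integral:
  assumes n: "n \<ge> 3" and C: "integration_constant n K I \<phi> \<phi>' C"
    and "a \<in> I" "b \<in> I" "a < b" and \<sigma>: "\<sigma> \<in> {1, - 1}"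
    and sgn: "\<And>s. a < s \<Longrightarrow> s < b \<Longrightarrow> sgn (\<phi>' s) = \<sigma>"
  shows "inj_on \<phi> {a..b}"
    and "b - a = (LBINT u=\<phi> a..\<phi> b. \<sigma> / sqrt (1 - (K * u ^ (n - 1) - C) powr (2 / (real n - 1))))"
proof -
  define h where "h u = 1 / sqrt (1 - (K * u ^ (n - 1) - C) powr (2 / (real n - 1)))" for u
  have sub: "{a..b} \<subseteq> I" using interval assms(3,4) by (rule is_interval_Icc_subset)
  have "{a<..<b} \<subseteq> interior I" using sub by (intro interior_maximal) auto
  then have int: "s \<in> interior I" "s \<in> I" if "a < s" "s < b" for s
    using that sub by auto
  have base: "K * \<phi> s ^ (n - 1) - C = \<psi>' s ^ (n - 1)" if "s \<in> I" for s
    using C integration_constant_iff[of n] n that by auto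
  have root: "1 - (K * \<phi> s ^ (n - 1) - C) powr (2 / (real n - 1)) = (\<phi>' s)\<^sup>2" if "s \<in> I" for s
    using unit[OF that] power_powr_root[OF \<psi>'_pos[OF that], of n] n by (simp add: base[OF that] del: One_nat_def)
  have nz: "\<phi>' s \<noteq> 0" if "a < s" "s < b" for s using sgn[OF that] \<sigma> by auto
  have h: "h (\<phi> s) = 1 / \<bar>\<phi>' s\<bar>" if "a < s" "s < b" for s
    using root[OF int(2)[OF that]] by (simp add: h_def)
  have conth: "isCont h (\<phi> s)" if "a < s" "s < b" for s
    unfolding h_def using root[OF int(2)[OF that]] base[OF int(2)[OF that]] nz[OF that]
      \<psi>'_pos[OF int(2)[OF that]] by (intro continuous_intros) auto
  have cont: "continuous_on {a..b} \<phi>" using continuous(1) sub by (rule continuous_on_subset)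
  have cont': "isCont \<phi>' s" if "a < s" "s < b" for s
    using continuous_on_interior[OF continuous_deriv(1) int(1)[OF that]] .
  have "inj_on \<phi> {a..b} \<and> (LBINT u=\<phi> a..\<phi> b. \<sigma> * h u) = b - a"
  proof (cases "\<sigma> = 1")
    case True
    then have pos: "\<phi>' s > 0" if "a < s" "s < b" for s using sgn[OF that] by (simp add: sgn_1_pos)
    have "\<phi> x < \<phi> y" if "x < y" "x \<in> {a..b}" "y \<in> {a..b}" for x y
    proof (rule DERIV_pos_imp_increasing_open[OF that(1)])
      show "\<exists>d. (\<phi> has_real_derivative d) (at s) \<and> 0 < d" if "x < s" "s < y" for s
        using deriv(1)[OF int(1)[of s]] pos[of s] that \<open>x \<in> {a..b}\<close> \<open>y \<in> {a..b}\<close> by auto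
      show "continuous_on {x..y} \<phi>"
        using that by (intro continuous_on_subset[OF cont]) auto
    qed
    then have "inj_on \<phi> {a..b}" unfolding inj_on_def by (metis linorder_neqE less_irrefl)
    moreover have "(LBINT u=\<phi> a..\<phi> b. h u) = b - a"
      using inverse_integral_mono[OF \<open>a < b\<close> cont deriv(1)[OF int(1)] cont' pos conth] h pos by force
    ultimately show ?thesis using True by simp
  next
    case False
    then have neg: "\<phi>' s < 0" if "a < s" "s < b" for s using \<sigma> sgn[OF that] by (simp add: sgn_1_neg)
    have "\<phi> x > \<phi> y" if "x < y" "x \<in> {a..b}" "y \<in> {a..b}" for x y
    proof (rule DERIV_neg_imp_decreasing_open[OF that(1)])
      show "\<exists>d. (\<phi> has_real_derivative d) (at s) \<and> d < 0" if "x < s" "s < y" for s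
        using deriv(1)[OF int(1)[of s]] neg[of s] that \<open>x \<in> {a..b}\<close> \<open>y \<in> {a..b}\<close> by auto
      show "continuous_on {x..y} \<phi>"
        using that by (intro continuous_on_subset[OF cont]) auto
    qed
    then have "inj_on \<phi> {a..b}" unfolding inj_on_def by (metis linorder_neqE less_irrefl)
    have *: "(LBINT u=\<phi> b..\<phi> a. h u) = b - a"
      using inverse_integral_antimono[OF \<open>a < b\<close> cont deriv(1)[OF int(1)] cont' neg conth] h neg by force
    have "(LBINT u=\<phi> a..\<phi> b. \<sigma> * h u) = \<sigma> * (LBINT u=\<phi> a..\<phi> b. h u)"
      by (rule interval_lebesgue_integral_mult_right)
    \<comment> \<open>For decreasing \<open>\<phi>\<close> the limits come in reverse order; that
      sign cancels against \<open>\<sigma> = - 1\<close>.\<close>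
    also have "\<dots> = b - a"
      using False \<sigma> * interval_integral_endpoints_reverse[of "\<phi> a" "\<phi> b" h] by auto
    finally show ?thesis using \<open>inj_on \<phi> {a..b}\<close> by blast
  qed
  then show "inj_on \<phi> {a..b}"
    and "b - a = (LBINT u=\<phi> a..\<phi> b. \<sigma> / sqrt (1 - (K * u ^ (n - 1) - C) powr (2 / (real n - 1))))"
    by (simp_all add: h_def)
qed

lemma inverse_integral_segment:
  assumes n: "n \<ge> 3" and C: "integration_constant n K I \<phi> \<phi>' C"
    and "t0 \<in> I" "t \<in> I" and \<sigma>: "\<sigma> \<in> {1, - 1}"
    and sgn: "\<forall>s\<in>open_segment t0 t. sgn (\<phi>' s) = \<sigma>"
  shows "inj_on \<phi> (closed_segment t0 t) \<and>
    t - t0 = (LBINT u=\<phi> t0..\<phi> t. \<sigma> / sqrt (1 - (K * u ^ (n - 1) - C) powr (2 / (real n - 1))))"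
proof (cases t0 t rule: linorder_cases)
  case less
  then show ?thesis using inverse_integral[OF n C assms(3,4) less \<sigma>] sgn
    by (simp add: open_segment_eq_real_ivl closed_segment_eq_real_ivl)
next
  case equal
  then show ?thesis by simp
next
  case greater
  note int = inverse_integral[OF n C assms(4,3) greater \<sigma>]
  have "inj_on \<phi> {t..t0}"
    and "t0 - t = (LBINT u=\<phi> t..\<phi> t0. \<sigma> / sqrt (1 - (K * u ^ (n - 1) - C) powr (2 / (real n - 1))))"
    using int sgn greater by (simp_all add: open_segment_eq_real_ivl)
  moreover from this(2) have
    "t - t0 = (LBINT u=\<phi> t0..\<phi> t. \<sigma> / sqrt (1 - (K * u ^ (n - 1) - C) powr (2 / (real n - 1))))"
    by (subst interval_integral_endpoints_reverse) linarith
  ultimately show ?thesis using greater by (simp add: closed_segment_eq_real_ivl)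
qed

text \<open>Since \<open>\<psi>' > 0\<close>, the flat equation forces \<open>\<phi>2 = 0\<close>,
  and then unit speed forces \<open>\<psi>2 = 0\<close>. The velocity is constant, so the curve is a
  line with slope \<open>\<phi>' / \<psi>'\<close> over the axis.\<close>

lemma flat_profile:
  assumes n: "n \<ge> 3" and "\<And>t. t \<in> I \<Longrightarrow> \<phi> t > 0"
    and gauss: "\<And>t \<phi>2 \<psi>2. t \<in> interior I \<Longrightarrow> (\<phi>' has_real_derivative \<phi>2) (at t) \<Longrightarrow>
      (\<psi>' has_real_derivative \<psi>2) (at t) \<Longrightarrow>
      0 = - \<phi>2 * \<psi>' t ^ (n - 3) \<and> \<phi>' t * \<phi>2 + \<psi>' t * \<psi>2 = 0"
  obtains a b where "\<And>t. t \<in> I \<Longrightarrow> \<phi> t = a * \<psi> t + b"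
proof -
  have d0: "(\<phi>' has_real_derivative 0) (at t)" "(\<psi>' has_real_derivative 0) (at t)"
    if t: "t \<in> interior I" for t
  proof -
    obtain \<phi>2 \<psi>2 where d2: "(\<phi>' has_real_derivative \<phi>2) (at t)" "(\<psi>' has_real_derivative \<psi>2) (at t)"
      using second_deriv[OF t] by blast
    have "\<psi>' t > 0" using \<psi>'_pos t interior_subset by blast
    then have "\<phi>2 = 0" "\<psi>2 = 0" using gauss[OF t d2] by auto
    then show "(\<phi>' has_real_derivative 0) (at t)" "(\<psi>' has_real_derivative 0) (at t)" using d2 by auto
  qed
  obtain s where s: "s \<in> I" using nondegenerate by blast
  have c: "\<phi>' t = \<phi>' s" "\<psi>' t = \<psi>' s" if "t \<in> I" for t
    using constant_on_interval[OF interval continuous_deriv(1) d0(1) that s]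
      constant_on_interval[OF interval continuous_deriv(2) d0(2) that s] by auto
  define a where "a = \<phi>' s / \<psi>' s"
  have "((\<lambda>t. \<phi> t - a * \<psi> t) has_real_derivative 0) (at t)" if t: "t \<in> interior I" for t
  proof -
    have "\<phi>' t - a * \<psi>' t = 0"
      using c[of t] t interior_subset[of I] \<psi>'_pos[OF s] by (auto simp: a_def)
    moreover have "((\<lambda>t. \<phi> t - a * \<psi> t) has_real_derivative \<phi>' t - a * \<psi>' t) (at t)"
      by (auto intro!: derivative_eq_intros deriv[OF t])
    ultimately show ?thesis by simp
  qed
  then have "\<phi> t - a * \<psi> t = \<phi> s - a * \<psi> s" if "t \<in> I" for t
    using constant_on_interval[OF interval _ _ that s, of "\<lambda>t. \<phi> t - a * \<psi> t"]
      continuous_on_diff[OF continuous(1) continuous_on_mult_left[OF continuous(2)]] by blast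
  then show ?thesis using that[of a "\<phi> s - a * \<psi> s"] by force
qed

end

text \<open>The apex of the cone lies at height \<open>- b / a\<close>. \<open>circular_cone\<close>
  is the double cone; positivity of \<open>f\<close> keeps \<open>J\<close> on one side of the
  apex.\<close>

lemma affine_profile_cone_or_cylinder:
  fixes M :: "((real^'m::finite) \<times> real) set"
  assumes "\<And>z. z \<in> J \<Longrightarrow> f z > 0" "\<And>z. z \<in> J \<Longrightarrow> f z = a * z + b" "J \<noteq> {}"
    and M: "\<And>x z. (x, z) \<in> M \<longleftrightarrow> z \<in> J \<and> norm x = f z"
  shows "\<exists>S. (circular_cone S \<or> circular_cylinder S) \<and> M = {p\<in>S. snd p \<in> J}"
proof (cases "a = 0")
  case True
  define S :: "((real^'m) \<times> real) set" where "S = {(x, z). norm x = b}"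
  have "b > 0" using assms True by auto
  then have "circular_cylinder S" unfolding circular_cylinder_def S_def by blast
  moreover have "M = {p\<in>S. snd p \<in> J}" using M assms(2) True by (auto simp: S_def)
  ultimately show ?thesis by blast
next
  case False
  define S :: "((real^'m) \<times> real) set" where "S = {(x, z). norm x = \<bar>a\<bar> * \<bar>z - (- b / a)\<bar>}"
  have "\<bar>a\<bar> > 0" using False by simp
  then have "circular_cone S" unfolding circular_cone_def S_def by blast
  moreover have "\<bar>a\<bar> * \<bar>z - (- b / a)\<bar> = f z" if "z \<in> J" for z
  proof -
    have "\<bar>a\<bar> * \<bar>z - (- b / a)\<bar> = \<bar>a * z + b\<bar>"
      using False by (simp add: abs_mult[symmetric] field_simps)
    then show ?thesis using assms(1,2)[OF that] by simp
  qed
  then have "M = {p\<in>S. snd p \<in> J}" using M by (auto simp: S_def)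
  ultimately show ?thesis by blast
qed

text \<open>By the chain rule \<open>\<phi>' t\<close> is a multiple of \<open>\<psi>' t\<close>, so
  \<open>\<psi>' t = 0\<close> would make the velocity vanish, against unit speed. \<open>J\<close>
  is infinite, hence \<open>I\<close> has a second point and one-sided derivatives are
  unique.\<close>

lemma graph_imp_height_deriv_pos:
  assumes "generating_graph J f" "arclength_curve I \<phi> \<psi> \<phi>' \<psi>'" "\<psi> ` I = J"
    and \<phi>: "\<forall>t\<in>I. \<phi> t = f (\<psi> t)" and t: "t \<in> I"
  shows "\<psi>' t > 0"
proof -
  have I: "is_interval I" using assms(2) by (simp add: arclength_curve_def)
  have d: "(\<phi> has_real_derivative \<phi>' t) (at t within I)"
    "(\<psi> has_real_derivative \<psi>' t) (at t within I)" "(\<phi>' t)\<^sup>2 + (\<psi>' t)\<^sup>2 = 1" "\<psi>' t \<ge> 0"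
    using assms(2) t by (auto simp: arclength_curve_def)
  have f: "Ck_on \<infinity> f J" using assms(1) by (simp add: generating_graph_def)
  obtain D where "(f has_real_derivative D) (at (\<psi> t) within \<psi> ` I)"
    using Ck_on_has_real_derivative[OF f, of "\<psi> t"] t assms(3) by blast
  then have "(f \<circ> \<psi> has_real_derivative D * \<psi>' t) (at t within I)"
    by (rule DERIV_image_chain[OF _ d(2)])
  then have "(\<phi> has_real_derivative D * \<psi>' t) (at t within I)"
    by (rule has_field_derivative_transform_within[where d = 1]) (use t \<phi> in auto)
  moreover have "at t within I \<noteq> bot"
  proof -
    have "infinite J" using assms(1) using empty_interior_finite by (auto simp: generating_graph_def)
    then have "\<exists>s\<in>I. s \<noteq> t" using assms(3) by (metis finite.simps finite_imageI finite_subset singletonI subsetI)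
    then show ?thesis using is_interval_at_within_nontrivial[OF I t] by blast
  qed
  ultimately have "\<phi>' t = D * \<psi>' t" using d(1) by (metis has_field_derivative_unique)
  then have "\<psi>' t \<noteq> 0" using d(3) by auto
  then show ?thesis using d(4) by simp
qed

section \<open>The profile for negative curvature\<close>

lemma antiderivative_pos:
  fixes f :: "real \<Rightarrow> real"
  assumes "continuous_on {0<..} f"
  obtains F where "\<And>u. u > 0 \<Longrightarrow> (F has_real_derivative f u) (at u)"
proof -
  have "isCont f x" if "x > 0" for x
    using assms that by (simp add: continuous_on_eq_continuous_at)
  then have "\<exists>F. \<forall>x. ereal 0 < ereal x \<longrightarrow> ereal x < \<infinity> \<longrightarrow> (F has_vector_derivative f x) (at x)"
    by (intro einterval_antiderivative) auto
  then show ?thesis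
    using that by (auto simp: has_real_derivative_iff_has_vector_derivative)
qed

text \<open>The solutions for \<open>K = - 1 / R ^ m\<close> and \<open>C\<^sub>K = -1\<close> (with \<open>m = n - 1\<close>) satisfy
  \<open>\<phi>' = sine \<phi>\<close> and \<open>\<psi>' = cosine \<phi>\<close>, the sine and cosine of the angle between the curve and the
  axis. Beyond \<open>R\<close> the cosine is continued by 0, so that the equation has global solutions.\<close>

locale pseudospherical =
  fixes m :: nat and R :: real
  assumes m2: "m \<ge> 2" and R_pos: "R > 0"
begin

definition cosine :: "real \<Rightarrow> real" where "cosine u = max 0 (1 - (u / R) ^ m) powr (1 / m)"
definition sine :: "real \<Rightarrow> real" where "sine u = sqrt (1 - (cosine u)\<^sup>2)"
text \<open>An antiderivative on all positive reals, with unspecified additive constant, as for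
  \<open>height\<close>; the shifts \<open>d\<close> and \<open>e\<close> below absorb these
  constants.\<close>

definition arclength :: "real \<Rightarrow> real" where
  "arclength = (SOME F. \<forall>u>0. (F has_real_derivative 1 / sine u) (at u))"
definition height :: "real \<Rightarrow> real" where
  "height = (SOME F. \<forall>u>0. (F has_real_derivative cosine u / sine u) (at u))"
definition radius :: "real \<Rightarrow> real" where
  "radius t = (THE u. u > 0 \<and> arclength u = t)"

section \<open>Bounds on the angle functions\<close>

lemma cosine_nonneg: "cosine u \<ge> 0" by (simp add: cosine_def)

lemma cosine_power: "cosine u ^ m = max 0 (1 - (u / R) ^ m)"
proof -
  have "cosine u ^ m = max 0 (1 - (u / R) ^ m) powr (1 / m * m)"
  proof (cases "max 0 (1 - (u / R) ^ m) = 0")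
    case False
    then have "cosine u > 0" by (simp add: cosine_def)
    then have "cosine u ^ m = cosine u powr m" by (simp add: powr_realpow)
    then show ?thesis by (simp only: cosine_def powr_powr)
  qed (use m2 in \<open>simp add: cosine_def\<close>)
  then show ?thesis using m2 by simp
qed

lemma cosine_unique:
  assumes "x \<ge> 0" "x ^ m = 1 - (u / R) ^ m"
  shows "x = cosine u"
proof -
  have "x ^ m \<ge> 0" using assms(1) by simp
  then have "x ^ m = cosine u ^ m" using assms by (simp add: cosine_power max_def)
  then show ?thesis using power_eq_imp_eq_base[OF _ assms(1) cosine_nonneg] m2 by auto
qed

lemma cosine_less_1: "u > 0 \<Longrightarrow> cosine u < 1"
proof -
  assume "u > 0"
  then have "cosine u ^ m < 1 ^ m" using R_pos by (simp add: cosine_power)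
  then show ?thesis using power_less_imp_less_base by fastforce
qed

lemma cosine_pos: "0 < u \<Longrightarrow> u < R \<Longrightarrow> cosine u > 0"
proof -
  assume "0 < u" "u < R"
  then have "(u / R) ^ m < 1" using m2 by (simp add: power_less_one_iff)
  then show ?thesis by (simp add: cosine_def)
qed

lemma sine_sq: "u > 0 \<Longrightarrow> (sine u)\<^sup>2 = 1 - (cosine u)\<^sup>2"
  using cosine_less_1[of u] cosine_nonneg[of u]
  by (simp add: sine_def power_le_one)

lemma sine_pos: "u > 0 \<Longrightarrow> sine u > 0"
  using cosine_less_1[of u] cosine_nonneg[of u]
  by (simp add: sine_def abs_square_less_1)

lemma sine_le_1: "sine u \<le> 1" by (simp add: sine_def)

text \<open>With \<open>m \<ge> 2\<close> and cosine at most 1, the squared sine is at most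
  \<open>1 - cosine u ^ m = (u / R) ^ m\<close>, hence at most the square of \<open>u / R\<close>.
  This makes arc length diverge as the radius tends to 0, so that the maximal interval starts at
  minus infinity.\<close>

lemma sine_le:
  assumes "0 < u" "u \<le> R" shows "sine u \<le> u / R"
proof -
  have s: "0 \<le> u / R" "u / R \<le> 1" using assms by auto
  have "cosine u ^ m \<le> (cosine u)\<^sup>2"
    using m2 cosine_nonneg cosine_less_1[OF assms(1)] by (intro power_decreasing) auto
  moreover have "(u / R) ^ m \<le> (u / R)\<^sup>2" using m2 s by (intro power_decreasing) auto
  moreover have "(u / R) ^ m \<le> 1" using s by (simp add: power_le_one)
  ultimately have "(sine u)\<^sup>2 \<le> (u / R)\<^sup>2"
    by (simp add: sine_sq[OF assms(1)] cosine_power)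
  then show ?thesis using s(1) by (rule power2_le_imp_le)
qed

text \<open>Bernoulli's inequality bounds \<open>1 - cosine u\<close> below by
  \<open>(u / R) ^ m / m\<close>, and the squared sine is at least \<open>1 - cosine u\<close>. This
  limits the length of arcs near the axis and yields finite volume.\<close>

lemma sine_ge:
  assumes "0 < u" "u \<le> R" shows "sine u \<ge> sqrt ((u / R) ^ m / m)"
proof -
  have s: "0 \<le> u / R" "u / R \<le> 1" using assms by auto
  have c: "0 \<le> cosine u" "cosine u \<le> 1" using cosine_nonneg cosine_less_1[OF assms(1)] by auto
  have "1 + real m * (cosine u - 1) \<le> (1 + (cosine u - 1)) ^ m"
    using c by (intro Bernoulli_inequality) auto
  also have "\<dots> = 1 - (u / R) ^ m" using s by (simp add: cosine_power power_le_one)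
  finally have "(u / R) ^ m \<le> (1 - cosine u) * m" by (simp add: algebra_simps)
  then have "(u / R) ^ m / m \<le> 1 - cosine u" using m2 by (simp only: pos_divide_le_eq)
  also have "\<dots> \<le> (sine u)\<^sup>2"
    unfolding sine_sq[OF assms(1)] using c by (simp add: power2_eq_square mult_left_le)
  finally show ?thesis using sine_pos[OF assms(1)] by (intro real_le_lsqrt) auto
qed

lemma continuous_cosine: "continuous_on {0<..} cosine"
  unfolding cosine_def using m2 R_pos by (intro continuous_intros continuous_on_powr') auto

lemma continuous_sine: "continuous_on {0<..} sine"
  unfolding sine_def by (intro continuous_intros continuous_cosine)

lemma arclength_deriv: "u > 0 \<Longrightarrow> (arclength has_real_derivative 1 / sine u) (at u)"
proof -
  have "continuous_on {0<..} (\<lambda>u. 1 / sine u)"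
    using sine_pos by (intro continuous_intros continuous_sine) (simp add: less_imp_neq[symmetric])
  from antiderivative_pos[OF this]
  have "\<exists>F. \<forall>u>0. (F has_real_derivative 1 / sine u) (at u)" by metis
  from someI_ex[OF this] show "u > 0 \<Longrightarrow> ?thesis" by (simp add: arclength_def)
qed

lemma height_deriv: "u > 0 \<Longrightarrow> (height has_real_derivative cosine u / sine u) (at u)"
proof -
  have "continuous_on {0<..} (\<lambda>u. cosine u / sine u)"
    using sine_pos
    by (intro continuous_intros continuous_cosine continuous_sine) (simp add: less_imp_neq[symmetric])
  from antiderivative_pos[OF this]
  have "\<exists>F. \<forall>u>0. (F has_real_derivative cosine u / sine u) (at u)" by metis
  from someI_ex[OF this] show "u > 0 \<Longrightarrow> ?thesis" by (simp add: height_def)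
qed

lemma arclength_less:
  assumes "0 < u" "u < v"
  shows "arclength u < arclength v"
proof (rule DERIV_pos_imp_increasing[OF assms(2)])
  show "\<exists>y. (arclength has_real_derivative y) (at x) \<and> 0 < y" if "u \<le> x" "x \<le> v" for x
    using arclength_deriv[of x] sine_pos[of x] assms that by (intro exI[of _ "1 / sine x"]) auto
qed

lemma arclength_less_iff: "u > 0 \<Longrightarrow> v > 0 \<Longrightarrow> arclength u < arclength v \<longleftrightarrow> u < v"
  using arclength_less[of u v] arclength_less[of v u] by (cases u v rule: linorder_cases) auto

lemma arclength_le_iff: "u > 0 \<Longrightarrow> v > 0 \<Longrightarrow> arclength u \<le> arclength v \<longleftrightarrow> u \<le> v"
  using arclength_less_iff[of v u] by (simp add: not_less[symmetric])

lemma arclength_inj: "u > 0 \<Longrightarrow> v > 0 \<Longrightarrow> arclength u = arclength v \<longleftrightarrow> u = v"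
  using arclength_less_iff[of v u] arclength_less_iff[of u v] by (metis less_irrefl linorder_neqE)

text \<open>Below \<open>R\<close> the slope is at least \<open>R / u\<close>, which gives
  logarithmic divergence at 0; beyond \<open>R\<close> it is at least 1. The intermediate value
  theorem does the rest.\<close>

lemma arclength_surj: "\<exists>u>0. arclength u = t"
proof -
  have upper: "arclength R + (v - R) \<le> arclength v" if "v \<ge> R" for v
  proof -
    have "arclength R - R \<le> arclength v - v"
    proof (rule DERIV_nonneg_imp_nondecreasing[OF that])
      fix x assume "R \<le> x"
      then have x: "x > 0" using R_pos by simp
      show "\<exists>y. ((\<lambda>v. arclength v - v) has_real_derivative y) (at x) \<and> 0 \<le> y"
        using sine_pos[OF x] sine_le_1[of x]
        by (intro exI[of _ "1 / sine x - 1"] conjI DERIV_diff arclength_deriv[OF x] DERIV_ident) simp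
    qed
    then show ?thesis by simp
  qed
  have lower: "arclength v \<le> arclength R + R * (ln v - ln R)" if "0 < v" "v \<le> R" for v
  proof -
    have "arclength v - R * ln v \<le> arclength R - R * ln R"
    proof (rule DERIV_nonneg_imp_nondecreasing[OF that(2)])
      fix x assume "v \<le> x" "x \<le> R"
      then have x: "x > 0" using that by simp
      have "R * (1 / x) \<le> 1 / sine x"
        using sine_le[OF x \<open>x \<le> R\<close>] sine_pos[OF x] R_pos x by (simp add: field_simps)
      then show "\<exists>y. ((\<lambda>v. arclength v - R * ln v) has_real_derivative y) (at x) \<and> 0 \<le> y"
        using x by (intro exI[of _ "1 / sine x - R * (1 / x)"] conjI DERIV_diff arclength_deriv[OF x]
          DERIV_cmult) (auto intro!: derivative_eq_intros)
    qed
    then show ?thesis by (simp add: algebra_simps)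
  qed
  \<comment> \<open>The points at which the two comparison bounds reach \<open>t\<close>, clamped to
    the side of \<open>R\<close> on which each bound holds.\<close>
  define a where "a = min R (R * exp ((t - arclength R) / R))"
  define b where "b = R + max 0 (t - arclength R)"
  have ab: "0 < a" "a \<le> R" "R \<le> b" using R_pos by (auto simp: a_def b_def)
  have "ln a \<le> ln R + (t - arclength R) / R"
  proof -
    have "ln a \<le> ln (R * exp ((t - arclength R) / R))"
      using ab(1) by (intro ln_mono) (auto simp: a_def)
    then show ?thesis using R_pos by (simp add: ln_mult)
  qed
  then have "R * (ln a - ln R) \<le> t - arclength R" using R_pos by (simp add: field_simps)
  then have "arclength a \<le> t" using lower[OF ab(1,2)] by simp
  moreover have "t \<le> arclength b" using upper[OF ab(3)] by (simp add: b_def)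
  moreover have "\<forall>x. a \<le> x \<and> x \<le> b \<longrightarrow> isCont arclength x"
    using ab(1) arclength_deriv DERIV_isCont by (meson less_le_trans)
  ultimately obtain u where "a \<le> u" "arclength u = t"
    using IVT[of arclength a t b] ab by auto
  then show ?thesis using ab(1) by (intro exI[of _ u]) auto
qed

lemma radius: "radius t > 0" "arclength (radius t) = t"
proof -
  have "\<exists>!u. u > 0 \<and> arclength u = t" using arclength_surj arclength_inj by metis
  from theI'[OF this] show "radius t > 0" "arclength (radius t) = t" by (auto simp: radius_def)
qed

lemma radius_arclength: "u > 0 \<Longrightarrow> radius (arclength u) = u"
  using radius arclength_inj by blast

lemma radius_less_iff: "u > 0 \<Longrightarrow> radius t < u \<longleftrightarrow> t < arclength u"
  using arclength_less_iff[OF radius(1), of u t] radius(2) by simp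

text \<open>Inverse function rule. It holds also at \<open>t = arclength R\<close>, because
  \<open>arclength\<close> continues differentiably past \<open>R\<close>.\<close>

lemma radius_deriv: "(radius has_real_derivative sine (radius t)) (at t)"
proof -
  let ?u = "radius t"
  have "isCont radius (arclength ?u)"
  proof (rule isCont_inverse_function[where d = "?u / 2" and f = arclength and x = ?u])
    have "z > 0" if "\<bar>z - ?u\<bar> \<le> ?u / 2" for z
      using that radius(1)[of t] by (auto simp: abs_if split: if_splits)
    then show "radius (arclength z) = z" "isCont arclength z" if "\<bar>z - ?u\<bar> \<le> ?u / 2" for z
      using that radius_arclength arclength_deriv DERIV_isCont by blast+
  qed (use radius(1)[of t] in simp)
  then have "isCont radius t" by (simp add: radius)
  then have "(radius has_real_derivative inverse (1 / sine ?u)) (at t)"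
    using arclength_deriv[OF radius(1)] sine_pos[OF radius(1), of t]
    by (intro DERIV_inverse_function[where f = arclength and a = "t - 1" and b = "t + 1"])
      (auto simp: radius)
  then show ?thesis by simp
qed

lemma smooth_cosine: "Ck_on_open j cosine {0<..<R}"
proof (rule Ck_on_open_cong_imp)
  have lt: "(u / R) powr m < 1" if "u \<in> {0<..<R}" for u
    using that m2 by (simp add: powr_realpow power_less_one_iff)
  have lin: "Ck_on_open j (\<lambda>u. u / R) {0<..<R}"
    by (intro Ck_on_open_linear bounded_linear_divide) simp
  show "Ck_on_open j (\<lambda>u. (1 - (u / R) powr m) powr (1 / m)) {0<..<R}"
    by (intro Ck_on_open_powr_compose Ck_on_open_diff Ck_on_open_const lin) (use lt in auto)
  show "(1 - (u / R) powr m) powr (1 / m) = cosine u" if "u \<in> {0<..<R}" for u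
    using lt[OF that] that by (simp add: cosine_def powr_realpow)
qed simp

lemma smooth_sine: "Ck_on_open j sine {0<..<R}"
proof (rule Ck_on_open_cong_imp)
  have pos: "1 - cosine u * cosine u > 0" if "u \<in> {0<..<R}" for u
    using sine_sq[of u] zero_less_power[OF sine_pos[of u], of 2] that
    by (simp add: power2_eq_square)
  show "Ck_on_open j (\<lambda>u. (1 - cosine u * cosine u) powr (1 / 2)) {0<..<R}"
    by (intro Ck_on_open_powr_compose Ck_on_open_diff Ck_on_open_const Ck_on_open_mult smooth_cosine
       pos) auto
  show "(1 - cosine u * cosine u) powr (1 / 2) = sine u" if "u \<in> {0<..<R}" for u
    using pos[OF that] by (simp add: sine_def powr_half_sqrt power2_eq_square)
qed simp

lemma smooth_height: "Ck_on_open j height {0<..<R}"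
proof -
  have "Ck_on_open (Suc j) height {0<..<R}"
    by (rule Ck_on_open_real_SucI[of _ _ "\<lambda>u. cosine u / sine u"])
      (use height_deriv sine_pos in \<open>auto intro!: Ck_on_open_divide smooth_cosine smooth_sine\<close>)
  then show ?thesis by (rule Ck_on_open_SucD)
qed

text \<open>Across \<open>R\<close> the integrand is continuous but has the root singularity of the
  cosine. This lemma supplies the regularity of the chart at the boundary sphere.\<close>

lemma C1_height: "Ck_on_open 1 height {0<..}"
  unfolding One_nat_def
proof (rule Ck_on_open_real_SucI[of _ _ "\<lambda>u. cosine u / sine u"])
  show "Ck_on_open 0 (\<lambda>u. cosine u / sine u) {0<..}"
    using sine_pos by (simp add: continuous_on_divide[OF continuous_cosine continuous_sine]
      less_imp_neq[symmetric])
qed (use height_deriv in auto)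

text \<open>Bootstrapping: the derivative is \<open>sine\<close> of the function itself, and
  \<open>sine\<close> is smooth below \<open>R\<close>, so each order of regularity yields the
  next.\<close>

lemma smooth_radius:
  assumes "open S" "\<And>t. t \<in> S \<Longrightarrow> radius (t + d) < R"
  shows "Ck_on_open j (\<lambda>t. radius (t + d)) S"
proof -
  have der: "((\<lambda>t. radius (t + d)) has_real_derivative sine (radius (t + d))) (at t)" for t
    using radius_deriv[of "t + d"] by (simp add: DERIV_shift)
  show ?thesis
  proof (induction j)
    case 0
    have "continuous_on S (\<lambda>t. radius (t + d))"
      by (rule DERIV_continuous_on[OF has_field_derivative_at_within[OF der]])
    then show ?case by simp
  next
    case (Suc j)
    have "Ck_on_open j (\<lambda>t. sine (radius (t + d))) S"
      by (rule Ck_on_open_compose[OF assms(1) _ _ Suc smooth_sine]) (use assms(2) radius(1) in auto)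
    then show ?case by (rule Ck_on_open_real_SucI[OF assms(1) der])
  qed
qed

section \<open>Existence and uniqueness of the maximal solution\<close>

definition curvature :: real where "curvature = - 1 / R ^ m"

lemma end_radius: "(- 1 / curvature) powr (1 / (real (Suc m) - 1)) = R"
proof -
  have "(- 1 / curvature) = R powr m" using R_pos by (simp add: curvature_def powr_realpow)
  then show ?thesis using R_pos m2 by (simp add: powr_powr)
qed

text \<open>The first integral reads \<open>\<psi>' t ^ m = 1 - (\<phi> t / R) ^ m\<close>;
  positivity of \<open>\<psi>'\<close> keeps \<open>\<phi>\<close> below \<open>R\<close>. Only the
  modulus of \<open>\<phi>'\<close> is determined.\<close>

lemma profile_ode:
  assumes "arclength_profile I \<phi> \<psi> \<phi>' \<psi>'" "integration_constant (Suc m) curvature I \<phi> \<phi>' (- 1)"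
    and t: "t \<in> I" "\<phi> t > 0"
  shows "\<phi> t < R" "\<psi>' t = cosine (\<phi> t)" "\<bar>\<phi>' t\<bar> = sine (\<phi> t)"
proof -
  interpret arclength_profile I \<phi> \<psi> \<phi>' \<psi>' by fact
  have "curvature * \<phi> t ^ m = \<psi>' t ^ m - 1"
    using integration_constant_iff[of "Suc m" curvature "- 1"] assms(2) t by auto
  then have p: "\<psi>' t ^ m = 1 - (\<phi> t / R) ^ m"
    by (simp add: curvature_def power_divide)
  have "\<psi>' t ^ m > 0" using \<psi>'_pos[OF t(1)] by simp
  then have "(\<phi> t / R) ^ m < 1 ^ m" using p by simp
  then have "\<phi> t / R < 1" by (rule power_less_imp_less_base) simp
  then show "\<phi> t < R" using R_pos by simp
  show c: "\<psi>' t = cosine (\<phi> t)" using cosine_unique[OF _ p] \<psi>'_pos[OF t(1)] by simp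
  have "(\<phi>' t)\<^sup>2 = (sine (\<phi> t))\<^sup>2" using unit[OF t(1)] sine_sq[OF t(2)] c by simp
  then show "\<bar>\<phi>' t\<bar> = sine (\<phi> t)" using sine_pos[OF t(2)] by (auto simp: power2_eq_iff)
qed

text \<open>\<open>radius\<close> solves \<open>\<phi>' = sine \<phi>\<close>, and the chain rule
  for \<open>height\<close> cancels the sine to leave \<open>cosine\<close>. The translations
  \<open>d\<close> in time and \<open>e\<close> in height exhaust the freedom.\<close>

lemma maximal_solution_radius:
  "maximal_solution (Suc m) curvature (arclength R - d) (\<lambda>t. radius (t + d))
     (\<lambda>t. height (radius (t + d)) - e)"
  unfolding maximal_solution_def
proof (intro conjI exI allI impI)
  let ?\<Phi> = "\<lambda>t. radius (t + d)" and ?\<Psi> = "\<lambda>t. height (radius (t + d)) - e"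
  let ?I = "{..<arclength R - d}"
  have d\<Phi>: "(?\<Phi> has_real_derivative sine (?\<Phi> t)) (at t)" for t
    using radius_deriv[of "t + d"] by (simp add: DERIV_shift)
  have d\<Psi>: "(?\<Psi> has_real_derivative cosine (?\<Phi> t)) (at t)" for t
  proof -
    have "(?\<Psi> has_real_derivative cosine (?\<Phi> t) / sine (?\<Phi> t) * sine (?\<Phi> t) - 0) (at t)"
      by (intro DERIV_diff DERIV_const DERIV_chain2[OF height_deriv d\<Phi>] radius)
    then show ?thesis using sine_pos[OF radius(1), of "t + d"] by simp
  qed
  have less: "?\<Phi> t < R" if "t \<in> ?I" for t using that radius_less_iff[OF R_pos] by auto
  show "continuous_on {..arclength R - d} ?\<Phi>" "continuous_on {..arclength R - d} ?\<Psi>"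
    by (rule DERIV_continuous_on[OF has_field_derivative_at_within[OF d\<Phi>]])
      (rule DERIV_continuous_on[OF has_field_derivative_at_within[OF d\<Psi>]])
  show "?\<Phi> (arclength R - d) = (- 1 / curvature) powr (1 / (real (Suc m) - 1))"
    using radius_arclength[OF R_pos] by (simp only: end_radius) simp
  show "arclength_curve ?I ?\<Phi> ?\<Psi> (\<lambda>t. sine (?\<Phi> t)) (\<lambda>t. cosine (?\<Phi> t))"
    unfolding arclength_curve_def
  proof (intro conjI ballI)
    show "is_interval ?I" by simp
    have s: "Ck_on_open j ?\<Phi> ?I" for j using less by (intro smooth_radius) auto
    then show "Ck_on \<infinity> ?\<Phi> ?I" by (intro Ck_on_openI[of ?I]) auto
    have "Ck_on_open j ?\<Psi> ?I" for j
      using less radius(1) by (intro Ck_on_open_diff Ck_on_open_const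
          Ck_on_open_compose[OF _ _ _ s smooth_height]) auto
    then show "Ck_on \<infinity> ?\<Psi> ?I" by (intro Ck_on_openI[of ?I]) auto
  qed (use d\<Phi> d\<Psi> sine_sq[OF radius(1)] cosine_nonneg in
      \<open>auto intro: has_field_derivative_at_within\<close>)
  show "integration_constant (Suc m) curvature ?I ?\<Phi> (\<lambda>t. sine (?\<Phi> t)) (- 1)"
    unfolding integration_constant_def
  proof
    fix t assume t: "t \<in> ?I"
    have c: "cosine (?\<Phi> t) > 0" using cosine_pos[OF radius(1) less[OF t]] .
    have "(?\<Phi> t / R) ^ m \<le> 1" using less[OF t] radius(1)[of "t + d"] R_pos by (simp add: power_le_one)
    then have "curvature * ?\<Phi> t ^ m = cosine (?\<Phi> t) ^ m - 1"
      by (simp add: cosine_power curvature_def power_divide)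
    then show "curvature * ?\<Phi> t ^ (Suc m - 1)
        = (1 - (sine (?\<Phi> t))\<^sup>2) powr ((real (Suc m) - 1) / 2) + - 1"
      using power2_powr_half[OF c, of "Suc m"] sine_sq[OF radius(1), of "t + d"] by simp
  qed
  show "?\<Phi> t > 0" "sine (?\<Phi> t) > 0" for t using radius(1) sine_pos by auto
qed

text \<open>\<open>\<phi>'\<close> never vanishes because the sine is positive, so its sign
  \<open>\<sigma>\<close> is constant; reversing time when \<open>\<sigma> = - 1\<close> makes the
  curve increasing. Then \<open>arclength (\<phi> t) - \<sigma> * t\<close> and
  \<open>height (\<phi> t) - \<sigma> * \<psi> t\<close> have derivative 0, and their values at one
  point \<open>s\<close> are \<open>d\<close> and \<open>e\<close>.\<close>

lemma maximal_solution_extends: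
  assumes "arclength_profile I \<phi> \<psi> \<phi>' \<psi>'" and int: "integration_constant (Suc m) curvature I \<phi> \<phi>' (- 1)"
    and pos: "\<And>t. t \<in> I \<Longrightarrow> \<phi> t > 0"
  shows "\<exists>tmax \<Phi> \<Psi>. maximal_solution (Suc m) curvature tmax \<Phi> \<Psi> \<and>
     (\<exists>\<sigma>\<in>{1, - 1}. \<forall>t\<in>I. \<sigma> * t \<le> tmax \<and> \<Phi> (\<sigma> * t) = \<phi> t \<and> \<Psi> (\<sigma> * t) = \<sigma> * \<psi> t)"
proof -
  interpret arclength_profile I \<phi> \<psi> \<phi>' \<psi>' by fact
  note ode = profile_ode[OF assms(1) int]
  obtain s where s: "s \<in> I" using nondegenerate by blast
  have nz: "\<phi>' t \<noteq> 0" if "t \<in> I" for t using ode(3)[OF that] sine_pos pos that by force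
  define \<sigma> where "\<sigma> = sgn (\<phi>' s)"
  have \<sigma>: "\<sigma> \<in> {1, - 1}" using nz[OF s] by (auto simp: \<sigma>_def sgn_real_def)
  have sgn: "sgn (\<phi>' t) = \<sigma>" if t: "t \<in> I" for t
  proof (rule ccontr)
    assume "sgn (\<phi>' t) \<noteq> \<sigma>"
    then have "\<phi>' s < 0 \<and> 0 < \<phi>' t \<or> \<phi>' t < 0 \<and> 0 < \<phi>' s"
      using nz[OF s] nz[OF t] by (auto simp: \<sigma>_def sgn_real_def split: if_splits)
    \<comment> \<open>Intermediate value property: a sign change of the continuous
      \<open>\<phi>'\<close> would produce a zero.\<close>
    moreover have "is_interval (\<phi>' ` I)"
      using connected_continuous_image[OF continuous_deriv(1)] interval
      by (simp add: is_interval_connected_1)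
    ultimately have "0 \<in> \<phi>' ` I"
      using s t mem_is_interval_1_I[of "\<phi>' ` I"] by (meson imageI less_imp_le)
    then show False using nz by auto
  qed
  have \<phi>': "\<phi>' t = \<sigma> * sine (\<phi> t)" if "t \<in> I" for t
    using ode(3)[OF that pos[OF that]] sgn[OF that] sgn_mult_abs by metis
  have \<sigma>2: "\<sigma> * \<sigma> = 1" using \<sigma> by auto
  define d where "d = arclength (\<phi> s) - \<sigma> * s"
  define e where "e = height (\<phi> s) - \<sigma> * \<psi> s"
  have cont: "continuous_on I (\<lambda>t. F (\<phi> t))" if "\<And>u. u > 0 \<Longrightarrow> (F has_real_derivative F' u) (at u)" for F F'
    by (rule continuous_on_compose2[OF DERIV_continuous_on[of "{0<..}" F F', OF has_field_derivative_at_within[OF that]]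
          continuous(1)]) (use pos in auto)
  have d_eq: "arclength (\<phi> t) = \<sigma> * t + d" if t: "t \<in> I" for t
  proof -
    have "arclength (\<phi> t) - \<sigma> * t = arclength (\<phi> s) - \<sigma> * s"
    proof (rule constant_on_interval[OF interval _ _ t s])
      show "continuous_on I (\<lambda>t. arclength (\<phi> t) - \<sigma> * t)"
        by (intro continuous_intros cont[OF arclength_deriv])
      fix x assume x: "x \<in> interior I"
      then have xI: "x \<in> I" using interior_subset by blast
      have "((\<lambda>t. arclength (\<phi> t) - \<sigma> * t) has_real_derivative 1 / sine (\<phi> x) * \<phi>' x - \<sigma> * 1) (at x)"
        by (intro DERIV_diff DERIV_cmult DERIV_ident DERIV_chain2[OF arclength_deriv deriv(1)[OF x]]
            pos xI)
      then show "((\<lambda>t. arclength (\<phi> t) - \<sigma> * t) has_real_derivative 0) (at x)"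
        using \<phi>'[OF xI] sine_pos[OF pos[OF xI]] by simp
    qed
    then show ?thesis by (simp add: d_def)
  qed
  have e_eq: "height (\<phi> t) = \<sigma> * \<psi> t + e" if t: "t \<in> I" for t
  proof -
    have "height (\<phi> t) - \<sigma> * \<psi> t = height (\<phi> s) - \<sigma> * \<psi> s"
    proof (rule constant_on_interval[OF interval _ _ t s])
      show "continuous_on I (\<lambda>t. height (\<phi> t) - \<sigma> * \<psi> t)"
        by (intro continuous_intros cont[OF height_deriv] continuous(2))
      fix x assume x: "x \<in> interior I"
      then have xI: "x \<in> I" using interior_subset by blast
      have "((\<lambda>t. height (\<phi> t) - \<sigma> * \<psi> t) has_real_derivative
          cosine (\<phi> x) / sine (\<phi> x) * \<phi>' x - \<sigma> * \<psi>' x) (at x)"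
        by (intro DERIV_diff DERIV_cmult deriv(2)[OF x] DERIV_chain2[OF height_deriv deriv(1)[OF x]]
            pos xI)
      then show "((\<lambda>t. height (\<phi> t) - \<sigma> * \<psi> t) has_real_derivative 0) (at x)"
        using \<phi>'[OF xI] ode(2)[OF xI pos[OF xI]] sine_pos[OF pos[OF xI]] by simp
    qed
    then show ?thesis by (simp add: e_def)
  qed
  have "\<sigma> * t \<le> arclength R - d \<and> radius (\<sigma> * t + d) = \<phi> t \<and> height (radius (\<sigma> * t + d)) - e = \<sigma> * \<psi> t"
    if t: "t \<in> I" for t
  proof -
    have "radius (\<sigma> * t + d) = \<phi> t"
      using radius_arclength[OF pos[OF t]] by (simp add: d_eq[OF t])
    moreover have "arclength (\<phi> t) < arclength R"
      using arclength_less_iff[OF pos[OF t] R_pos] ode(1)[OF t pos[OF t]] by simp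
    ultimately show ?thesis using e_eq[OF t] d_eq[OF t] by simp
  qed
  then show ?thesis using maximal_solution_radius[of d e] \<sigma> by blast
qed

text \<open>The definition gives only \<open>\<psi>' \<ge> 0\<close> and, at \<open>tmax\<close>,
  only continuity. Monotonicity towards the value \<open>R\<close> at the tip keeps
  \<open>\<Phi>\<close> below \<open>R\<close>, which upgrades the sign of \<open>\<psi>'\<close>.
  The differences \<open>arclength (\<Phi> t) - t\<close> and
  \<open>height (\<Phi> t) - \<Psi> t\<close> are then constant on the open ray, and continuity
  extends this to \<open>tmax\<close>.\<close>

lemma maximal_solution_unique:
  assumes max: "maximal_solution (Suc m) curvature tmax \<Phi> \<Psi>"
  obtains d e where "tmax = arclength R - d" "\<And>t. t \<le> tmax \<Longrightarrow> \<Phi> t = radius (t + d)"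
    "\<And>t. t \<le> tmax \<Longrightarrow> \<Psi> t = height (radius (t + d)) - e"
proof -
  let ?I = "{..<tmax}"
  obtain \<Phi>' \<Psi>' where curve: "arclength_curve ?I \<Phi> \<Psi> \<Phi>' \<Psi>'"
    and pos: "\<And>t. t < tmax \<Longrightarrow> \<Phi> t > 0" "\<And>t. t < tmax \<Longrightarrow> \<Phi>' t > 0"
    and int: "integration_constant (Suc m) curvature ?I \<Phi> \<Phi>' (- 1)"
    using max unfolding maximal_solution_def by blast
  have cont: "continuous_on {..tmax} \<Phi>" "continuous_on {..tmax} \<Psi>" and tip: "\<Phi> tmax = R"
    using max end_radius unfolding maximal_solution_def by auto
  have d\<Phi>: "(\<Phi> has_real_derivative \<Phi>' t) (at t)" "(\<Psi> has_real_derivative \<Psi>' t) (at t)"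
    if "t < tmax" for t
    using curve that at_within_open[of t ?I] unfolding arclength_curve_def
    by (metis lessThan_iff open_lessThan)+
  have less: "\<Phi> t < R" if t: "t < tmax" for t
  proof -
    have "\<Phi> t < \<Phi> tmax"
    proof (rule DERIV_pos_imp_increasing_open[OF t])
      show "\<exists>y. (\<Phi> has_real_derivative y) (at x) \<and> 0 < y" if "t < x" "x < tmax" for x
        using d\<Phi>(1)[OF that(2)] pos(2)[OF that(2)] by blast
    qed (use continuous_on_subset[OF cont(1)] in auto)
    then show ?thesis using tip by simp
  qed
  have "arclength_profile ?I \<Phi> \<Psi> \<Phi>' \<Psi>'"
  proof
    show "\<exists>a\<in>?I. \<exists>b\<in>?I. a \<noteq> b"
      by (intro bexI[of _ "tmax - 1"] bexI[of _ "tmax - 2"]) auto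
    fix t assume t: "t \<in> ?I"
    \<comment> \<open>Since \<open>0 powr x = 0\<close>, a vanishing \<open>\<Psi>' t\<close> would
      make the real power in the first integral 0, that is, \<open>\<Phi> t = R\<close>.\<close>
    have "(\<Phi> t / R) ^ m < 1" using less[of t] pos(1)[of t] t m2 by (simp add: power_less_one_iff)
    moreover have "curvature * \<Phi> t ^ m = (1 - (\<Phi>' t)\<^sup>2) powr (m / 2) - 1"
      using int t by (auto simp: integration_constant_def)
    then have "- ((\<Phi> t / R) ^ m) = (1 - (\<Phi>' t)\<^sup>2) powr (m / 2) - 1"
      by (simp add: curvature_def power_divide)
    ultimately have "(1 - (\<Phi>' t)\<^sup>2) powr (m / 2) > 0" by linarith
    moreover have "(\<Phi>' t)\<^sup>2 + (\<Psi>' t)\<^sup>2 = 1" "\<Psi>' t \<ge> 0"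
      using curve t by (auto simp: arclength_curve_def)
    moreover have "1 - (\<Phi>' t)\<^sup>2 = (\<Psi>' t)\<^sup>2" using calculation by linarith
    ultimately show "\<Psi>' t > 0" by (cases "\<Psi>' t = 0") auto
  qed (fact curve)
  note ode = profile_ode[OF this int]
  have \<Phi>': "\<Phi>' t = sine (\<Phi> t)" if "t < tmax" for t
    using ode(3)[of t] pos[OF that] that by simp
  have pos_le: "\<Phi> t > 0" if "t \<le> tmax" for t
    using pos(1)[of t] tip R_pos that by (cases "t = tmax") auto
  define d where "d = arclength R - tmax"
  define e where "e = height R - \<Psi> tmax"
  have comp: "continuous_on {..tmax} (\<lambda>t. F (\<Phi> t))"
    if "\<And>u. u > 0 \<Longrightarrow> (F has_real_derivative F' u) (at u)" for F F'
    by (rule continuous_on_compose2[OF DERIV_continuous_on[of "{0<..}" F F', OF has_field_derivative_at_within[OF that]]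
          cont(1)]) (use pos_le in auto)
  have int: "interior {..tmax} = ?I" by simp
  have T: "arclength (\<Phi> t) = t + d" if t: "t \<le> tmax" for t
  proof -
    have "arclength (\<Phi> t) - t = arclength (\<Phi> tmax) - tmax"
    proof (rule constant_on_interval[of "{..tmax}" "\<lambda>t. arclength (\<Phi> t) - t" t tmax])
      show "continuous_on {..tmax} (\<lambda>t. arclength (\<Phi> t) - t)"
        by (intro continuous_intros comp[OF arclength_deriv])
      fix x assume "x \<in> interior {..tmax}"
      then have x: "x < tmax" by (simp add: int)
      have "((\<lambda>t. arclength (\<Phi> t) - t) has_real_derivative 1 / sine (\<Phi> x) * \<Phi>' x - 1) (at x)"
        by (intro DERIV_diff DERIV_ident DERIV_chain2[OF arclength_deriv d\<Phi>(1)] pos x)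
      then show "((\<lambda>t. arclength (\<Phi> t) - t) has_real_derivative 0) (at x)"
        using \<Phi>'[OF x] sine_pos[OF pos(1)[OF x]] by simp
    qed (use t in auto)
    then show ?thesis by (simp add: d_def tip)
  qed
  have H: "height (\<Phi> t) = \<Psi> t + e" if t: "t \<le> tmax" for t
  proof -
    have "height (\<Phi> t) - \<Psi> t = height (\<Phi> tmax) - \<Psi> tmax"
    proof (rule constant_on_interval[of "{..tmax}" "\<lambda>t. height (\<Phi> t) - \<Psi> t" t tmax])
      show "continuous_on {..tmax} (\<lambda>t. height (\<Phi> t) - \<Psi> t)"
        by (intro continuous_intros comp[OF height_deriv] cont(2))
      fix x assume "x \<in> interior {..tmax}"
      then have x: "x < tmax" by (simp add: int)
      have "((\<lambda>t. height (\<Phi> t) - \<Psi> t) has_real_derivative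
          cosine (\<Phi> x) / sine (\<Phi> x) * \<Phi>' x - \<Psi>' x) (at x)"
        by (intro DERIV_diff d\<Phi>(2) DERIV_chain2[OF height_deriv d\<Phi>(1)] pos x)
      then show "((\<lambda>t. height (\<Phi> t) - \<Psi> t) has_real_derivative 0) (at x)"
        using \<Phi>'[OF x] ode(2)[of x] x pos(1)[OF x] sine_pos[OF pos(1)[OF x]] by simp
    qed (use t in auto)
    then show ?thesis by (simp add: e_def tip)
  qed
  have eq: "\<Phi> t = radius (t + d)" if "t \<le> tmax" for t
    using radius_arclength[OF pos_le[OF that]] T[OF that] by simp
  then have "\<Psi> t = height (radius (t + d)) - e" if "t \<le> tmax" for t
    using H[OF that] that by simp
  then show ?thesis using that[of d e] eq by (simp add: d_def)
qed

section \<open>The hypersurface as a graph over a punctured ball, and its chart\<close>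

lemma rotate_curve_radius:
  assumes "\<And>t. t \<in> I \<Longrightarrow> \<Phi> t = radius (t + d) \<and> \<Psi> t = height (radius (t + d)) - e"
  shows "rotate_curve I \<Phi> \<Psi> =
    (\<lambda>x :: real^'m::finite. (x, height (norm x) - e)) ` {x. x \<noteq> 0 \<and> arclength (norm x) - d \<in> I}"
proof (intro set_eqI iffI)
  fix p :: "(real^'m) \<times> real"
  obtain x z where p: "p = (x, z)" by fastforce
  have pos: "\<Phi> t > 0" if "t \<in> I" for t using assms[OF that] radius(1) by simp
  have iff: "p \<in> rotate_curve I \<Phi> \<Psi> \<longleftrightarrow> (\<exists>t\<in>I. norm x = radius (t + d) \<and> z = height (radius (t + d)) - e)"
  proof -
    have "p \<in> rotate_curve I \<Phi> \<Psi> \<longleftrightarrow> (\<exists>t\<in>I. norm x = \<Phi> t \<and> z = \<Psi> t)"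
      unfolding p by (rule rotate_curve_eq) (rule pos)
    also have "\<dots> \<longleftrightarrow> (\<exists>t\<in>I. norm x = radius (t + d) \<and> z = height (radius (t + d)) - e)"
      by (rule bex_cong) (simp_all add: assms)
    finally show ?thesis .
  qed
  show "p \<in> (\<lambda>x. (x, height (norm x) - e)) ` {x. x \<noteq> 0 \<and> arclength (norm x) - d \<in> I}"
    if "p \<in> rotate_curve I \<Phi> \<Psi>"
  proof -
    obtain t where t: "t \<in> I" "norm x = radius (t + d)" "z = height (radius (t + d)) - e"
      using \<open>p \<in> rotate_curve I \<Phi> \<Psi>\<close> unfolding iff by blast
    then show ?thesis using radius[of "t + d"] by (auto simp: p)
  qed
  show "p \<in> rotate_curve I \<Phi> \<Psi>"
    if "p \<in> (\<lambda>x. (x, height (norm x) - e)) ` {x. x \<noteq> 0 \<and> arclength (norm x) - d \<in> I}"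
    unfolding iff using that radius_arclength
    by (intro bexI[of _ "arclength (norm x) - d"]) (auto simp: p)
qed

text \<open>The second coordinate \<open>s\<close> is 0 on the boundary sphere and tends to infinity
  along the end where the radius tends to 0. The formula makes sense for all \<open>s > - 1\<close>,
  that is, past the boundary, which provides the open extension demanded by
  \<open>Ck_on\<close>.\<close>

definition chart :: "real \<Rightarrow> (real^'m::finite) \<times> real \<Rightarrow> (real^'m) \<times> real" where
  "chart e p = ((R / (1 + snd p)) *\<^sub>R fst p, height (R / (1 + snd p)) - e)"

text \<open>\<open>A\<close> is left free because the lemma serves twice: with all positive radii,
  where \<open>height\<close> is C^1, and with radii below \<open>R\<close>, where it is
  smooth.\<close>

lemma chart_smooth:
  assumes "open S" "\<And>p. p \<in> S \<Longrightarrow> - 1 < snd p" "open A"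
    and "\<And>p. p \<in> S \<Longrightarrow> R / (1 + snd p) \<in> A" "Ck_on_open k height A"
  shows "Ck_on_open k (chart e) S"
proof -
  have r: "Ck_on_open k (\<lambda>p. R / (1 + snd p)) S"
    by (rule Ck_on_open_divide[OF assms(1)])
      (use assms(1,2) in \<open>auto intro!: Ck_on_open_add Ck_on_open_const Ck_on_open_snd simp: add_pos_nonneg less_diff_eq\<close>, smt (verit))
  have "Ck_on_open k (\<lambda>p. height (R / (1 + snd p))) S"
    by (rule Ck_on_open_compose[OF assms(1,3) _ r assms(5)]) (use assms(4) in auto)
  then show ?thesis
    unfolding chart_def
    by (intro Ck_on_open_Pair Ck_on_open_bilinear[OF bounded_bilinear_scaleR] Ck_on_open_diff
        Ck_on_open_const Ck_on_open_fst r assms(1))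
qed

text \<open>The hypersurface is a graph, so the inverse \<open>G\<close> reads off
  \<open>x / norm x\<close> and \<open>R / norm x - 1\<close> from the horizontal part alone and
  never meets \<open>height\<close>. It is smooth even at the boundary; only the forward map loses
  regularity there.\<close>

lemma chart_diffeomorphism:
  assumes J: "J \<subseteq> {0..}" and smooth: "Ck_on k (chart e) (sphere (0 :: real^'m::finite) 1 \<times> J)"
    and A: "A = {x. x \<noteq> 0 \<and> R / norm x - 1 \<in> J}"
  shows "Ck_diffeomorphism k (sphere (0 :: real^'m) 1 \<times> J)
    ((\<lambda>x :: real^'m. (x, height (norm x) - e)) ` A) (chart e)"
proof -
  let ?X = "sphere (0 :: real^'m) 1 \<times> J" and ?Y = "(\<lambda>x :: real^'m. (x, height (norm x) - e)) ` A"
  define G where "G q = ((1 / norm (fst q)) *\<^sub>R fst q, R / norm (fst q) - 1)" for q :: "(real^'m) \<times> real"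
  have GF: "G (chart e p) = p" if "p \<in> ?X" for p
  proof -
    have "1 + snd p > 0" using that J by (auto simp: subset_eq add_pos_nonneg)
    then show ?thesis using that R_pos by (auto simp: G_def chart_def)
  qed
  have FY: "chart e p \<in> ?Y" if "p \<in> ?X" for p
  proof -
    have pos: "R / (1 + snd p) > 0" using that J R_pos by (auto simp: subset_eq add_pos_nonneg)
    have "norm ((R / (1 + snd p)) *\<^sub>R fst p) = \<bar>R / (1 + snd p)\<bar>" using that by auto
    then have n: "norm ((R / (1 + snd p)) *\<^sub>R fst p) = R / (1 + snd p)" using pos by linarith
    have "R / (R / (1 + snd p)) - 1 = snd p" using R_pos by simp
    then have "(R / (1 + snd p)) *\<^sub>R fst p \<in> A" using that n pos unfolding A by force
    then show ?thesis unfolding chart_def using n by (metis (no_types, lifting) image_eqI)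
  qed
  have FG: "G q \<in> ?X" "chart e (G q) = q" if "q \<in> ?Y" for q
    using that R_pos by (auto simp: A G_def chart_def)
  have bij: "bij_betw (chart e) ?X ?Y"
    by (rule bij_betw_byWitness[where f' = G]) (use GF FY FG in blast)+
  have inv: "inv_into ?X (chart e) q = G q" if "q \<in> ?Y" for q
    by (rule inv_into_f_eq[OF bij_betw_imp_inj_on[OF bij] FG[OF that]])
  have "open ((- {0 :: real^'m}) \<times> (UNIV :: real set))" (is "open ?U") by (intro open_Times) auto
  have n: "Ck_on_open j (\<lambda>q. norm (fst q)) ?U" for j
    by (rule Ck_on_open_compose[OF \<open>open ?U\<close> _ _ Ck_on_open_fst[OF \<open>open ?U\<close>] Ck_on_open_norm]) auto
  have "Ck_on_open j G ?U" for j
    unfolding G_def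
    by (intro Ck_on_open_Pair Ck_on_open_bilinear[OF bounded_bilinear_scaleR] Ck_on_open_diff
        Ck_on_open_divide Ck_on_open_const Ck_on_open_fst n \<open>open ?U\<close>) auto
  then have "Ck_on k (inv_into ?X (chart e)) ?Y"
    by (intro Ck_on_openI[OF \<open>open ?U\<close>, where g = G]) (auto simp: inv A)
  then show ?thesis using bij smooth by (simp add: Ck_diffeomorphism_def)
qed

lemma maximal_solution_diffeomorphism:
  assumes max: "maximal_solution (Suc m) curvature tmax \<Phi> \<Psi>"
  shows "\<exists>F. Ck_diffeomorphism 1 (sphere (0 :: real^'m::finite) 1 \<times> {0 :: real..})
               (rotate_curve {..tmax} \<Phi> \<Psi> :: ((real^'m) \<times> real) set) F \<and>
             Ck_diffeomorphism \<infinity> (sphere (0 :: real^'m) 1 \<times> {0 :: real<..})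
               (rotate_curve {..<tmax} \<Phi> \<Psi> :: ((real^'m) \<times> real) set) F"
proof -
  obtain d e where de: "tmax = arclength R - d" "\<And>t. t \<le> tmax \<Longrightarrow> \<Phi> t = radius (t + d)"
    "\<And>t. t \<le> tmax \<Longrightarrow> \<Psi> t = height (radius (t + d)) - e"
    using maximal_solution_unique[OF max] by blast
  have "Ck_diffeomorphism 1 (sphere (0 :: real^'m) 1 \<times> {0 :: real..})
      (rotate_curve {..tmax} \<Phi> \<Psi>) (chart e)"
  proof (subst rotate_curve_radius[of _ \<Phi> d \<Psi> e])
    show "Ck_diffeomorphism 1 (sphere (0 :: real^'m) 1 \<times> {0..})
      ((\<lambda>x. (x, height (norm x) - e)) ` {x. x \<noteq> 0 \<and> arclength (norm x) - d \<in> {..tmax}}) (chart e)"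
    proof (rule chart_diffeomorphism)
      \<comment> \<open>An open neighbourhood of the closed half-cylinder: for
        \<open>s > - 1\<close> the radius \<open>R / (1 + s)\<close> takes values beyond
        \<open>R\<close>.\<close>
      have "Ck_on_open 1 (chart e) ((UNIV :: (real^'m) set) \<times> {- 1<..})"
        by (rule chart_smooth[OF _ _ _ _ C1_height]) (use R_pos in \<open>auto intro!: open_Times\<close>)
      then show "Ck_on 1 (chart e) (sphere (0 :: real^'m) 1 \<times> {0..})"
        using Ck_on_open_le[of _ 1]
        by (intro Ck_on_openI[of "(UNIV :: (real^'m) set) \<times> {- 1<..}"])
          (auto intro!: open_Times simp: one_enat_def simp del: Ck_on_open.simps)
      show "{x. x \<noteq> 0 \<and> arclength (norm x) - d \<in> {..tmax}} = {x :: real^'m. x \<noteq> 0 \<and> R / norm x - 1 \<in> {0..}}"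
        using arclength_le_iff[OF _ R_pos] R_pos by (auto simp: de(1) field_simps)
    qed simp
  qed (use de in auto)
  moreover have "Ck_diffeomorphism \<infinity> (sphere (0 :: real^'m) 1 \<times> {0 :: real<..})
      (rotate_curve {..<tmax} \<Phi> \<Psi>) (chart e)"
  proof (subst rotate_curve_radius[of _ \<Phi> d \<Psi> e])
    show "Ck_diffeomorphism \<infinity> (sphere (0 :: real^'m) 1 \<times> {0<..})
      ((\<lambda>x. (x, height (norm x) - e)) ` {x. x \<noteq> 0 \<and> arclength (norm x) - d \<in> {..<tmax}}) (chart e)"
    proof (rule chart_diffeomorphism)
      \<comment> \<open>Here \<open>s > 0\<close> keeps the radius strictly below \<open>R\<close>,
        away from the singularity of the cosine.\<close>
      have "Ck_on_open j (chart e) ((UNIV :: (real^'m) set) \<times> {0<..})" for j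
        by (rule chart_smooth[OF _ _ _ _ smooth_height])
          (use R_pos in \<open>auto intro!: open_Times simp: field_simps\<close>)
      then show "Ck_on \<infinity> (chart e) (sphere (0 :: real^'m) 1 \<times> {0<..})"
        by (intro Ck_on_openI[of "(UNIV :: (real^'m) set) \<times> {0<..}"]) (auto intro!: open_Times)
      show "{x. x \<noteq> 0 \<and> arclength (norm x) - d \<in> {..<tmax}} = {x :: real^'m. x \<noteq> 0 \<and> R / norm x - 1 \<in> {0<..}}"
        using arclength_less_iff[OF _ R_pos] R_pos by (auto simp: de(1) field_simps)
    qed auto
  qed (use de in auto)
  ultimately show ?thesis by blast
qed

end

section \<open>Coverings of rotated arcs\<close>

lemma power_diff_le:
  fixes x y :: real assumes "0 \<le> y" "y \<le> x"
  shows "x ^ n - y ^ n \<le> n * x ^ (n - 1) * (x - y)"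
proof (induction n)
  case (Suc n)
  have "x ^ Suc n - y ^ Suc n = x * (x ^ n - y ^ n) + y ^ n * (x - y)" by (simp add: algebra_simps)
  also have "\<dots> \<le> x * (n * x ^ (n - 1) * (x - y)) + x ^ n * (x - y)"
    using Suc assms by (intro add_mono mult_left_mono mult_right_mono power_mono) auto
  also have "\<dots> = Suc n * x ^ (Suc n - 1) * (x - y)"
    by (cases n) (auto simp: algebra_simps)
  finally show ?case .
qed simp

text \<open>The balls of radius \<open>r / 2\<close> around an \<open>r\<close>-separated subset of the unit sphere are disjoint
  and contained in a spherical shell of volume \<open>O(r)\<close>.\<close>

lemma card_separated_sphere:
  fixes A :: "'a::euclidean_space set" and r :: real
  assumes r: "0 < r" "r \<le> 1" and A: "finite A" "A \<subseteq> sphere 0 1"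
    and sep: "\<And>x y. x \<in> A \<Longrightarrow> y \<in> A \<Longrightarrow> x \<noteq> y \<Longrightarrow> r \<le> dist x y"
  shows "card A * r ^ (DIM('a) - 1) \<le> DIM('a) * 3 ^ DIM('a)"
proof -
  let ?D = "DIM('a)" and ?\<omega> = "unit_ball_vol (real DIM('a))"
  let ?U = "\<Union>a\<in>A. ball a (r / 2)"
  have "?D > 0" by simp
  have fin: "emeasure lborel (ball a s) \<noteq> \<infinity>" for a :: 'a and s
    using emeasure_lborel_ball_finite[of a s] by simp
  have disj: "disjoint_family_on (\<lambda>a. ball a (r / 2)) A"
    unfolding disjoint_family_on_def
  proof (intro ballI impI equals0I)
    fix a b x assume *: "a \<in> A" "b \<in> A" "a \<noteq> b" "x \<in> ball a (r / 2) \<inter> ball b (r / 2)"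
    then have "dist a b < r" using dist_triangle_half_r[of x a r b] by (simp add: dist_commute)
    then show False using sep[OF *(1-3)] by simp
  qed
  have "measure lborel ?U = (\<Sum>a\<in>A. measure lborel (ball a (r / 2)))"
    using A(1) disj fin by (intro measure_finite_Union) auto
  then have U: "measure lborel ?U = card A * (?\<omega> * (r / 2) ^ ?D)"
    using r by (simp add: content_ball)
  have finU: "emeasure lborel ?U \<noteq> \<infinity>"
  proof -
    have "bounded ?U" using A(1) by (intro bounded_UN) auto
    from emeasure_bounded_finite[OF this] show ?thesis by simp
  qed
  have "?U \<inter> ball 0 (1 - r / 2) = {}"
  proof (intro equals0I)
    fix x assume "x \<in> ?U \<inter> ball 0 (1 - r / 2)"
    then obtain a where "a \<in> A" "dist a x < r / 2" "norm x < 1 - r / 2" by auto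
    moreover have "norm a \<le> norm x + dist a x" by (metis dist_norm norm_triangle_sub)
    ultimately show False using A(2) by auto
  qed
  then have "measure lborel (?U \<union> ball 0 (1 - r / 2)) = measure lborel ?U + measure lborel (ball (0::'a) (1 - r / 2))"
    using finU fin by (intro measure_Union) (auto intro!: borel_open)
  moreover have "measure lborel (?U \<union> ball 0 (1 - r / 2)) \<le> measure lborel (ball (0::'a) (1 + r / 2))"
  proof (rule measure_mono_fmeasurable)
    show "?U \<union> ball 0 (1 - r / 2) \<subseteq> ball 0 (1 + r / 2)"
    proof
      fix x assume "x \<in> ?U \<union> ball 0 (1 - r / 2)"
      then consider a where "a \<in> A" "dist a x < r / 2" | "norm x < 1 - r / 2" by auto
      then show "x \<in> ball 0 (1 + r / 2)"
      proof cases
        case 1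
        have "norm x \<le> norm a + dist a x" by (metis dist_commute dist_norm norm_triangle_sub)
        then show ?thesis using 1 A(2) by auto
      qed (use r in auto)
    qed
    show "?U \<union> ball 0 (1 - r / 2) \<in> sets lborel"
      by (intro sets.Un) (auto intro!: borel_open)
    show "ball 0 (1 + r / 2) \<in> fmeasurable lborel"
      by (intro fmeasurableI emeasure_lborel_ball_finite) auto
  qed
  ultimately have "card A * (?\<omega> * (r / 2) ^ ?D) + ?\<omega> * (1 - r / 2) ^ ?D \<le> ?\<omega> * (1 + r / 2) ^ ?D"
    using r U by (simp add: content_ball)
  then have "?\<omega> * (card A * (r / 2) ^ ?D) \<le> ?\<omega> * ((1 + r / 2) ^ ?D - (1 - r / 2) ^ ?D)"
    by (simp add: algebra_simps)
  moreover have "?\<omega> > 0" by simp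
  ultimately have "card A * (r / 2) ^ ?D \<le> (1 + r / 2) ^ ?D - (1 - r / 2) ^ ?D"
    by (simp only: mult_le_cancel_left_pos)
  also have "\<dots> \<le> ?D * (1 + r / 2) ^ (?D - 1) * ((1 + r / 2) - (1 - r / 2))"
    using r by (intro power_diff_le) auto
  also have "\<dots> \<le> ?D * (3 / 2) ^ (?D - 1) * r"
    using r by (auto intro!: mult_right_mono mult_left_mono power_mono)
  finally have le: "card A * (r / 2) ^ ?D \<le> ?D * (3 / 2) ^ (?D - 1) * r" .
  obtain k where k: "?D = Suc k" using gr0_implies_Suc[OF \<open>?D > 0\<close>] by blast
  \<comment> \<open>Clearing the powers of 2; the factor \<open>r\<close> on the right is the
    thickness of the shell and lowers the exponent from \<open>DIM('a)\<close> to
    \<open>k\<close>.\<close>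
  have "(card A * r ^ k) * r \<le> (2 * ?D * 3 ^ k) * r"
    using le by (simp add: k power_divide field_simps)
  then have "card A * r ^ k \<le> 2 * ?D * 3 ^ k" using r(1) by (simp only: mult_le_cancel_right_pos)
  also have "\<dots> \<le> ?D * 3 ^ ?D" by (simp add: k)
  finally show ?thesis by (simp add: k)
qed

text \<open>A separated set of greatest cardinality is a net: a point farther than \<open>r\<close>
  from all its members could be added. The packing bound guarantees that the greatest cardinality
  exists and also counts the balls.\<close>

lemma sphere_cover:
  fixes r :: real
  assumes r: "0 < r" "r \<le> 1"
  obtains A :: "'a::euclidean_space set" where "finite A"
    "sphere 0 1 \<subseteq> (\<Union>a\<in>A. cball a r)" "card A * r ^ (DIM('a) - 1) \<le> DIM('a) * 3 ^ DIM('a)"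
proof -
  define P where "P A \<longleftrightarrow> finite A \<and> A \<subseteq> sphere 0 1 \<and> (\<forall>x\<in>A. \<forall>y\<in>A. x \<noteq> y \<longrightarrow> r \<le> dist x y)" for A :: "'a set"
  have bound: "card A * r ^ (DIM('a) - 1) \<le> DIM('a) * 3 ^ DIM('a)" if "P A" for A
    using card_separated_sphere[OF r, of A] that unfolding P_def by blast
  define b where "b = nat \<lceil>DIM('a) * 3 ^ DIM('a) / r ^ (DIM('a) - 1)\<rceil> + 1"
  have "card A < b" if "P A" for A
  proof -
    have "real (card A) \<le> DIM('a) * 3 ^ DIM('a) / r ^ (DIM('a) - 1)"
      using bound[OF that] r(1) by (simp add: pos_le_divide_eq)
    then show ?thesis unfolding b_def by linarith
  qed
  moreover have "P {}" by (simp add: P_def)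
  ultimately obtain A where A: "P A" "\<And>B. P B \<Longrightarrow> card B \<le> card A"
    using ex_has_greatest_nat[of P "{}" card b] by blast
  have "x \<in> (\<Union>a\<in>A. cball a r)" if x: "x \<in> sphere 0 1" for x
  proof (rule ccontr)
    assume "x \<notin> (\<Union>a\<in>A. cball a r)"
    then have far: "\<And>a. a \<in> A \<Longrightarrow> r < dist a x" by force
    then have "P (insert x A)"
      using A(1) x unfolding P_def by (auto simp: dist_commute less_imp_le)
    moreover have "x \<notin> A" using far r(1) by force
    ultimately show False using A(2)[of "insert x A"] A(1) by (simp add: P_def)
  qed
  then have sub: "sphere 0 1 \<subseteq> (\<Union>a\<in>A. cball a r)" by blast
  show ?thesis by (rule that[OF _ sub bound[OF A(1)]]) (use A(1) in \<open>simp add: P_def\<close>)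
qed

text \<open>The premeasure uses coverings indexed by all naturals. A finite one is padded with empty
  sets; as \<open>d \<ge> 1\<close>, their diameter 0 contributes 0.\<close>

lemma finite_cover_sequence:
  fixes \<U> :: "'a::metric_space set set"
  assumes "finite \<U>" "card \<U> \<le> N" "q \<ge> 0" "d \<ge> 1"
    and U: "\<And>U. U \<in> \<U> \<Longrightarrow> bounded U \<and> diameter U \<le> q"
  obtains V :: "nat \<Rightarrow> 'a set" where "(\<Union>i. V i) = \<Union>\<U>" "\<And>i. bounded (V i)" "\<And>i. diameter (V i) \<le> q"
    "(\<Sum>i. ennreal (unit_ball_vol (real d) * (diameter (V i) / 2) ^ d))
       \<le> ennreal (N * (unit_ball_vol (real d) * (q / 2) ^ d))"
proof -
  obtain xs where xs: "set xs = \<U>" "length xs = card \<U>"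
    using finite_distinct_list[OF assms(1)] distinct_card by metis
  define V where "V i = (if i < length xs then xs ! i else {})" for i
  have V: "bounded (V i)" "diameter (V i) \<le> q" for i
    using U assms(3) xs(1) by (auto simp: V_def)
  have "(\<Union>i. V i) = \<Union>\<U>"
  proof -
    have "(\<Union>i. V i) = (\<Union>i<length xs. xs ! i)" by (auto simp: V_def split: if_splits)
    also have "\<dots> = \<Union>(set xs)" by (auto simp: set_conv_nth)
    finally show ?thesis using xs(1) by simp
  qed
  moreover have "(\<Sum>i. ennreal (unit_ball_vol (real d) * (diameter (V i) / 2) ^ d))
      = (\<Sum>i<length xs. ennreal (unit_ball_vol (real d) * (diameter (V i) / 2) ^ d))"
    using assms(4) by (intro suminf_finite) (auto simp: V_def)
  moreover have "\<dots> \<le> (\<Sum>i<length xs. ennreal (unit_ball_vol (real d) * (q / 2) ^ d))"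
    using V by (intro sum_mono ennreal_leI mult_left_mono power_mono divide_right_mono)
      (auto intro: diameter_ge_0)
  moreover have "\<dots> = ennreal (length xs * (unit_ball_vol (real d) * (q / 2) ^ d))"
    using assms(3) by (simp add: ennreal_of_nat_eq_real_of_nat ennreal_mult)
  moreover have "\<dots> \<le> ennreal (N * (unit_ball_vol (real d) * (q / 2) ^ d))"
    using assms(2,3) xs(2) by (intro ennreal_leI mult_right_mono) auto
  ultimately show ?thesis by (intro that[of V] V) (simp_all only: order_trans)
qed

text \<open>Coverings of all the \<open>S j\<close> merge into one sequence through the pairing
  function on the naturals, and the sum over pairs is an iterated sum.\<close>

lemma hausdorff_premeasure_UN_le:
  fixes S :: "nat \<Rightarrow> 'a::metric_space set"
  assumes "\<And>j. \<exists>V :: nat \<Rightarrow> 'a set. S j \<subseteq> (\<Union>i. V i) \<and> (\<forall>i. bounded (V i) \<and> diameter (V i) \<le> \<delta>) \<and>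
    (\<Sum>i. ennreal (unit_ball_vol (real d) * (diameter (V i) / 2) ^ d)) \<le> c j"
  shows "hausdorff_premeasure d \<delta> (\<Union>j. S j) \<le> (\<Sum>j. c j)"
proof -
  obtain V :: "nat \<Rightarrow> nat \<Rightarrow> 'a set" where V: "\<And>j. S j \<subseteq> (\<Union>i. V j i)"
    "\<And>j i. bounded (V j i) \<and> diameter (V j i) \<le> \<delta>"
    "\<And>j. (\<Sum>i. ennreal (unit_ball_vol (real d) * (diameter (V j i) / 2) ^ d)) \<le> c j"
    using assms by metis
  define W where "W = (\<lambda>k. case prod_decode k of (j, i) \<Rightarrow> V j i)"
  have "(\<Union>j. S j) \<subseteq> (\<Union>k. W k)"
  proof
    fix x assume "x \<in> (\<Union>j. S j)"
    then obtain j i where "x \<in> V j i" using V(1) by blast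
    then have "x \<in> W (prod_encode (j, i))" by (simp add: W_def)
    then show "x \<in> (\<Union>k. W k)" by blast
  qed
  moreover have "bounded (W k) \<and> diameter (W k) \<le> \<delta>" for k
    using V(2) by (simp add: W_def split: prod.split)
  ultimately have "hausdorff_premeasure d \<delta> (\<Union>j. S j)
      \<le> (\<Sum>k. ennreal (unit_ball_vol (real d) * (diameter (W k) / 2) ^ d))"
    unfolding hausdorff_premeasure_def by (intro INF_lower) auto
  also have "\<dots> = (\<Sum>k. (case prod_decode k of (j, i) \<Rightarrow>
      ennreal (unit_ball_vol (real d) * (diameter (V j i) / 2) ^ d)))"
    by (simp add: W_def split_beta)
  also have "\<dots> = (\<Sum>j. \<Sum>i. ennreal (unit_ball_vol (real d) * (diameter (V j i) / 2) ^ d))"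
    by (rule suminf_ennreal_2dimen[where f = "\<lambda>(j, i). ennreal (unit_ball_vol (real d) * (diameter (V j i) / 2) ^ d)"])
       simp
  also have "\<dots> \<le> (\<Sum>j. c j)" by (intro suminf_le V(3)) auto
  finally show ?thesis .
qed

text \<open>Cut time into slabs of length \<open>\<epsilon>\<close> and the sphere into caps of
  radius \<open>r = \<epsilon> / \<rho>\<close>. The radius contributes at most
  \<open>\<epsilon>\<close> to the diameter of a piece, the direction
  \<open>2 * \<rho> * r = 2 * \<epsilon>\<close> and the height \<open>\<epsilon>\<close>. The
  number of pieces times the m-th power of \<open>\<epsilon>\<close> (with m the cardinality of
  \<open>'m\<close>) is of order \<open>(b - a) * \<rho> ^ (CARD('m) - 1)\<close>, the area of a
  cylinder, uniformly in \<open>\<delta>\<close>.\<close>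

lemma rotated_arc_cover:
  fixes \<Phi> \<Psi> :: "real \<Rightarrow> real" and \<delta> \<rho> a b :: real
  defines "P \<equiv> (\<lambda>(t, w :: real^'m::finite). (\<Phi> t *\<^sub>R w, \<Psi> t))"
  assumes "a < b" "\<rho> > 0" "\<delta> > 0"
    and \<Phi>: "\<And>t. t \<in> {a..b} \<Longrightarrow> 0 \<le> \<Phi> t \<and> \<Phi> t \<le> \<rho>"
    and lip: "\<And>s t. \<bar>\<Phi> s - \<Phi> t\<bar> \<le> \<bar>s - t\<bar>" "\<And>s t. \<bar>\<Psi> s - \<Psi> t\<bar> \<le> \<bar>s - t\<bar>"
  shows "\<exists>V :: nat \<Rightarrow> ((real^'m) \<times> real) set. P ` ({a..b} \<times> sphere 0 1) \<subseteq> (\<Union>i. V i) \<and>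
    (\<forall>i. bounded (V i) \<and> diameter (V i) \<le> \<delta>) \<and>
    (\<Sum>i. ennreal (unit_ball_vol (real CARD('m)) * (diameter (V i) / 2) ^ CARD('m)))
      \<le> ennreal (2 * unit_ball_vol (real CARD('m)) * CARD('m) * 6 ^ CARD('m) * \<rho> ^ (CARD('m) - 1) * (b - a))"
proof -
  \<comment> \<open>The three bounds serve the diameter limit \<open>\<delta>\<close>, the
    requirement \<open>r \<le> 1\<close> of \<open>sphere_cover\<close>, and the rounding of the
    slab count.\<close>
  define \<epsilon> where "\<epsilon> = Min {\<delta> / 4, \<rho>, b - a}"
  have \<epsilon>: "0 < \<epsilon>" "4 * \<epsilon> \<le> \<delta>" "\<epsilon> \<le> \<rho>" "\<epsilon> \<le> b - a"
    using assms(2-4) by (auto simp: \<epsilon>_def min_def)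
  define r where "r = \<epsilon> / \<rho>"
  have r: "0 < r" "r \<le> 1" "\<rho> * r = \<epsilon>" using \<epsilon> assms(3) by (auto simp: r_def)
  obtain A :: "(real^'m) set" where A: "finite A" "sphere 0 1 \<subseteq> (\<Union>y\<in>A. cball y r)"
    "card A * r ^ (CARD('m) - 1) \<le> CARD('m) * 3 ^ CARD('m)"
    using sphere_cover[OF r(1,2), where 'a = "real^'m"] by auto
  define L where "L = nat \<lfloor>(b - a) / \<epsilon>\<rfloor>"
  define U where "U = (\<lambda>(l :: nat, y). P ` ({t \<in> {a..b}. a + l * \<epsilon> \<le> t \<and> t \<le> a + (real l + 1) * \<epsilon>} \<times> (sphere 0 1 \<inter> cball y r)))"
  define \<U> where "\<U> = U ` ({..L} \<times> A)"
  have dist_U: "dist p q \<le> 4 * \<epsilon>" if pq: "p \<in> U (l, y)" "q \<in> U (l, y)" for p q l y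
  proof -
    obtain s v where p: "p = (\<Phi> s *\<^sub>R v, \<Psi> s)" "s \<in> {a..b}" "a + l * \<epsilon> \<le> s" "s \<le> a + (real l + 1) * \<epsilon>"
      "norm v = 1" "dist y v \<le> r"
      using pq(1) by (auto simp: U_def P_def)
    obtain t w where q: "q = (\<Phi> t *\<^sub>R w, \<Psi> t)" "t \<in> {a..b}" "a + l * \<epsilon> \<le> t" "t \<le> a + (real l + 1) * \<epsilon>"
      "norm w = 1" "dist y w \<le> r"
      using pq(2) by (auto simp: U_def P_def)
    have st: "\<bar>s - t\<bar> \<le> \<epsilon>" using p q by (auto simp: abs_le_iff algebra_simps)
    have vw: "norm (v - w) \<le> 2 * r"
      using dist_triangle2[of v w y] p(6) q(6) by (simp add: dist_norm dist_commute norm_minus_commute)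
    have "\<Phi> s *\<^sub>R v - \<Phi> t *\<^sub>R w = (\<Phi> s - \<Phi> t) *\<^sub>R v + \<Phi> t *\<^sub>R (v - w)" by (simp add: algebra_simps)
    then have "norm (\<Phi> s *\<^sub>R v - \<Phi> t *\<^sub>R w) \<le> norm ((\<Phi> s - \<Phi> t) *\<^sub>R v) + norm (\<Phi> t *\<^sub>R (v - w))"
      by (metis norm_triangle_ineq)
    also have "\<dots> = \<bar>\<Phi> s - \<Phi> t\<bar> + \<Phi> t * norm (v - w)" using p(5) \<Phi>[OF q(2)] by simp
    also have "\<dots> \<le> \<epsilon> + \<rho> * (2 * r)"
      using lip(1)[of s t] st vw \<Phi>[OF q(2)] assms(3) by (intro add_mono mult_mono) auto
    finally have "norm (\<Phi> s *\<^sub>R v - \<Phi> t *\<^sub>R w) \<le> 3 * \<epsilon>" using r(3) by simp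
    moreover have "norm (\<Psi> s - \<Psi> t) \<le> \<epsilon>" using lip(2)[of s t] st by simp
    moreover have "dist p q \<le> norm (\<Phi> s *\<^sub>R v - \<Phi> t *\<^sub>R w) + norm (\<Psi> s - \<Psi> t)"
      using sqrt_sum_squares_le_sum[of "norm (\<Phi> s *\<^sub>R v - \<Phi> t *\<^sub>R w)" "norm (\<Psi> s - \<Psi> t)"]
      unfolding p(1) q(1) dist_Pair_Pair by (simp add: dist_norm)
    ultimately show ?thesis by simp
  qed
  have cover: "P ` ({a..b} \<times> sphere 0 1) \<subseteq> \<Union>\<U>"
  proof
    fix p assume "p \<in> P ` ({a..b} \<times> sphere 0 1)"
    then obtain t w where tw: "p = P (t, w)" "t \<in> {a..b}" "w \<in> sphere 0 1" by blast
    then obtain y where y: "y \<in> A" "w \<in> cball y r" using A(2) by blast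
    define l where "l = nat \<lfloor>(t - a) / \<epsilon>\<rfloor>"
    have "0 \<le> (t - a) / \<epsilon>" using tw(2) \<epsilon>(1) by simp
    then have "real l \<le> (t - a) / \<epsilon>" "(t - a) / \<epsilon> \<le> real l + 1" unfolding l_def by linarith+
    then have "a + l * \<epsilon> \<le> t" "t \<le> a + (real l + 1) * \<epsilon>" using \<epsilon>(1) by (simp_all add: field_simps)
    moreover have "l \<le> L" unfolding l_def L_def using tw(2) \<epsilon>(1)
      by (intro nat_mono floor_mono divide_right_mono) auto
    ultimately have "p \<in> U (l, y)" using tw y by (auto simp: U_def)
    then show "p \<in> \<Union>\<U>" using \<open>l \<le> L\<close> y(1) unfolding \<U>_def by blast
  qed
  have "card \<U> \<le> (L + 1) * card A"
    using card_image_le[of "{..L} \<times> A" U] A(1) by (simp add: \<U>_def card_cartesian_product)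
  moreover have "finite \<U>" using A(1) by (simp add: \<U>_def)
  moreover have "bounded V \<and> diameter V \<le> 4 * \<epsilon>" if V: "V \<in> \<U>" for V
  proof -
    obtain l y where "V = U (l, y)" using V by (auto simp: \<U>_def)
    then have d: "\<And>p q. p \<in> V \<Longrightarrow> q \<in> V \<Longrightarrow> dist p q \<le> 4 * \<epsilon>" using dist_U by blast
    then have "bounded V" unfolding bounded_two_points by blast
    moreover have "diameter V \<le> 4 * \<epsilon>"
      using d \<epsilon>(1) by (intro diameter_le) (auto simp: dist_norm)
    ultimately show ?thesis by blast
  qed
  moreover have "CARD('m) \<ge> 1" by (simp add: Suc_leI)
  ultimately obtain V :: "nat \<Rightarrow> ((real^'m) \<times> real) set" where
    V: "(\<Union>i. V i) = \<Union>\<U>" "\<And>i. bounded (V i)" "\<And>i. diameter (V i) \<le> 4 * \<epsilon>"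
    "(\<Sum>i. ennreal (unit_ball_vol (real CARD('m)) * (diameter (V i) / 2) ^ CARD('m)))
       \<le> ennreal (real ((L + 1) * card A) * (unit_ball_vol (real CARD('m)) * (4 * \<epsilon> / 2) ^ CARD('m)))"
    using finite_cover_sequence[of \<U> "(L + 1) * card A" "4 * \<epsilon>" "CARD('m)"] \<epsilon>(1) by auto
  \<comment> \<open>The constant: 2 from rounding the slab count, and 6 = 2 * 3 from half the
    diameter \<open>4 * \<epsilon>\<close> and from the packing bound.\<close>
  have "real ((L + 1) * card A) * (unit_ball_vol (real CARD('m)) * (4 * \<epsilon> / 2) ^ CARD('m))
      \<le> 2 * unit_ball_vol (real CARD('m)) * CARD('m) * 6 ^ CARD('m) * \<rho> ^ (CARD('m) - 1) * (b - a)"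
  proof -
    obtain k where k: "CARD('m) = Suc k" using \<open>CARD('m) \<ge> 1\<close> by (cases "CARD('m)") auto
    \<comment> \<open>The slabs are numbered from 0 to \<open>L\<close>; the extra one is absorbed
      by \<open>\<epsilon> \<le> b - a\<close>.\<close>
    have "real L + 1 \<le> (b - a) / \<epsilon> + (b - a) / \<epsilon>"
      using \<epsilon> assms(2) unfolding L_def by (intro add_mono) (auto simp: of_nat_nat)
    also have "\<dots> = 2 * (b - a) / \<epsilon>" by simp
    finally have L: "(real L + 1) * \<epsilon> \<le> 2 * (b - a)" by (simp only: pos_le_divide_eq[OF \<epsilon>(1)])
    have "card A * \<epsilon> ^ k = card A * r ^ k * \<rho> ^ k"
      using r(3) by (metis mult.assoc mult.commute power_mult_distrib)
    also have "\<dots> \<le> CARD('m) * 3 ^ CARD('m) * \<rho> ^ k"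
      using A(3) assms(3) by (intro mult_right_mono) (auto simp: k)
    finally have cA: "card A * \<epsilon> ^ k \<le> CARD('m) * 3 ^ CARD('m) * \<rho> ^ k" .
    have "real ((L + 1) * card A) * (unit_ball_vol (real CARD('m)) * (4 * \<epsilon> / 2) ^ CARD('m))
        = unit_ball_vol (real CARD('m)) * 2 ^ CARD('m) * (((real L + 1) * \<epsilon>) * (card A * \<epsilon> ^ k))"
      by (simp add: k power_mult_distrib algebra_simps)
    also have "\<dots> \<le> unit_ball_vol (real CARD('m)) * 2 ^ CARD('m) *
        ((2 * (b - a)) * (CARD('m) * 3 ^ CARD('m) * \<rho> ^ k))"
      by (intro mult_left_mono[OF mult_mono[OF L cA]]) (use assms(2) \<epsilon>(1) in auto)
    also have "\<dots> = 2 * unit_ball_vol (real CARD('m)) * CARD('m) * (2 ^ CARD('m) * 3 ^ CARD('m)) * \<rho> ^ k * (b - a)"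
      by (simp only: of_nat_mult of_nat_power of_nat_numeral mult_ac)
    also have "(2::real) ^ CARD('m) * 3 ^ CARD('m) = 6 ^ CARD('m)"
      by (simp flip: power_mult_distrib)
    finally show ?thesis by (simp add: k)
  qed
  then have "(\<Sum>i. ennreal (unit_ball_vol (real CARD('m)) * (diameter (V i) / 2) ^ CARD('m)))
      \<le> ennreal (2 * unit_ball_vol (real CARD('m)) * CARD('m) * 6 ^ CARD('m) * \<rho> ^ (CARD('m) - 1) * (b - a))"
    using V(4) ennreal_leI order_trans by blast
  moreover have "diameter (V i) \<le> \<delta>" for i using V(3)[of i] \<epsilon>(2) by linarith
  ultimately show ?thesis using V(1,2) cover by (intro exI[of _ V]) auto
qed

section \<open>Finite volume and the classification\<close>

context pseudospherical
begin

text \<open>Unit speed makes radius and height 1-Lipschitz, so \<open>rotated_arc_cover\<close>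
  applies to each arc on which the radius halves. The sum of the bounds is geometric and independent
  of \<open>\<delta>\<close>, hence survives the supremum in
  \<open>hausdorff_measure\<close>.\<close>

lemma maximal_solution_finite_volume:
  assumes m: "m = CARD('m::finite)" and max: "maximal_solution (Suc m) curvature tmax \<Phi> \<Psi>"
  shows "hausdorff_measure m (rotate_curve {..tmax} \<Phi> \<Psi> :: ((real^'m) \<times> real) set) < \<infinity>"
proof -
  obtain d e where de: "tmax = arclength R - d" "\<And>t. t \<le> tmax \<Longrightarrow> \<Phi> t = radius (t + d)"
    "\<And>t. t \<le> tmax \<Longrightarrow> \<Psi> t = height (radius (t + d)) - e"
    using maximal_solution_unique[OF max] by blast
  define \<rho> where "\<rho> j = R * (1 / 2) ^ j" for j
  have \<rho>: "\<rho> j > 0" "\<rho> (Suc j) < \<rho> j" "\<rho> j \<le> R" for j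
    using R_pos by (auto simp: \<rho>_def power_le_one)
  define \<tau> where "\<tau> j = arclength (\<rho> j) - d" for j
  have \<tau>_less: "\<tau> (Suc j) < \<tau> j" for j
    using arclength_less[OF \<rho>(1) \<rho>(2)] by (simp add: \<tau>_def)
  let ?r = "\<lambda>t. radius (t + d)" and ?h = "\<lambda>t. height (radius (t + d)) - e"
  have dr: "(?r has_real_derivative sine (?r t)) (at t)" for t
    using radius_deriv[of "t + d"] by (simp add: DERIV_shift)
  have dh: "(?h has_real_derivative cosine (?r t)) (at t)" for t
  proof -
    have "(?h has_real_derivative cosine (?r t) / sine (?r t) * sine (?r t) - 0) (at t)"
      by (intro DERIV_diff DERIV_const DERIV_chain2[OF height_deriv dr] radius)
    then show ?thesis using sine_pos[OF radius(1), of "t + d"] by simp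
  qed
  have lip: "\<bar>?r s - ?r t\<bar> \<le> \<bar>s - t\<bar>" "\<bar>?h s - ?h t\<bar> \<le> \<bar>s - t\<bar>" for s t
    using field_differentiable_bound[of UNIV ?r "\<lambda>t. sine (?r t)" 1 s t]
      field_differentiable_bound[of UNIV ?h "\<lambda>t. cosine (?r t)" 1 s t] dr dh
      sine_pos[OF radius(1)] sine_le_1 cosine_nonneg cosine_less_1[OF radius(1)]
    by (simp_all add: abs_of_nonneg less_imp_le)
  let ?P = "\<lambda>(t, w :: real^'m). (?r t *\<^sub>R w, ?h t)"
  define S where "S j = ?P ` ({\<tau> (Suc j)..\<tau> j} \<times> sphere 0 1)" for j
  have cover: "rotate_curve {..tmax} \<Phi> \<Psi> \<subseteq> (\<Union>j. S j)"
  proof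
    fix p :: "(real^'m) \<times> real" assume p: "p \<in> rotate_curve {..tmax} \<Phi> \<Psi>"
    obtain x z where xz: "p = (x, z)" by fastforce
    have pos: "\<Phi> t > 0" if "t \<in> {..tmax}" for t using de(2) radius(1) that by simp
    obtain t where t: "t \<le> tmax" "norm x = \<Phi> t" "z = \<Psi> t"
      using p rotate_curve_eq[of "{..tmax}" \<Phi> x z \<Psi>] pos unfolding xz by auto
    have x: "norm x = ?r t" "z = ?h t" using t de by auto
    have "?r t \<le> R" using t(1) radius_less_iff[OF R_pos, of "t + d"] arclength_le_iff[OF radius(1) R_pos, of "t + d"]
      by (simp add: de(1) radius)
    have "(\<lambda>j. R * (1 / 2) ^ j) \<longlonglongrightarrow> R * 0" by (intro tendsto_intros) auto
    then have "eventually (\<lambda>j. \<rho> j < ?r t) sequentially"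
      using radius(1)[of "t + d"] unfolding \<rho>_def by (intro order_tendstoD) auto
    then have ex: "\<exists>j. \<rho> j < ?r t" by (auto simp: eventually_sequentially)
    \<comment> \<open>Minimality puts the radius between \<open>\<rho> k\<close> and
      \<open>\<rho> (k - 1)\<close>; \<open>k\<close> is not 0 because \<open>\<rho> 0 = R\<close>
      is the largest radius.\<close>
    define k where "k = (LEAST j. \<rho> j < ?r t)"
    have k: "\<rho> k < ?r t" unfolding k_def using ex by (rule LeastI_ex)
    then obtain j where j: "k = Suc j" using \<open>?r t \<le> R\<close> by (cases k) (auto simp: \<rho>_def)
    have "\<not> \<rho> j < ?r t" using not_less_Least[of j "\<lambda>j. \<rho> j < ?r t"] j by (simp add: k_def)
    then have "arclength (\<rho> (Suc j)) \<le> t + d" "t + d \<le> arclength (\<rho> j)"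
      using k j arclength_le_iff[OF \<rho>(1) radius(1)] arclength_le_iff[OF radius(1) \<rho>(1)] radius(2)
      by (metis less_imp_le, metis not_less)
    then have "t \<in> {\<tau> (Suc j)..\<tau> j}" by (simp add: \<tau>_def)
    moreover have "?P (t, (1 / norm x) *\<^sub>R x) = p"
      using x radius(1)[of "t + d"] by (simp add: xz)
    moreover have "norm ((1 / norm x) *\<^sub>R x) = 1" using x radius(1)[of "t + d"] by auto
    ultimately have "p \<in> S j" unfolding S_def by (intro image_eqI[of _ _ "(t, (1 / norm x) *\<^sub>R x)"]) auto
    then show "p \<in> (\<Union>j. S j)" by blast
  qed
  define c where "c = 2 * unit_ball_vol (real m) * m * 6 ^ m"
  have c: "c \<ge> 0" by (simp add: c_def)
  define b where "b = c * R ^ m / 2 * sqrt (2 ^ m * m)"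
  have len: "c * \<rho> j ^ (m - 1) * (\<tau> j - \<tau> (Suc j)) \<le> b * (1 / 2) ^ j" for j
  proof -
    define x :: real where "x = (1 / 2) ^ j"
    have x: "0 < x" "x \<le> 1" "\<rho> j = R * x" "\<rho> (Suc j) = R * (x / 2)"
      by (auto simp: x_def \<rho>_def power_le_one)
    \<comment> \<open>Upper bound for \<open>1 / sine\<close> on the arc, from
      \<open>sine_ge\<close> at its smallest radius.\<close>
    define B where "B = 1 / sqrt ((x / 2) ^ m / m)"
    have "norm (arclength (\<rho> j) - arclength (\<rho> (Suc j))) \<le> B * norm (\<rho> j - \<rho> (Suc j))"
    proof (rule field_differentiable_bound[of "{\<rho> (Suc j)..\<rho> j}" _ "\<lambda>u. 1 / sine u"])
      fix u assume u: "u \<in> {\<rho> (Suc j)..\<rho> j}"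
      then have u0: "0 < u" "u \<le> R" using \<rho>(1)[of "Suc j"] \<rho>(3)[of j] by auto
      show "(arclength has_real_derivative 1 / sine u) (at u within {\<rho> (Suc j)..\<rho> j})"
        using arclength_deriv[OF u0(1)] by (rule has_field_derivative_at_within)
      have "x / 2 \<le> u / R" using u x(4) R_pos by (simp add: field_simps)
      then have "sqrt ((x / 2) ^ m / m) \<le> sqrt ((u / R) ^ m / m)"
        using x(1) by (intro real_sqrt_le_mono divide_right_mono power_mono) auto
      also have "\<dots> \<le> sine u" by (rule sine_ge[OF u0])
      finally have "sqrt ((x / 2) ^ m / m) \<le> sine u" .
      moreover have "0 < sqrt ((x / 2) ^ m / m)" using x(1) m2 by simp
      ultimately show "norm (1 / sine u) \<le> B"
        using sine_pos[OF u0(1)] unfolding B_def by (simp add: frac_le)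
    qed (use \<rho>(2)[of j] in auto)
    then have "\<tau> j - \<tau> (Suc j) \<le> B * (\<rho> j - \<rho> (Suc j))"
      using \<rho>(2)[of j] by (simp add: \<tau>_def)
    also have "\<rho> j - \<rho> (Suc j) = R * (x / 2)" by (simp add: x(3,4))
    finally have "\<tau> j - \<tau> (Suc j) \<le> B * (R * (x / 2))" .
    then have "c * \<rho> j ^ (m - 1) * (\<tau> j - \<tau> (Suc j)) \<le> c * \<rho> j ^ (m - 1) * (B * (R * (x / 2)))"
      using c \<rho>(1)[of j] by (intro mult_left_mono) auto
    also have "\<dots> = c * R ^ m / 2 * (x ^ m * B)"
      using m2 by (cases m) (auto simp: x(3) power_mult_distrib algebra_simps)
    \<comment> \<open>Half of the exponent cancels: \<open>x ^ m\<close> is a product of two square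
      roots, and \<open>B\<close> is a constant divided by one of them.\<close>
    also have "x ^ m * B = sqrt (2 ^ m * m) * sqrt (x ^ m)"
    proof -
      have "sqrt (x ^ m) * sqrt (x ^ m) = x ^ m" using x(1) by simp
      then have "x ^ m * B = sqrt (x ^ m) * (sqrt (x ^ m) / sqrt ((x / 2) ^ m / m))"
        by (simp add: B_def)
      also have "sqrt (x ^ m) / sqrt ((x / 2) ^ m / m) = sqrt (2 ^ m * m)"
        using x(1) by (simp add: real_sqrt_divide[symmetric] power_divide)
      finally show ?thesis by simp
    qed
    \<comment> \<open>Here \<open>m \<ge> 2\<close> enters: the remaining power
      \<open>x ^ (m / 2)\<close> is at most \<open>x\<close>, which is geometric in
      \<open>j\<close>.\<close>
    also have "c * R ^ m / 2 * (sqrt (2 ^ m * m) * sqrt (x ^ m)) \<le> c * R ^ m / 2 * (sqrt (2 ^ m * m) * x)"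
    proof -
      have "x ^ m \<le> x\<^sup>2" using x m2 by (intro power_decreasing) auto
      then have "sqrt (x ^ m) \<le> x" using x(1) by (intro real_le_lsqrt) auto
      then show ?thesis using c R_pos by (intro mult_left_mono) auto
    qed
    finally show ?thesis by (simp add: b_def x_def)
  qed
  have "hausdorff_premeasure m \<delta> (rotate_curve {..tmax} \<Phi> \<Psi> :: ((real^'m) \<times> real) set)
      \<le> (\<Sum>j. ennreal (b * (1 / 2) ^ j))" if "\<delta> > 0" for \<delta>
  proof -
    have "hausdorff_premeasure m \<delta> (\<Union>j. S j) \<le> (\<Sum>j. ennreal (b * (1 / 2) ^ j))"
    proof (rule hausdorff_premeasure_UN_le)
      fix j
      have "0 \<le> ?r t \<and> ?r t \<le> \<rho> j" if "t \<in> {\<tau> (Suc j)..\<tau> j}" for t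
        using that radius(1)[of "t + d"] arclength_le_iff[OF radius(1) \<rho>(1), of "t + d" j]
        by (simp add: \<tau>_def radius less_imp_le)
      from rotated_arc_cover[where 'm = 'm and \<Psi> = ?h, OF \<tau>_less \<rho>(1) that this lip]
      obtain V :: "nat \<Rightarrow> ((real^'m) \<times> real) set" where V: "S j \<subseteq> (\<Union>i. V i)"
        "\<forall>i. bounded (V i) \<and> diameter (V i) \<le> \<delta>"
        "(\<Sum>i. ennreal (unit_ball_vol (real m) * (diameter (V i) / 2) ^ m))
           \<le> ennreal (c * \<rho> j ^ (m - 1) * (\<tau> j - \<tau> (Suc j)))"
        unfolding S_def c_def m by blast
      then show "\<exists>V. S j \<subseteq> (\<Union>i. V i) \<and> (\<forall>i. bounded (V i) \<and> diameter (V i) \<le> \<delta>) \<and>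
        (\<Sum>i. ennreal (unit_ball_vol (real m) * (diameter (V i) / 2) ^ m)) \<le> ennreal (b * (1 / 2) ^ j)"
        using ennreal_leI[OF len] order_trans by blast
    qed
    moreover have "hausdorff_premeasure m \<delta> (rotate_curve {..tmax} \<Phi> \<Psi> :: ((real^'m) \<times> real) set)
      \<le> hausdorff_premeasure m \<delta> (\<Union>j. S j)"
      unfolding hausdorff_premeasure_def using cover by (intro INF_superset_mono) auto
    ultimately show ?thesis by (rule order_trans[rotated])
  qed
  then have "hausdorff_measure m (rotate_curve {..tmax} \<Phi> \<Psi> :: ((real^'m) \<times> real) set)
      \<le> (\<Sum>j. ennreal (b * (1 / 2) ^ j))"
    unfolding hausdorff_measure_def by (intro SUP_least) auto
  also have "\<dots> < \<infinity>"
  proof -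
    have "b \<ge> 0" using c R_pos by (simp add: b_def)
    moreover have "summable (\<lambda>j. b * (1 / 2) ^ j :: real)" by (intro summable_mult summable_geometric) simp
    ultimately have "(\<Sum>j. ennreal (b * (1 / 2) ^ j)) = ennreal (\<Sum>j. b * (1 / 2) ^ j)"
      by (intro suminf_ennreal2) auto
    then show ?thesis by simp
  qed
  finally show ?thesis .
qed

end

text \<open>The unit sphere of \<open>real^'m\<close> is S^(n-2). Clause (3) separates curve and
  geometry: the given curve, with time and height negated when \<open>\<sigma> = - 1\<close>, is a
  piece of a maximal solution, and diffeomorphism and volume bound are asserted for every maximal
  solution. A single \<open>F\<close> is C^1 up to the boundary and smooth inside.\<close>

theorem theorem1p1:
  fixes n :: nat
    and M :: "((real^'m::finite) \<times> real) set"
    and K :: real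
    and I J :: "real set"
    and f \<phi> \<psi> \<phi>' \<psi>' :: "real \<Rightarrow> real"
  assumes "n \<ge> 3"
    and "n = CARD('m) + 1"
    and "generating_graph J f"
    and "M = rotate_curve J f (\<lambda>z. z)"
    and "has_constant_gauss_curvature M K"
    and "arclength_curve I \<phi> \<psi> \<phi>' \<psi>'"
    and "\<psi> ` I = J"
    and "\<forall>t\<in>I. \<phi> t = f (\<psi> t)"
  shows "(K = 0 \<longrightarrow>
            (\<exists>S. (circular_cone S \<or> circular_cylinder S) \<and> M = {p\<in>S. snd p \<in> J}))
       \<and> (K \<noteq> 0 \<longrightarrow>
            (\<exists>C. integration_constant n K I \<phi> \<phi>' C \<and>
               (\<forall>t0\<in>I. \<forall>t\<in>I. \<forall>\<sigma>\<in>{1, - 1}.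
                  (\<forall>s\<in>open_segment t0 t. sgn (\<phi>' s) = \<sigma>) \<longrightarrow>
                    inj_on \<phi> (closed_segment t0 t) \<and>
                    t - t0 = (LBINT u=\<phi> t0..\<phi> t.
                      \<sigma> / sqrt (1 - (K * u ^ (n - 1) - C) powr (2 / (real n - 1))))))
            \<and> (\<forall>t0\<in>I. \<forall>t\<in>I. \<psi> t = \<psi> t0 + (LBINT s=t0..t. sqrt (1 - (\<phi>' s)\<^sup>2))))
       \<and> (K < 0 \<and> integration_constant n K I \<phi> \<phi>' (- 1) \<longrightarrow>
            (\<exists>tmax \<Phi> \<Psi>. maximal_solution n K tmax \<Phi> \<Psi> \<and>
               (\<exists>\<sigma>\<in>{1, - 1}. \<forall>t\<in>I.
                  \<sigma> * t \<le> tmax \<and> \<Phi> (\<sigma> * t) = \<phi> t \<and> \<Psi> (\<sigma> * t) = \<sigma> * \<psi> t))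
            \<and> (\<forall>tmax \<Phi> \<Psi>. maximal_solution n K tmax \<Phi> \<Psi> \<longrightarrow>
                 (\<exists>F. Ck_diffeomorphism 1 (sphere (0 :: real^'m) 1 \<times> {0 :: real..})
                        (rotate_curve {..tmax} \<Phi> \<Psi> :: ((real^'m) \<times> real) set) F \<and>
                      Ck_diffeomorphism \<infinity> (sphere (0 :: real^'m) 1 \<times> {0 :: real<..})
                        (rotate_curve {..<tmax} \<Phi> \<Psi> :: ((real^'m) \<times> real) set) F) \<and>
                 hausdorff_measure (n - 1)
                   (rotate_curve {..tmax} \<Phi> \<Psi> :: ((real^'m) \<times> real) set) < \<infinity>))"
proof -
  have f_pos: "f z > 0" if "z \<in> J" for z using assms(3) that by (auto simp: generating_graph_def)
  have pos: "\<phi> t > 0" if "t \<in> I" for t using that assms(7,8) f_pos[of "\<psi> t"] by auto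
  have M_iff: "(x, z) \<in> M \<longleftrightarrow> z \<in> J \<and> norm x = f z" for x z
  proof -
    have "(x, z) \<in> M \<longleftrightarrow> (\<exists>t\<in>J. norm x = f t \<and> z = t)"
      unfolding assms(4) by (rule rotate_curve_eq) (rule f_pos)
    then show ?thesis by auto
  qed
  have M_eq: "M = rotate_curve I \<phi> \<psi>"
  proof (rule set_eqI)
    fix p :: "(real^'m) \<times> real"
    obtain x z where p: "p = (x, z)" by fastforce
    have "(x, z) \<in> rotate_curve I \<phi> \<psi> \<longleftrightarrow> (\<exists>t\<in>I. norm x = \<phi> t \<and> z = \<psi> t)"
      by (rule rotate_curve_eq) (rule pos)
    then show "p \<in> M \<longleftrightarrow> p \<in> rotate_curve I \<phi> \<psi>"
      unfolding p M_iff using assms(7,8) by auto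
  qed
  interpret arclength_profile I \<phi> \<psi> \<phi>' \<psi>'
  proof
    have "infinite J" using assms(3) empty_interior_finite by (auto simp: generating_graph_def)
    then have "infinite I" using assms(7) by blast
    from infinite_imp_nonempty[OF this] obtain a where "a \<in> I" by blast
    moreover have "I - {a} \<noteq> {}"
      by (rule infinite_imp_nonempty[OF infinite_remove[OF \<open>infinite I\<close>]])
    ultimately show "\<exists>a\<in>I. \<exists>b\<in>I. a \<noteq> b" by blast
  qed (use assms(6) graph_imp_height_deriv_pos[OF assms(3,6,7,8)] in auto)
  obtain \<nu> where \<nu>: "unit_normal_field M \<nu>" "\<And>p. p \<in> M \<Longrightarrow> fst (\<nu> p) \<bullet> fst p < 0"
    "\<And>p. p \<in> M \<Longrightarrow> has_gauss_curvature M \<nu> p K"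
    using assms(5) unfolding has_constant_gauss_curvature_def by blast
  have interior: "t \<in> I" if "t \<in> interior I" for t using that interior_subset by blast
  interpret rotational_hypersurface I \<phi> \<psi> \<phi>' \<psi>' M \<nu>
    by (rule rotational_hypersurface.intro
        [OF M_eq pos deriv unit[OF interior] \<psi>'_pos[OF interior] \<nu>(1,2)])
  have gauss: "K * \<phi> t ^ (n - 2) = - \<phi>2 * \<psi>' t ^ (n - 3) \<and> \<phi>' t * \<phi>2 + \<psi>' t * \<psi>2 = 0"
    if "t \<in> interior I" "(\<phi>' has_real_derivative \<phi>2) (at t)" "(\<psi>' has_real_derivative \<psi>2) (at t)"
    for t \<phi>2 \<psi>2
    using gauss_curvature_eq[OF that \<nu>(3)] assms(1,2) by auto
  have flat: "\<exists>S. (circular_cone S \<or> circular_cylinder S) \<and> M = {p\<in>S. snd p \<in> J}" if "K = 0"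
  proof -
    obtain a b where ab: "\<And>t. t \<in> I \<Longrightarrow> \<phi> t = a * \<psi> t + b"
      using flat_profile[OF assms(1) pos] gauss \<open>K = 0\<close> by (metis mult_zero_left)
    have "f z = a * z + b" if "z \<in> J" for z using ab assms(7,8) that by fastforce
    moreover have "J \<noteq> {}" using assms(3) by (auto simp: generating_graph_def)
    ultimately show ?thesis
      by (intro affine_profile_cone_or_cylinder[OF f_pos _ _ M_iff])
  qed
  obtain C where C: "integration_constant n K I \<phi> \<phi>' C"
    using first_integral[OF assms(1) gauss] by blast
  note integral = inverse_integral_segment[OF assms(1) C]
  have negative: "(\<exists>tmax \<Phi> \<Psi>. maximal_solution n K tmax \<Phi> \<Psi> \<and>
        (\<exists>\<sigma>\<in>{1, - 1}. \<forall>t\<in>I. \<sigma> * t \<le> tmax \<and> \<Phi> (\<sigma> * t) = \<phi> t \<and> \<Psi> (\<sigma> * t) = \<sigma> * \<psi> t))"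
    (is ?extends)
    "\<And>tmax \<Phi> \<Psi>. maximal_solution n K tmax \<Phi> \<Psi> \<Longrightarrow>
        (\<exists>F. Ck_diffeomorphism 1 (sphere (0 :: real^'m) 1 \<times> {0 :: real..})
               (rotate_curve {..tmax} \<Phi> \<Psi> :: ((real^'m) \<times> real) set) F \<and>
             Ck_diffeomorphism \<infinity> (sphere (0 :: real^'m) 1 \<times> {0 :: real<..})
               (rotate_curve {..<tmax} \<Phi> \<Psi> :: ((real^'m) \<times> real) set) F) \<and>
        hausdorff_measure (n - 1) (rotate_curve {..tmax} \<Phi> \<Psi> :: ((real^'m) \<times> real) set) < \<infinity>"
    if "K < 0" "integration_constant n K I \<phi> \<phi>' (- 1)"
  proof -
    \<comment> \<open>The greatest radius, chosen so that \<open>- 1 / R ^ CARD('m)\<close> is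
      \<open>K\<close>.\<close>
    define R where "R = (- 1 / K) powr (1 / CARD('m))"
    have "R > 0" using \<open>K < 0\<close> by (simp add: R_def)
    then interpret p: pseudospherical "CARD('m)" R
      using assms(1,2) by unfold_locales auto
    have "R ^ CARD('m) = - 1 / K"
    proof -
      have "R ^ CARD('m) = R powr CARD('m)" using \<open>R > 0\<close> by (simp only: powr_realpow)
      also have "\<dots> = (- 1 / K) powr (1 / CARD('m) * CARD('m))" by (simp only: R_def powr_powr)
      finally show ?thesis using \<open>K < 0\<close> by (simp add: divide_nonpos_neg)
    qed
    then have K: "p.curvature = K" by (simp add: p.curvature_def)
    have n: "n = Suc CARD('m)" using assms(2) by simp
    show ?extends
      using p.maximal_solution_extends[OF arclength_profile_axioms _ pos] that(2) unfolding K n by blast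
    fix tmax \<Phi> \<Psi> assume "maximal_solution n K tmax \<Phi> \<Psi>"
    then have max: "maximal_solution (Suc CARD('m)) p.curvature tmax \<Phi> \<Psi>" by (simp only: K n)
    show "(\<exists>F. Ck_diffeomorphism 1 (sphere (0 :: real^'m) 1 \<times> {0 :: real..})
               (rotate_curve {..tmax} \<Phi> \<Psi> :: ((real^'m) \<times> real) set) F \<and>
             Ck_diffeomorphism \<infinity> (sphere (0 :: real^'m) 1 \<times> {0 :: real<..})
               (rotate_curve {..<tmax} \<Phi> \<Psi> :: ((real^'m) \<times> real) set) F) \<and>
        hausdorff_measure (n - 1) (rotate_curve {..tmax} \<Phi> \<Psi> :: ((real^'m) \<times> real) set) < \<infinity>"
      using p.maximal_solution_diffeomorphism[OF max] p.maximal_solution_finite_volume[OF refl max]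
      by (simp add: n)
  qed
  show ?thesis
    using flat C integral height_integral negative by (intro conjI impI) blast+
qed

end
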